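(* Let $d\ge1$, $0\le r\le d$, let $\Gamma$ be a discrete subgroup of rank $r$ of $(\mathbb{R}^d,+)$, let $\nu>0$, and let $\chi$ be a character of $\Gamma$ with values in the unit circle, written $\chi(\gamma)=e^{2i\pi\langle\gamma,v_\chi\rangle}$ for $\gamma\in\Gamma$, with $v_\chi\in\mathrm{Span}_{\mathbb{R}}(\Gamma)$. Put $\widetilde{\Gamma}=\frac{1}{\sqrt2}\Gamma$ and $\widetilde{\chi}(\widetilde{\gamma})=e^{2i\pi\langle\widetilde{\gamma},\sqrt2 v_\chi\rangle}$ for $\widetilde\gamma\in\widetilde\Gamma$. Then the Segal-Bargmann transform $$[\mathcal{B}\varphi](z)=\left(\frac{\nu}{\pi}\right)^{\frac{3d}{4}}\int_{\mathbb{R}^d}e^{\sqrt2\nu\langle z,x\rangle-\frac{\nu}{2}\langle z,z\rangle}\varphi(x)e^{-\nu\|x\|^2}d\lambda(x),\qquad z\in\mathbb{C}^d,$$ defines an isometric isomorphism from $L^{2,\nu}_{\Gamma,\chi}(\mathbb{R}^d)$ onto $\mathcal{F}^{2,\nu}_{\widetilde\Gamma,\widetilde\chi}(\mathbb{C}^d)$.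
   Context: $\langle\cdot,\cdot\rangle$ and $\|\cdot\|$ are the usual scalar product and norm on $\mathbb{R}^d$; $\langle\cdot,\cdot\rangle$ also denotes the $\mathbb{C}$-bilinear extension $\langle z,w\rangle=\sum_{j=1}^d z_jw_j$ to $\mathbb{C}^d$, and $H(z,w)=\langle z,\overline{w}\rangle$ is the standard Hermitian product. $d\lambda$ denotes Lebesgue measure. A character satisfies $\chi(\gamma+\gamma')=\chi(\gamma)\chi(\gamma')$. $L^{2,\nu}_{\Gamma,\chi}(\mathbb{R}^d)$ is the Hilbert space of (classes, modulo a.e. equality, of) Borel measurable functions $f:\mathbb{R}^d\to\mathbb{C}$ such that $f(x+\gamma)=\chi(\gamma)e^{\nu\langle x+\gamma/2,\gamma\rangle}f(x)$ for almost every $x\in\mathbb{R}^d$ and every $\gamma\in\Gamma$, and $\|f\|_{\Gamma,\nu}^2:=\int_{\Lambda(\Gamma)}|f(x)|^2e^{-\nu\|x\|^2}d\lambda(x)<\infty$, where $\Lambda(\Gamma)$ is a fundamental domain of $\Gamma$ in $\mathbb{R}^d$ (the norm does not depend on its choice). For a discrete subgroup $\widetilde{\Gamma}$ of $(\mathbb{R}^d,+)$, viewed inside $\mathbb{C}^d=\mathbb{R}^d+i\mathbb{R}^d$, and a character $\widetilde\chi$ of it, $\mathcal{F}^{2,\nu}_{\widetilde\Gamma,\widetilde\chi}(\mathbb{C}^d)$ is the Hilbert space of all holomorphic functions $F$ on $\mathbb{C}^d$ such that $F(z+\widetilde\gamma)=\widetilde\chi(\widetilde\gamma)e^{\nu H(z+\widetilde\gamma/2,\widetilde\gamma)}F(z)$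 for all $z\in\mathbb{C}^d$, $\widetilde\gamma\in\widetilde\Gamma$, and $\|F\|_{\widetilde\Gamma,H}^2:=\int_{\widetilde{\Lambda}(\widetilde\Gamma)}|F(z)|^2e^{-\nu H(z,z)}d\lambda(z)<\infty$, where $\widetilde{\Lambda}(\widetilde\Gamma)$ is a fundamental domain of $\widetilde\Gamma$ in $\mathbb{C}^d=\mathbb{R}^{2d}$. *)

theory Defs
  imports "HOL-Analysis.Analysis"
begin

definition discrete_subgroup :: "'a::real_normed_vector set \<Rightarrow> bool" where
  "discrete_subgroup \<Gamma> \<longleftrightarrow>
     0 \<in> \<Gamma> \<and> (\<forall>x\<in>\<Gamma>. \<forall>y\<in>\<Gamma>. x + y \<in> \<Gamma>) \<and> (\<forall>x\<in>\<Gamma>. - x \<in> \<Gamma>) \<and> discrete \<Gamma>"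

abbreviation int_scale :: "int \<Rightarrow> 'a::real_vector \<Rightarrow> 'a" where
  "int_scale k x \<equiv> of_int k *\<^sub>R x"

text \<open>Rank in the sense of free abelian groups: existence of a basis over the integers with
  r elements. Linear independence over the reals is not built in.\<close>

definition has_rank :: "'a::real_vector set \<Rightarrow> nat \<Rightarrow> bool" where
  "has_rank \<Gamma> r \<longleftrightarrow>
     (\<exists>B. finite B \<and> card B = r \<and> \<not> module.dependent int_scale B \<and>
          module.span int_scale B = \<Gamma>)"

definition unitary_character :: "'a::ab_group_add set \<Rightarrow> ('a \<Rightarrow> complex) \<Rightarrow> bool" where
  "unitary_character \<Gamma> ch \<longleftrightarrow>
     (\<forall>g\<in>\<Gamma>. \<forall>h\<in>\<Gamma>. ch (g + h) = ch g * ch h) \<and> (\<forall>g\<in>\<Gamma>. cmod (ch g) = 1)"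

text \<open>Measurable fundamental domains, up to null sets: almost every point has exactly one
  translate in D. This covers exact fundamental domains as well as, say, closed
  parallelotopes.\<close>

definition fundamental_domain :: "'a::euclidean_space set \<Rightarrow> 'a set \<Rightarrow> bool" where
  "fundamental_domain \<Gamma> D \<longleftrightarrow>
     D \<in> sets borel \<and> (AE x in lborel. \<exists>!g. g \<in> \<Gamma> \<and> x - g \<in> D)"

definition cvec :: "real^'n \<Rightarrow> complex^'n" where
  "cvec x = (\<chi> j. complex_of_real (x $ j))"

definition bilin :: "complex^'n \<Rightarrow> complex^'n \<Rightarrow> complex" where
  "bilin z w = (\<Sum>j\<in>UNIV. z $ j * w $ j)"

definition herm :: "complex^'n \<Rightarrow> complex^'n \<Rightarrow> complex" where
  "herm z w = bilin z (\<chi> j. cnj (w $ j))"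

text \<open>Holomorphy in several variables: the Frechet derivative exists everywhere and is
  complex linear.\<close>

definition entire :: "(complex^'n \<Rightarrow> complex) \<Rightarrow> bool" where
  "entire F \<longleftrightarrow>
     (\<forall>z. \<exists>F'. (F has_derivative F') (at z) \<and> Vector_Spaces.linear (*s) (*) F')"

text \<open>Representatives of the elements of the theta-like \<open>L\<^sup>2\<close> space; a fundamental domain D is
  carried along as a parameter.\<close>

definition theta_L2 ::
  "(real^'n) set \<Rightarrow> (real^'n) set \<Rightarrow> (real^'n \<Rightarrow> complex) \<Rightarrow> real \<Rightarrow> (real^'n \<Rightarrow> complex) set" where
  "theta_L2 D \<Gamma> ch \<nu> =
     {f. f \<in> borel_measurable borel \<and>
         (\<forall>g\<in>\<Gamma>. AE x in lborel.
            f (x + g) = ch g * complex_of_real (exp (\<nu> * ((x + g /\<^sub>R 2) \<bullet> g))) * f x) \<and>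
         set_integrable lborel D (\<lambda>x. (cmod (f x))\<^sup>2 * exp (- \<nu> * (norm x)\<^sup>2))}"

definition theta_L2_norm :: "(real^'n) set \<Rightarrow> real \<Rightarrow> (real^'n \<Rightarrow> complex) \<Rightarrow> real" where
  "theta_L2_norm D \<nu> f =
     sqrt (LINT x:D|lborel. (cmod (f x))\<^sup>2 * exp (- \<nu> * (norm x)\<^sup>2))"

text \<open>The elements of the \<open>L\<^sup>2\<close> space itself are the classes in \<open>L // ae_eq_on L\<close>, where
  \<open>L = theta_L2 D \<Gamma> ch \<nu>\<close>.\<close>

definition ae_eq_on ::
  "('a::euclidean_space \<Rightarrow> complex) set \<Rightarrow> (('a \<Rightarrow> complex) \<times> ('a \<Rightarrow> complex)) set" where
  "ae_eq_on L = {(f, g). f \<in> L \<and> g \<in> L \<and> (AE x in lborel. f x = g x)}"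

text \<open>The subgroup \<open>\<Gamma>\<close> of real vectors is embedded into the complex space by \<open>cvec\<close>; E is a
  fundamental domain of \<open>cvec ` \<Gamma>\<close>. The number \<open>herm z z\<close> is real.\<close>

definition theta_Fock ::
  "(complex^'n) set \<Rightarrow> (real^'n) set \<Rightarrow> (real^'n \<Rightarrow> complex) \<Rightarrow> real \<Rightarrow> (complex^'n \<Rightarrow> complex) set" where
  "theta_Fock E \<Gamma> ch \<nu> =
     {F. entire F \<and>
         (\<forall>z. \<forall>g\<in>\<Gamma>.
            F (z + cvec g) =
              ch g * exp (complex_of_real \<nu> * herm (z + cvec g /\<^sub>R 2) (cvec g)) * F z) \<and>
         set_integrable lborel E (\<lambda>z. (cmod (F z))\<^sup>2 * exp (- \<nu> * Re (herm z z)))}"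

definition theta_Fock_norm :: "(complex^'n) set \<Rightarrow> real \<Rightarrow> (complex^'n \<Rightarrow> complex) \<Rightarrow> real" where
  "theta_Fock_norm E \<nu> F =
     sqrt (LINT z:E|lborel. (cmod (F z))\<^sup>2 * exp (- \<nu> * Re (herm z z)))"

definition bargmann_integrand ::
  "real \<Rightarrow> (real^'n \<Rightarrow> complex) \<Rightarrow> complex^'n \<Rightarrow> real^'n \<Rightarrow> complex" where
  "bargmann_integrand \<nu> \<phi> z x =
     exp (complex_of_real (sqrt 2 * \<nu>) * bilin z (cvec x) - complex_of_real (\<nu> / 2) * bilin z z)
       * \<phi> x * complex_of_real (exp (- \<nu> * (norm x)\<^sup>2))"

definition bargmann :: "real \<Rightarrow> (real^'n \<Rightarrow> complex) \<Rightarrow> complex^'n \<Rightarrow> complex" where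
  "bargmann \<nu> \<phi> z =
     complex_of_real ((\<nu> / pi) powr (3 * real CARD('n) / 4))
       * (LINT x|lborel. bargmann_integrand \<nu> \<phi> z x)"

end

theory Submission
  imports Defs "HOL-Probability.Characteristic_Functions" "HOL-Complex_Analysis.Conformal_Mappings"
begin

text \<open>Put \<open>t = 1/\<nu>\<close>. Multiplication by \<open>exp (-\<nu>|x|^2/2)\<close> turns a theta-like function into a function \<open>u\<close> with
  \<open>u(x+g) = ch(g) u(x)\<close>, and up to a constant the transform of \<open>\<phi>\<close> is \<open>exp (\<nu>/2 <z,z>) H u (sqrt 2 z)\<close>,
  where \<open>H\<close> is convolution with the heat kernel at time \<open>t\<close>, continued to complex arguments.
  For fixed real part \<open>a\<close>, \<open>H u (a+ib)\<close> is, up to explicit factors, the Fourier transform at \<open>b/t\<close> of \<open>u\<close> times a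
  Gaussian centred at \<open>a\<close>. The Plancherel identity in \<open>b\<close> followed by integration of \<open>a\<close> over a fundamental
  domain gives the isometry; no basis of the lattice and no theta series are involved.

  For surjectivity let \<open>p\<close> be an entire function with the required periodicity and finite energy. For \<open>s < t\<close> the integral
  of \<open>p(x+ib)\<close> against the heat kernel at time \<open>s\<close> in \<open>b\<close> converges and defines a function \<open>u_s\<close> whose heat transform
  at time \<open>s\<close> is \<open>p\<close>: on real arguments this is the mean value property for a rotation invariant Gaussian, and elsewhere it
  is analytic continuation. At time \<open>t\<close> the transform of \<open>u_s\<close> is \<open>p\<close> convolved with the heat kernel at time \<open>t-s\<close>, which
  converges to \<open>p\<close> pointwise without increasing the norm, hence in norm. By the isometry the functions \<open>u_s\<close> converge to a preimage of \<open>p\<close>.\<close>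

section \<open>Gaussian integrals\<close>

text \<open>The approximation in \<open>s\<close> is forced. Cauchy-Schwarz on an imaginary fibre
  pairs the squared kernel \<open>gauss_kernel s b\<close> with \<open>exp (|b|^2 / t)\<close>, a
  product that behaves like \<open>exp (- (1/s - 1/t) |b|^2)\<close>: integrable for
  \<open>s < t\<close>, constant for \<open>s = t\<close>. At the time that matters the estimate
  breaks down, so completeness of the L2 space has to supply the preimage. The other obstacle is
  size: a function with \<open>|u(x+g)| = |u(x)|\<close> has no decay along the lattice, and a
  fundamental domain may be unbounded. Convergence rests on one averaging estimate,
  \<open>gauss_weighted_bound\<close>, which controls Gaussian-weighted integrals over the whole
  space by the energy over one domain. The exponent \<open>3d/4\<close> balances four factors with
  product 1: the squared prefactor \<open>(\<nu>/pi)^(3d/2)\<close>, the squared normalisation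
  \<open>(2 pi/\<nu>)^d\<close> of the heat kernel, the mass \<open>(pi/\<nu>)^(d/2)\<close> of
  \<open>exp (- \<nu> |x|^2)\<close>, and the Jacobian \<open>2^(-d)\<close> of
  \<open>z -> sqrt 2 z\<close>.\<close>

lemma integrable_dominated:
  fixes f :: "'a \<Rightarrow> 'b::{banach,second_countable_topology}" and g :: "'a \<Rightarrow> real"
  assumes "integrable M g" "f \<in> borel_measurable M" "\<And>x. norm (f x) \<le> g x"
  shows "integrable M f"
  by (rule Bochner_Integration.integrable_bound[OF assms(1,2)]) (intro AE_I2 order_trans[OF assms(3)], simp)

lemma norm_add_sq_le: "(norm (x + y))\<^sup>2 \<le> 2 * (norm x)\<^sup>2 + 2 * (norm (y::'a::real_normed_vector))\<^sup>2"
proof -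
  have "(norm (x + y))\<^sup>2 \<le> (norm x + norm y)\<^sup>2"
    by (intro power_mono norm_triangle_ineq) simp
  also have "\<dots> \<le> 2 * (norm x)\<^sup>2 + 2 * (norm y)\<^sup>2"
    using zero_le_power2[of "norm x - norm y"] by (simp add: power2_eq_square algebra_simps)
  finally show ?thesis .
qed

lemma norm_diff_sq_le: "(norm (x - y))\<^sup>2 \<le> 2 * (norm x)\<^sup>2 + 2 * (norm (y::'a::real_normed_vector))\<^sup>2"
  using norm_add_sq_le[of x "- y"] by simp

section \<open>Affine substitutions in Lebesgue integrals\<close>

lemma borel_measurable_affine [measurable]:
  "(\<lambda>x::'a::euclidean_space. t + c *\<^sub>R x) \<in> borel_measurable borel"
  by simp

lemma nn_integral_lborel_affine:
  fixes t :: "'a::euclidean_space" and f :: "'a \<Rightarrow> ennreal"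
  assumes "c \<noteq> 0" and [measurable]: "f \<in> borel_measurable borel"
  shows "(\<integral>\<^sup>+x. f x \<partial>lborel) = ennreal (\<bar>c\<bar> ^ DIM('a)) * (\<integral>\<^sup>+x. f (t + c *\<^sub>R x) \<partial>lborel)"
  by (subst lborel_affine[OF assms(1), of t])
     (simp add: nn_integral_density nn_integral_distr nn_integral_cmult)

lemma integral_lborel_affine:
  fixes t :: "'a::euclidean_space" and f :: "'a \<Rightarrow> 'b::{banach,second_countable_topology}"
  assumes "c \<noteq> 0" and [measurable]: "f \<in> borel_measurable borel"
  shows "(\<integral>x. f x \<partial>lborel) = \<bar>c\<bar> ^ DIM('a) *\<^sub>R (\<integral>x. f (t + c *\<^sub>R x) \<partial>lborel)"
  by (subst lborel_affine[OF assms(1), of t])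
     (simp add: integral_density integral_distr)

lemma integrable_lborel_affine:
  fixes t :: "'a::euclidean_space" and f :: "'a \<Rightarrow> 'b::{banach,second_countable_topology}"
  assumes "c \<noteq> 0" and f: "integrable lborel f"
  shows "integrable lborel (\<lambda>x. f (t + c *\<^sub>R x))"
proof -
  have [measurable]: "f \<in> borel_measurable borel" using f by auto
  have "integrable (density (distr lborel borel (\<lambda>x. t + c *\<^sub>R x)) (\<lambda>_. \<bar>c\<bar> ^ DIM('a))) f"
    using f lborel_affine[OF assms(1), of t] by simp
  then show ?thesis
    using assms(1) integrable_scaleR_right[of "inverse (\<bar>c\<bar> ^ DIM('a))" lborel "\<lambda>x. \<bar>c\<bar> ^ DIM('a) *\<^sub>R f (t + c *\<^sub>R x)"]
    by (simp add: integrable_density integrable_distr_eq)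
qed

lemma nn_integral_translation:
  fixes t :: "'a::euclidean_space" and f :: "'a \<Rightarrow> ennreal"
  assumes [measurable]: "f \<in> borel_measurable borel"
  shows "(\<integral>\<^sup>+x. f (x + t) \<partial>lborel) = (\<integral>\<^sup>+x. f x \<partial>lborel)"
  using nn_integral_lborel_affine[of 1 f t] by (simp add: add.commute)

lemma integral_translation:
  fixes t :: "'a::euclidean_space" and f :: "'a \<Rightarrow> 'b::{banach,second_countable_topology}"
  assumes [measurable]: "f \<in> borel_measurable borel"
  shows "(\<integral>x. f (x + t) \<partial>lborel) = (\<integral>x. f x \<partial>lborel)"
  using integral_lborel_affine[of 1 f t] by (simp add: add.commute)

lemma integrable_translation:
  fixes t :: "'a::euclidean_space" and f :: "'a \<Rightarrow> 'b::{banach,second_countable_topology}"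
  assumes "integrable lborel f"
  shows "integrable lborel (\<lambda>x. f (x + t))"
  using integrable_lborel_affine[OF _ assms, of 1 t] by (simp add: add.commute)

lemma AE_translation:
  fixes t :: "'a::euclidean_space"
  assumes "AE x in lborel. P x"
  shows "AE x in lborel. P (x + t)"
proof -
  obtain N where N: "{x. \<not> P x} \<subseteq> N" "N \<in> sets lborel" "emeasure lborel N = 0"
    using assms by (auto elim!: AE_E)
  have [measurable]: "N \<in> sets borel" using N by simp
  have "(\<integral>\<^sup>+x. indicator N (x + t) \<partial>lborel) = 0"
    using N by (subst nn_integral_translation) auto
  then have "AE x in lborel. indicator N (x + t) = (0::ennreal)"
    by (subst (asm) nn_integral_0_iff_AE) auto
  then show ?thesis
    by eventually_elim (use N in \<open>auto simp: indicator_def split: if_splits\<close>)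
qed

section \<open>Gaussian integrals and their Fourier transforms on Euclidean spaces\<close>

lemma
  fixes f :: "'a::euclidean_space \<Rightarrow> real \<Rightarrow> complex"
  assumes f: "\<And>b. b \<in> Basis \<Longrightarrow> integrable lborel (f b)"
  shows integrable_lborel_prod_Basis: "integrable lborel (\<lambda>x. \<Prod>b\<in>Basis. f b (x \<bullet> b))"
    and integral_lborel_prod_Basis:
      "(\<integral>x. (\<Prod>b\<in>Basis. f b (x \<bullet> b)) \<partial>lborel) = (\<Prod>b\<in>Basis. \<integral>x. f b x \<partial>lborel)"
proof -
  interpret product_sigma_finite "\<lambda>_::'a. lborel :: real measure"
    by standard
  \<comment> \<open>\<open>lborel\<close> on a Euclidean space is the image under \<open>?h\<close>
    of a finite product of one-dimensional Lebesgue measures, so Fubini for finite products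
    applies.\<close>
  let ?h = "\<lambda>g::'a \<Rightarrow> real. \<Sum>b\<in>Basis. g b *\<^sub>R b"
  have [measurable]: "\<And>b. b \<in> Basis \<Longrightarrow> f b \<in> borel_measurable borel" using f by auto
  have F [measurable]: "(\<lambda>x::'a. \<Prod>b\<in>Basis. f b (x \<bullet> b)) \<in> borel_measurable borel" by measurable
  have *: "(\<Prod>b\<in>Basis. f b (?h g \<bullet> b)) = (\<Prod>b\<in>Basis. f b (g b))" for g
    by (intro prod.cong refl) simp
  have m: "?h \<in> (\<Pi>\<^sub>M b\<in>Basis. lborel) \<rightarrow>\<^sub>M borel" by measurable
  show "integrable lborel (\<lambda>x::'a. \<Prod>b\<in>Basis. f b (x \<bullet> b))"
    unfolding lborel_eq[where 'a='a] integrable_distr_eq[OF m F] *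
    by (rule product_integrable_prod) (auto intro: f)
  show "(\<integral>x. (\<Prod>b\<in>Basis. f b (x \<bullet> b)) \<partial>(lborel::'a measure)) = (\<Prod>b\<in>Basis. \<integral>x. f b x \<partial>lborel)"
    unfolding lborel_eq[where 'a='a] integral_distr[OF m F] *
    by (rule product_integral_prod) (auto intro: f)
qed

text \<open>This is the characteristic function of the standard normal law, cleared of the density
  constant \<open>1 / sqrt (2 pi)\<close>.\<close>

lemma
  fixes s :: real
  shows integrable_gauss_fourier_real:
      "integrable lborel (\<lambda>x::real. exp (\<i> * complex_of_real (x * s)) * complex_of_real (exp (- x\<^sup>2 / 2)))"
    and integral_gauss_fourier_real:
      "(\<integral>x. exp (\<i> * complex_of_real (x * s)) * complex_of_real (exp (- x\<^sup>2 / 2)) \<partial>lborel)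
        = complex_of_real (sqrt (2 * pi) * exp (- s\<^sup>2 / 2))"
proof -
  have i0: "integrable lborel std_normal_density"
    by (rule integrable_normal_density) simp
  have "integrable lborel (\<lambda>x::real. exp (- x\<^sup>2 / 2))"
    using integrable_mult_right[OF i0, of "sqrt (2*pi)"] by (simp add: std_normal_density_def)
  then have i1: "integrable lborel (\<lambda>x::real. complex_of_real (exp (- x\<^sup>2 / 2)))" by simp
  show i: "integrable lborel (\<lambda>x::real. exp (\<i> * complex_of_real (x * s)) * complex_of_real (exp (- x\<^sup>2 / 2)))"
    by (rule Bochner_Integration.integrable_bound[OF i1]) (auto simp: norm_mult)
  have "complex_of_real (exp (- s\<^sup>2 / 2)) = (\<integral>x. iexp (s * x) \<partial>std_normal_distribution)"
    using char_std_normal_distribution by (simp add: char_def fun_eq_iff)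
  also have "\<dots> = (\<integral>x. std_normal_density x *\<^sub>R iexp (s * x) \<partial>lborel)"
    by (rule integral_density) (auto simp: normal_density_nonneg)
  also have "\<dots> = (\<integral>x. complex_of_real (1 / sqrt (2*pi)) * (exp (\<i> * complex_of_real (x * s)) * complex_of_real (exp (- x\<^sup>2 / 2))) \<partial>lborel)"
    by (intro Bochner_Integration.integral_cong refl)
       (simp add: std_normal_density_def scaleR_conv_of_real mult_ac)
  also have "\<dots> = complex_of_real (1 / sqrt (2*pi)) * (\<integral>x. exp (\<i> * complex_of_real (x * s)) * complex_of_real (exp (- x\<^sup>2 / 2)) \<partial>lborel)"
    by (rule integral_mult_right_zero)
  finally show "(\<integral>x. exp (\<i> * complex_of_real (x * s)) * complex_of_real (exp (- x\<^sup>2 / 2)) \<partial>lborel)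
        = complex_of_real (sqrt (2 * pi) * exp (- s\<^sup>2 / 2))"
    by (simp add: field_simps)
qed

lemma norm_eq_sum_Basis: "(norm (x::'a::euclidean_space))\<^sup>2 = (\<Sum>b\<in>Basis. (x \<bullet> b)\<^sup>2)"
  unfolding power2_norm_eq_inner by (subst euclidean_inner) (simp add: power2_eq_square)

lemma
  fixes y :: "'a::euclidean_space"
  shows integrable_gauss_fourier_1:
      "integrable lborel (\<lambda>x::'a. exp (\<i> * complex_of_real (x \<bullet> y)) * complex_of_real (exp (- (norm x)\<^sup>2 / 2)))"
    and integral_gauss_fourier_1:
      "(\<integral>x. exp (\<i> * complex_of_real (x \<bullet> y)) * complex_of_real (exp (- (norm x)\<^sup>2 / 2)) \<partial>lborel)
        = complex_of_real (sqrt (2 * pi) ^ DIM('a) * exp (- (norm y)\<^sup>2 / 2))"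
proof -
  let ?f = "\<lambda>b x. exp (\<i> * complex_of_real (x * (y \<bullet> b))) * complex_of_real (exp (- x\<^sup>2 / 2))"
  have eq: "exp (\<i> * complex_of_real (x \<bullet> y)) * complex_of_real (exp (- (norm x)\<^sup>2 / 2)) = (\<Prod>b\<in>Basis. ?f b (x \<bullet> b))" for x :: 'a
    unfolding prod.distrib norm_eq_sum_Basis euclidean_inner[of x y]
    by (simp add: exp_sum sum_distrib_left sum_divide_distrib sum_negf[symmetric] exp_of_real[symmetric])
  have eq2: "complex_of_real (sqrt (2 * pi) ^ DIM('a) * exp (- (norm y)\<^sup>2 / 2)) =
     (\<Prod>b\<in>Basis. complex_of_real (sqrt (2 * pi) * exp (- (y \<bullet> b)\<^sup>2 / 2)))"
    unfolding norm_eq_sum_Basis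
    by (simp add: prod.distrib exp_sum sum_divide_distrib sum_negf[symmetric])
  show "integrable lborel (\<lambda>x::'a. exp (\<i> * complex_of_real (x \<bullet> y)) * complex_of_real (exp (- (norm x)\<^sup>2 / 2)))"
    unfolding eq by (intro integrable_lborel_prod_Basis integrable_gauss_fourier_real)
  show "(\<integral>x. exp (\<i> * complex_of_real (x \<bullet> y)) * complex_of_real (exp (- (norm x)\<^sup>2 / 2)) \<partial>lborel)
        = complex_of_real (sqrt (2 * pi) ^ DIM('a) * exp (- (norm y)\<^sup>2 / 2))"
    unfolding eq eq2
    by (subst integral_lborel_prod_Basis)
       (auto intro!: integrable_gauss_fourier_real prod.cong simp only: integral_gauss_fourier_real)
qed

lemma
  fixes y :: "'a::euclidean_space"
  assumes t: "t > 0"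
  shows integrable_gauss_fourier:
      "integrable lborel (\<lambda>x::'a. exp (\<i> * complex_of_real (x \<bullet> y)) * complex_of_real (exp (- (norm x)\<^sup>2 / (2 * t))))"
    and integral_gauss_fourier:
      "(\<integral>x. exp (\<i> * complex_of_real (x \<bullet> y)) * complex_of_real (exp (- (norm x)\<^sup>2 / (2 * t))) \<partial>lborel)
        = complex_of_real (sqrt (2 * pi * t) ^ DIM('a) * exp (- t * (norm y)\<^sup>2 / 2))"
proof -
  let ?g = "\<lambda>x::'a. exp (\<i> * complex_of_real (x \<bullet> (sqrt t *\<^sub>R y))) * complex_of_real (exp (- (norm x)\<^sup>2 / 2))"
  have eq: "exp (\<i> * complex_of_real (x \<bullet> y)) * complex_of_real (exp (- (norm x)\<^sup>2 / (2 * t))) = ?g (0 + (1 / sqrt t) *\<^sub>R x)" for x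
    using t by (simp add: field_simps power_divide)
  show "integrable lborel (\<lambda>x::'a. exp (\<i> * complex_of_real (x \<bullet> y)) * complex_of_real (exp (- (norm x)\<^sup>2 / (2 * t))))"
    unfolding eq using t by (intro integrable_lborel_affine integrable_gauss_fourier_1) simp
  have "complex_of_real (sqrt (2 * pi) ^ DIM('a) * exp (- t * (norm y)\<^sup>2 / 2)) = (\<integral>x. ?g x \<partial>lborel)"
    using t by (subst integral_gauss_fourier_1) (simp add: power_mult_distrib)
  also have "\<dots> = \<bar>1 / sqrt t\<bar> ^ DIM('a) *\<^sub>R (\<integral>x. ?g (0 + (1 / sqrt t) *\<^sub>R x) \<partial>lborel)"
    using t by (intro integral_lborel_affine) auto
  finally show "(\<integral>x. exp (\<i> * complex_of_real (x \<bullet> y)) * complex_of_real (exp (- (norm x)\<^sup>2 / (2 * t))) \<partial>lborel)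
        = complex_of_real (sqrt (2 * pi * t) ^ DIM('a) * exp (- t * (norm y)\<^sup>2 / 2))"
    unfolding eq using t
    by (simp add: scaleR_conv_of_real real_sqrt_mult power_mult_distrib power_divide field_simps)
qed

lemma
  fixes dummy :: "'a::euclidean_space"
  assumes t: "t > 0"
  shows integrable_gauss: "integrable lborel (\<lambda>x::'a. exp (- (norm x)\<^sup>2 / (2 * t)))"
    and integral_gauss: "(\<integral>x. exp (- (norm x)\<^sup>2 / (2 * t)) \<partial>(lborel::'a measure)) = sqrt (2 * pi * t) ^ DIM('a)"
proof -
  have "integrable lborel (\<lambda>x::'a. complex_of_real (exp (- (norm x)\<^sup>2 / (2 * t))))"
    using integrable_gauss_fourier[OF t, of 0] by (simp del: of_real_exp)
  then show i: "integrable lborel (\<lambda>x::'a. exp (- (norm x)\<^sup>2 / (2 * t)))"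
    by (simp only: complex_of_real_integrable_eq)
  have "complex_of_real (\<integral>x. exp (- (norm x)\<^sup>2 / (2 * t)) \<partial>(lborel::'a measure)) = complex_of_real (sqrt (2 * pi * t) ^ DIM('a))"
    using integral_gauss_fourier[OF t, of 0]
    by (simp del: of_real_exp of_real_power of_real_mult add: integral_complex_of_real)
  then show "(\<integral>x. exp (- (norm x)\<^sup>2 / (2 * t)) \<partial>(lborel::'a measure)) = sqrt (2 * pi * t) ^ DIM('a)"
    by (simp only: of_real_eq_iff)
qed

lemma nn_integral_gauss:
  assumes t: "t > 0"
  shows "(\<integral>\<^sup>+x. ennreal (exp (- (norm x)\<^sup>2 / (2 * t))) \<partial>(lborel::'a::euclidean_space measure)) = ennreal (sqrt (2 * pi * t) ^ DIM('a))"
  by (subst nn_integral_eq_integral[OF integrable_gauss[OF t]]) (simp_all only: integral_gauss[OF t] exp_ge_zero AE_I2)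

section \<open>Continuity of translations in the mean\<close>

text \<open>Density arguments come in this form: up to an arbitrary error \<open>e\<close> the
  quantity is bounded by that of a better object, whose limit is known.\<close>

lemma tendsto_zero_approx:
  fixes a :: "nat \<Rightarrow> real"
  assumes "\<And>k. 0 \<le> a k"
    and "\<And>e. e > 0 \<Longrightarrow> \<exists>b. b \<longlonglongrightarrow> 0 \<and> (\<forall>k. a k \<le> b k + e)"
  shows "a \<longlonglongrightarrow> 0"
proof (rule LIMSEQ_I)
  fix r :: real assume r: "0 < r"
  obtain b where b: "b \<longlonglongrightarrow> 0" "\<And>k. a k \<le> b k + r/2" using assms(2)[of "r/2"] r by auto
  from LIMSEQ_D[OF b(1), of "r/2"] r obtain N where N: "\<And>n. n \<ge> N \<Longrightarrow> \<bar>b n\<bar> < r/2" by auto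
  have "norm (a n - 0) < r" if "n \<ge> N" for n
    using N[OF that] b(2)[of n] assms(1)[of n] by simp
  then show "\<exists>no. \<forall>n\<ge>no. norm (a n - 0) < r" by blast
qed

lemma tendsto_zero_le:
  fixes a b :: "nat \<Rightarrow> real"
  assumes "\<And>k. 0 \<le> a k" "\<And>k. a k \<le> b k" "b \<longlonglongrightarrow> 0"
  shows "a \<longlonglongrightarrow> 0"
  using assms by (intro tendsto_sandwich[OF _ _ tendsto_const assms(3)]) simp_all

text \<open>The factor \<open>indicat_real U x\<close> matters: at boundary points of
  \<open>U\<close> the translated indicator alone may fail to converge, while the product is
  constantly 0 there.\<close>

lemma open_indicator_translate_tendsto:
  fixes y :: "nat \<Rightarrow> 'a::real_normed_vector"
  assumes "open U" "y \<longlonglongrightarrow> 0"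
  shows "(\<lambda>k. indicat_real U x * indicat_real U (x + y k)) \<longlonglongrightarrow> indicat_real U x"
proof (cases "x \<in> U")
  case True
  have "(\<lambda>k. x + y k) \<longlonglongrightarrow> x + 0" by (intro tendsto_intros assms)
  then have "\<forall>\<^sub>F k in sequentially. x + y k \<in> U"
    using True assms(1) by (auto elim: topological_tendstoD)
  then have "\<forall>\<^sub>F k in sequentially. indicat_real U x * indicat_real U (x + y k) = indicat_real U x"
    by eventually_elim simp
  then show ?thesis by (rule tendsto_eventually)
qed simp

text \<open>For indicators \<open>|p - q| = p + q - 2 p q\<close>, and translation preserves the
  measure of \<open>U\<close>. Only the overlap of \<open>U\<close> with its translate needs a
  limit, which dominated convergence provides.\<close>

lemma L1_translation_indicator_open:
  fixes U :: "'a::euclidean_space set"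
  assumes U: "open U" "emeasure lborel U < \<infinity>" and y: "y \<longlonglongrightarrow> 0"
  shows "(\<lambda>k. \<integral>x. \<bar>indicat_real U (x + y k) - indicat_real U x\<bar> \<partial>lborel) \<longlonglongrightarrow> 0"
proof -
  have [measurable]: "U \<in> sets borel" using U by simp
  have iU: "integrable lborel (indicat_real U)" using U by (simp add: integrable_indicator_iff)
  have iT: "integrable lborel (\<lambda>x. indicat_real U (x + y k))" for k
    by (rule integrable_translation[OF iU])
  have iP: "integrable lborel (\<lambda>x. indicat_real U x * indicat_real U (x + y k))" for k
    by (rule Bochner_Integration.integrable_bound[OF iU]) (auto simp: indicator_def)
  have "(\<integral>x. \<bar>indicat_real U (x + y k) - indicat_real U x\<bar> \<partial>lborel)
     = (\<integral>x. indicat_real U (x + y k) + indicat_real U x - 2 * (indicat_real U x * indicat_real U (x + y k)) \<partial>lborel)" for k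
    by (intro Bochner_Integration.integral_cong) (auto simp: indicator_def)
  also have "\<dots> k = 2 * measure lborel U - 2 * (\<integral>x. indicat_real U x * indicat_real U (x + y k) \<partial>lborel)" for k
    using iU iT iP integral_translation[of "indicat_real U" "y k"] by simp
  finally have eq: "(\<integral>x. \<bar>indicat_real U (x + y k) - indicat_real U x\<bar> \<partial>lborel)
     = 2 * measure lborel U - 2 * (\<integral>x. indicat_real U x * indicat_real U (x + y k) \<partial>lborel)" for k .
  have "(\<lambda>k. \<integral>x. indicat_real U x * indicat_real U (x + y k) \<partial>lborel) \<longlonglongrightarrow> (\<integral>x. indicat_real U x \<partial>lborel)"
    by (rule integral_dominated_convergence[where w="indicat_real U"])
       (auto simp: iU open_indicator_translate_tendsto[OF U(1) y], auto simp: indicator_def)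
  then have "(\<lambda>k. 2 * measure lborel U - 2 * (\<integral>x. indicat_real U x * indicat_real U (x + y k) \<partial>lborel)) \<longlonglongrightarrow> 2 * measure lborel U - 2 * measure lborel U"
    by (intro tendsto_intros) simp
  then show ?thesis unfolding eq by simp
qed

text \<open>Outer regularity: \<open>A\<close> is replaced by an open \<open>U\<close> of finite
  measure, and each of the two indicators changes by at most the indicator of the small excess
  \<open>U - A\<close>.\<close>

lemma L1_translation_indicator:
  fixes A :: "'a::euclidean_space set"
  assumes A: "A \<in> sets borel" "emeasure lborel A < \<infinity>" and y: "y \<longlonglongrightarrow> 0"
  shows "(\<lambda>k. \<integral>x. \<bar>indicat_real A (x + y k) - indicat_real A x\<bar> \<partial>lborel) \<longlonglongrightarrow> 0"
proof (rule tendsto_zero_approx)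
  fix e :: real assume e: "e > 0"
  obtain U where U: "open U" "A \<subseteq> U" "emeasure lborel (U - A) < ennreal (e/2)"
    using outer_regular_lborel[OF A(1), of "e/2"] e by auto
  have [measurable]: "U \<in> sets borel" "A \<in> sets borel" using U A by auto
  have fd: "emeasure lborel (U - A) < \<infinity>" using U(3) by (rule order_less_trans) simp
  have "emeasure lborel U = emeasure lborel (A \<union> (U - A))" using U(2) by (simp add: Un_absorb1)
  also have "\<dots> \<le> emeasure lborel A + emeasure lborel (U - A)" by (intro emeasure_subadditive) auto
  also have "\<dots> < \<infinity>" using A(2) fd by (simp add: ennreal_add_less_top)
  finally have fU: "emeasure lborel U < \<infinity>" .
  have iU: "integrable lborel (indicat_real U)" "integrable lborel (indicat_real A)" "integrable lborel (indicat_real (U - A))"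
    using fU A(2) fd by (auto simp: integrable_indicator_iff)
  note iT = iU[THEN integrable_translation]
  have m: "measure lborel (U - A) \<le> e/2"
    unfolding measure_def using U(3) e by (intro enn2real_leI) auto
  have "(\<integral>x. \<bar>indicat_real A (x + y k) - indicat_real A x\<bar> \<partial>lborel)
    \<le> (\<integral>x. \<bar>indicat_real U (x + y k) - indicat_real U x\<bar> \<partial>lborel) + e" for k
  proof -
    have "(\<integral>x. \<bar>indicat_real A (x + y k) - indicat_real A x\<bar> \<partial>lborel)
       \<le> (\<integral>x. \<bar>indicat_real U (x + y k) - indicat_real U x\<bar> + (indicat_real (U - A) (x + y k) + indicat_real (U - A) x) \<partial>lborel)"
    proof (rule integral_mono)
      show "\<bar>indicat_real A (x + y k) - indicat_real A x\<bar> \<le> \<bar>indicat_real U (x + y k) - indicat_real U x\<bar> + (indicat_real (U - A) (x + y k) + indicat_real (U - A) x)" for x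
        using U(2) by (auto simp: indicator_def)
    qed (intro Bochner_Integration.integrable_add Bochner_Integration.integrable_diff integrable_abs iU iT)+
    also have "\<dots> = (\<integral>x. \<bar>indicat_real U (x + y k) - indicat_real U x\<bar> \<partial>lborel) + (measure lborel (U - A) + measure lborel (U - A))"
      using iU iT integral_translation[of "indicat_real (U - A)" "y k"] by simp
    finally show ?thesis using m by simp
  qed
  then show "\<exists>b. b \<longlonglongrightarrow> 0 \<and> (\<forall>k. (\<integral>x. \<bar>indicat_real A (x + y k) - indicat_real A x\<bar> \<partial>lborel) \<le> b k + e)"
    using L1_translation_indicator_open[OF U(1) fU y] by blast
qed simp

text \<open>Induction over integrable functions. In the limit case the approximation error enters
  twice, and by translation invariance the translated copy is no larger than the original.\<close>

lemma L1_translation: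
  fixes f :: "'a::euclidean_space \<Rightarrow> 'b::{banach,second_countable_topology}"
  assumes f: "integrable lborel f" and y: "y \<longlonglongrightarrow> 0"
  shows "(\<lambda>k. \<integral>x. norm (f (x + y k) - f x) \<partial>lborel) \<longlonglongrightarrow> 0"
  using f
proof (induction rule: integrable_induct)
  case (base A c)
  have eq: "norm (indicat_real A (x + y k) *\<^sub>R c - indicat_real A x *\<^sub>R c) = \<bar>indicat_real A (x + y k) - indicat_real A x\<bar> * norm c" for x k
    by (metis norm_scaleR real_norm_def scaleR_left_diff_distrib)
  have "(\<lambda>k. (\<integral>x. \<bar>indicat_real A (x + y k) - indicat_real A x\<bar> \<partial>lborel) * norm c) \<longlonglongrightarrow> 0 * norm c"
    using base y by (intro tendsto_intros L1_translation_indicator) auto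
  then show ?case unfolding eq by simp
next
  case (add f g)
  note i = add.hyps add.hyps[THEN integrable_translation]
  have "(\<integral>x. norm (f (x + y k) + g (x + y k) - (f x + g x)) \<partial>lborel) \<le>
     (\<integral>x. norm (f (x + y k) - f x) \<partial>lborel) + (\<integral>x. norm (g (x + y k) - g x) \<partial>lborel)" for k
  proof -
    have "(\<integral>x. norm (f (x + y k) + g (x + y k) - (f x + g x)) \<partial>lborel) \<le> (\<integral>x. norm (f (x + y k) - f x) + norm (g (x + y k) - g x) \<partial>lborel)"
      by (intro integral_mono norm_diff_triangle_ineq integrable_norm Bochner_Integration.integrable_add Bochner_Integration.integrable_diff i)
    also have "\<dots> = (\<integral>x. norm (f (x + y k) - f x) \<partial>lborel) + (\<integral>x. norm (g (x + y k) - g x) \<partial>lborel)"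
      by (intro Bochner_Integration.integral_add integrable_norm Bochner_Integration.integrable_diff i)
    finally show ?thesis .
  qed
  then show ?case
    by (rule tendsto_zero_le[rotated]) (use tendsto_add[OF add.IH] in simp, rule integral_nonneg_AE, rule AE_I2, rule norm_ge_zero)
next
  case (lim f s)
  note i = lim.hyps(4,1) lim.hyps(4,1)[THEN integrable_translation]
  have L: "(\<lambda>i. \<integral>x. norm (f x - s i x) \<partial>lborel) \<longlonglongrightarrow> (\<integral>x. 0 \<partial>(lborel::'a measure))"
  proof (rule integral_dominated_convergence[where w="\<lambda>x. 3 * norm (f x)"])
    show "AE x in lborel. (\<lambda>i. norm (f x - s i x)) \<longlonglongrightarrow> 0"
    proof (intro AE_I2)
      fix x :: 'a
      have "(\<lambda>i. norm (f x - s i x)) \<longlonglongrightarrow> norm (f x - f x)"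
        by (intro tendsto_intros lim.hyps) simp
      then show "(\<lambda>i. norm (f x - s i x)) \<longlonglongrightarrow> 0" by simp
    qed
    show "AE x in lborel. norm (norm (f x - s i x)) \<le> 3 * norm (f x)" for i
    proof (intro AE_I2)
      fix x :: 'a
      have "norm (f x - s i x) \<le> norm (f x) + norm (s i x)" by (rule norm_triangle_ineq4)
      with lim.hyps(3)[of x i] show "norm (norm (f x - s i x)) \<le> 3 * norm (f x)" by simp
    qed
  qed (use i in auto)
  show ?case
  proof (rule tendsto_zero_approx)
    fix e :: real assume e: "e > 0"
    from LIMSEQ_D[OF L, of "e/2"] e obtain N where N: "(\<integral>x. norm (f x - s N x) \<partial>lborel) < e/2" by auto
    have "(\<integral>x. norm (f (x + y k) - f x) \<partial>lborel) \<le> (\<integral>x. norm (s N (x + y k) - s N x) \<partial>lborel) + e" for k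
    proof -
      have "(\<integral>x. norm (f (x + y k) - f x) \<partial>lborel) \<le>
        (\<integral>x. norm (s N (x + y k) - s N x) + (norm (f (x + y k) - s N (x + y k)) + norm (f x - s N x)) \<partial>lborel)"
      proof (rule integral_mono)
        fix x
        have "f (x + y k) - f x = (s N (x + y k) - s N x) + ((f (x + y k) - s N (x + y k)) - (f x - s N x))" by simp
        then show "norm (f (x + y k) - f x) \<le> norm (s N (x + y k) - s N x) + (norm (f (x + y k) - s N (x + y k)) + norm (f x - s N x))"
          by (metis norm_triangle_mono norm_triangle_ineq4 order_refl)
      qed (use i in auto)
      also have "\<dots> = (\<integral>x. norm (s N (x + y k) - s N x) \<partial>lborel) + ((\<integral>x. norm (f x - s N x) \<partial>lborel) + (\<integral>x. norm (f x - s N x) \<partial>lborel))"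
        using i integral_translation[of "\<lambda>x. norm (f x - s N x)" "y k"] by simp
      finally show ?thesis using N by simp
    qed
    then show "\<exists>b. b \<longlonglongrightarrow> 0 \<and> (\<forall>k. (\<integral>x. norm (f (x + y k) - f x) \<partial>lborel) \<le> b k + e)"
      using lim.IH by blast
  qed simp
qed

section \<open>The Plancherel identity\<close>

lemma borel_measurable_cnj [measurable (raw)]:
  "f \<in> borel_measurable M \<Longrightarrow> (\<lambda>x. cnj (f x)) \<in> borel_measurable M"
  by (rule borel_measurable_continuous_on[where f=cnj]) (intro continuous_intros)

lemma cmod_diff_sq: "(cmod (a - b))\<^sup>2 = (cmod a)\<^sup>2 + (cmod b)\<^sup>2 - 2 * Re (a * cnj b)"
  unfolding cmod_power2 by (simp add: power2_eq_square algebra_simps)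

lemma integrable_cmod_diff_sq:
  assumes [measurable]: "f \<in> borel_measurable M" "g \<in> borel_measurable M"
    and "integrable M (\<lambda>x. (cmod (f x))\<^sup>2)" "integrable M (\<lambda>x. (cmod (g x))\<^sup>2)"
  shows "integrable M (\<lambda>x. (cmod (f x - g x))\<^sup>2)"
proof (rule integrable_dominated)
  show "integrable M (\<lambda>x. 2 * (cmod (f x))\<^sup>2 + 2 * (cmod (g x))\<^sup>2)"
    by (intro Bochner_Integration.integrable_add integrable_mult_right assms)
qed (simp_all add: norm_diff_sq_le)

text \<open>Truncating the values at height \<open>n\<close> bounds the square by \<open>2 n\<close>
  times a first power, so continuity in the L1 mean suffices; the truncation error is small in L2 by
  dominated convergence.\<close>

lemma L2_translation:
  fixes h :: "'a::euclidean_space \<Rightarrow> complex"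
  assumes h: "integrable lborel h" and h2: "integrable lborel (\<lambda>x. (cmod (h x))\<^sup>2)" and y: "y \<longlonglongrightarrow> 0"
  shows "(\<lambda>k. \<integral>x. (cmod (h (x + y k) - h x))\<^sup>2 \<partial>lborel) \<longlonglongrightarrow> 0"
proof (rule tendsto_zero_approx)
  fix e :: real assume e: "e > 0"
  have [measurable]: "h \<in> borel_measurable borel" using h by auto
  define T where "T = (\<lambda>(n::nat) x. if cmod (h x) \<le> n then h x else 0)"
  have [measurable]: "T n \<in> borel_measurable borel" for n unfolding T_def by measurable
  have Tle: "cmod (T n x) \<le> cmod (h x)" "cmod (h x - T n x) \<le> cmod (h x)" "cmod (T n x) \<le> n" for n x
    unfolding T_def by auto
  have iT: "integrable lborel (T n)" for n
    by (rule Bochner_Integration.integrable_bound[OF h]) (auto simp: Tle)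
  have id: "integrable lborel (\<lambda>x. (cmod (h x - T n x))\<^sup>2)" for n
    by (rule Bochner_Integration.integrable_bound[OF h2]) (auto intro!: power_mono simp: Tle)
  have iT2: "integrable lborel (\<lambda>x. (cmod (T n x))\<^sup>2)" for n
    by (rule Bochner_Integration.integrable_bound[OF h2]) (auto intro!: power_mono simp: Tle)
  have "(\<lambda>n. \<integral>x. (cmod (h x - T n x))\<^sup>2 \<partial>lborel) \<longlonglongrightarrow> (\<integral>x. 0 \<partial>(lborel::'a measure))"
  proof (rule integral_dominated_convergence[where w="\<lambda>x. (cmod (h x))\<^sup>2"])
    show "AE x in lborel. (\<lambda>n. (cmod (h x - T n x))\<^sup>2) \<longlonglongrightarrow> 0"
    proof (intro AE_I2 tendsto_eventually)
      fix x :: 'a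
      show "\<forall>\<^sub>F n in sequentially. (cmod (h x - T n x))\<^sup>2 = 0"
        using eventually_ge_at_top[of "nat \<lceil>cmod (h x)\<rceil>"]
      proof eventually_elim
        case (elim n)
        then have "cmod (h x) \<le> real n" by linarith
        then show ?case by (simp add: T_def)
      qed
    qed
    show "AE x in lborel. norm ((cmod (h x - T n x))\<^sup>2) \<le> (cmod (h x))\<^sup>2" for n
      by (auto intro!: power_mono simp: Tle)
  qed (use h2 in measurable)
  then have "(\<lambda>n. \<integral>x. (cmod (h x - T n x))\<^sup>2 \<partial>lborel) \<longlonglongrightarrow> 0" by simp
  \<comment> \<open>The truncation error enters four times at \<open>x\<close> and four times at
    \<open>x + y k\<close>, hence the threshold \<open>e/8\<close>.\<close>
  from LIMSEQ_D[OF this, of "e/8"] e obtain n where n: "(\<integral>x. (cmod (h x - T n x))\<^sup>2 \<partial>lborel) < e/8" by auto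
  have i1: "integrable lborel (\<lambda>x. (cmod (h (x + y k) - h x))\<^sup>2)" for k
    using integrable_translation[OF h2] h2 by (intro integrable_cmod_diff_sq) auto
  have i2: "integrable lborel (\<lambda>x. cmod (T n (x + y k) - T n x))" for k
    by (intro integrable_norm Bochner_Integration.integrable_diff integrable_translation iT)
  have "(\<integral>x. (cmod (h (x + y k) - h x))\<^sup>2 \<partial>lborel) \<le>
     4 * n * (\<integral>x. cmod (T n (x + y k) - T n x) \<partial>lborel) + e" for k
  proof -
    have "(\<integral>x. (cmod (h (x + y k) - h x))\<^sup>2 \<partial>lborel) \<le>
      (\<integral>x. 4 * n * cmod (T n (x + y k) - T n x) + (4 * (cmod (h (x + y k) - T n (x + y k)))\<^sup>2 + 4 * (cmod (h x - T n x))\<^sup>2) \<partial>lborel)"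
    proof (rule integral_mono)
      show "integrable lborel (\<lambda>x. 4 * n * cmod (T n (x + y k) - T n x) + (4 * (cmod (h (x + y k) - T n (x + y k)))\<^sup>2 + 4 * (cmod (h x - T n x))\<^sup>2))"
        by (intro Bochner_Integration.integrable_add integrable_mult_right i2 id integrable_translation[OF id])
      fix x
      have "(cmod (h (x + y k) - h x))\<^sup>2 \<le> 2 * (cmod (T n (x + y k) - T n x))\<^sup>2
         + 2 * (cmod ((h (x + y k) - T n (x + y k)) - (h x - T n x)))\<^sup>2"
        using norm_add_sq_le[of "T n (x + y k) - T n x" "(h (x + y k) - T n (x + y k)) - (h x - T n x)"] by simp
      moreover have "(cmod ((h (x + y k) - T n (x + y k)) - (h x - T n x)))\<^sup>2 \<le>
         2 * (cmod (h (x + y k) - T n (x + y k)))\<^sup>2 + 2 * (cmod (h x - T n x))\<^sup>2"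
        by (rule norm_diff_sq_le)
      moreover have "(cmod (T n (x + y k) - T n x))\<^sup>2 \<le> 2 * n * cmod (T n (x + y k) - T n x)"
      proof -
        have "cmod (T n (x + y k) - T n x) \<le> 2 * n"
          using norm_triangle_ineq4[of "T n (x + y k)" "T n x"] Tle(3)[of n x] Tle(3)[of n "x + y k"] by linarith
        then show ?thesis by (simp add: power2_eq_square mult_right_mono)
      qed
      ultimately show "(cmod (h (x + y k) - h x))\<^sup>2 \<le> 4 * n * cmod (T n (x + y k) - T n x) + (4 * (cmod (h (x + y k) - T n (x + y k)))\<^sup>2 + 4 * (cmod (h x - T n x))\<^sup>2)"
        by linarith
    qed (rule i1)
    also have "\<dots> = 4 * n * (\<integral>x. cmod (T n (x + y k) - T n x) \<partial>lborel)
       + (4 * (\<integral>x. (cmod (h (x + y k) - T n (x + y k)))\<^sup>2 \<partial>lborel) + 4 * (\<integral>x. (cmod (h x - T n x))\<^sup>2 \<partial>lborel))"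
      using i2[of k] id[of n] integrable_translation[OF id[of n], of "y k"] by simp
    also have "(\<integral>x. (cmod (h (x + y k) - T n (x + y k)))\<^sup>2 \<partial>lborel) = (\<integral>x. (cmod (h x - T n x))\<^sup>2 \<partial>lborel)"
      by (rule integral_translation) simp
    finally show ?thesis using n by simp
  qed
  moreover have "(\<lambda>k. 4 * n * (\<integral>x. cmod (T n (x + y k) - T n x) \<partial>lborel)) \<longlonglongrightarrow> real (4 * n) * 0"
    by (intro tendsto_intros L1_translation iT y)
  ultimately show "\<exists>b. b \<longlonglongrightarrow> 0 \<and> (\<forall>k. (\<integral>x. (cmod (h (x + y k) - h x))\<^sup>2 \<partial>lborel) \<le> b k + e)"
    by (intro exI[of _ "\<lambda>k. 4 * n * (\<integral>x. cmod (T n (x + y k) - T n x) \<partial>lborel)"]) simp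
qed simp

section \<open>The Fourier transform and the autocorrelation function\<close>

definition fourier :: "('a::euclidean_space \<Rightarrow> complex) \<Rightarrow> 'a \<Rightarrow> complex" where
  "fourier h b = (\<integral>x. exp (\<i> * complex_of_real (x \<bullet> b)) * h x \<partial>lborel)"

text \<open>This is \<open>h\<close> convolved with its reflected conjugate: its transform is the
  squared modulus of the transform of \<open>h\<close>, and its value at 0 is the squared norm.
  Plancherel thereby becomes Fourier inversion at a single point.\<close>

definition autocorr :: "('a::euclidean_space \<Rightarrow> complex) \<Rightarrow> 'a \<Rightarrow> complex" where
  "autocorr h y = (\<integral>x. h (x + y) * cnj (h x) \<partial>lborel)"

lemma integrable_character_mult:
  fixes h :: "'a::euclidean_space \<Rightarrow> complex"
  assumes "integrable lborel h"
  shows "integrable lborel (\<lambda>x. exp (\<i> * complex_of_real (x \<bullet> b)) * h x)"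
  by (rule Bochner_Integration.integrable_bound[OF assms]) (use assms in \<open>auto simp: norm_mult\<close>)

lemma borel_measurable_fourier [measurable]:
  assumes [measurable]: "h \<in> borel_measurable borel"
  shows "fourier h \<in> borel_measurable borel"
  unfolding fourier_def by measurable

lemma
  fixes h :: "'a::euclidean_space \<Rightarrow> complex"
  assumes h: "integrable lborel h"
  shows integrable_autocorr: "integrable lborel (autocorr h)"
    and fourier_autocorr: "fourier (autocorr h) b = complex_of_real ((cmod (fourier h b))\<^sup>2)"
proof -
  have [measurable]: "h \<in> borel_measurable borel" using h by auto
  let ?F = "\<lambda>b (x::'a) y. exp (\<i> * complex_of_real (y \<bullet> b)) * (h (x + y) * cnj (h x))"
  have iT: "integrable lborel (\<lambda>y. h (x + y))" for x
    using integrable_translation[OF h, of x] by (simp add: add.commute)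
  have int: "integrable (lborel \<Otimes>\<^sub>M lborel) (case_prod (?F b))" for b
  proof (rule lborel_pair.Fubini_integrable)
    show "AE x in lborel. integrable lborel (\<lambda>y. case_prod (?F b) (x, y))"
      by (intro AE_I2) (simp, intro integrable_character_mult integrable_mult_left iT)
    have "(\<integral>y. norm (case_prod (?F b) (x, y)) \<partial>lborel) = cmod (h x) * (\<integral>y. cmod (h y) \<partial>lborel)" for x
      using integral_translation[of "\<lambda>y. cmod (h y)" x] by (simp add: norm_mult add.commute mult.commute)
    then show "integrable lborel (\<lambda>x. \<integral>y. norm (case_prod (?F b) (x, y)) \<partial>lborel)"
      using h by simp
  qed measurable
  have "integrable lborel (\<lambda>y. \<integral>x. ?F 0 x y \<partial>lborel)"
    using lborel_pair.integrable_snd[OF int[of 0]] by simp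
  then show "integrable lborel (autocorr h)" by (simp add: autocorr_def[abs_def])
  have "fourier (autocorr h) b = (\<integral>y. \<integral>x. ?F b x y \<partial>lborel \<partial>lborel)"
    unfolding fourier_def autocorr_def by simp
  also have "\<dots> = (\<integral>x. \<integral>y. ?F b x y \<partial>lborel \<partial>lborel)"
    by (rule lborel_pair.Fubini_integral[OF int])
  also have "\<dots> = (\<integral>x. fourier h b * cnj (exp (\<i> * complex_of_real (x \<bullet> b)) * h x) \<partial>lborel)"
  proof (intro Bochner_Integration.integral_cong refl)
    fix x :: 'a
    have "(\<integral>y. ?F b x y \<partial>lborel) = (\<integral>y. cnj (exp (\<i> * complex_of_real (x \<bullet> b)) * h x) * (exp (\<i> * complex_of_real ((y + x) \<bullet> b)) * h (y + x)) \<partial>lborel)"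
      by (intro Bochner_Integration.integral_cong refl)
         (simp add: inner_add_left distrib_left exp_add exp_cnj exp_minus field_simps)
    also have "\<dots> = cnj (exp (\<i> * complex_of_real (x \<bullet> b)) * h x) * (\<integral>y. exp (\<i> * complex_of_real ((y + x) \<bullet> b)) * h (y + x) \<partial>lborel)"
      by (rule integral_mult_right_zero)
    also have "(\<integral>y. exp (\<i> * complex_of_real ((y + x) \<bullet> b)) * h (y + x) \<partial>lborel) = fourier h b"
      unfolding fourier_def by (rule integral_translation) measurable
    finally show "(\<integral>y. ?F b x y \<partial>lborel) = fourier h b * cnj (exp (\<i> * complex_of_real (x \<bullet> b)) * h x)"
      by (simp only: mult.commute)
  qed
  also have "\<dots> = fourier h b * cnj (fourier h b)"
    unfolding fourier_def by (simp add: integral_cnj[symmetric] del: complex_cnj_mult)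
  also have "\<dots> = complex_of_real ((cmod (fourier h b))\<^sup>2)"
    by (simp add: complex_norm_square[symmetric])
  finally show "fourier (autocorr h) b = complex_of_real ((cmod (fourier h b))\<^sup>2)" .
qed

text \<open>Expansion of \<open>|h(x+y) - h(x)|^2\<close> together with translation invariance.
  Continuity of the real part at 0 is thus continuity of translations in L2; real parts suffice
  because the regularised Plancherel integral is real.\<close>

lemma
  fixes h :: "'a::euclidean_space \<Rightarrow> complex"
  assumes h: "integrable lborel h" and h2: "integrable lborel (\<lambda>x. (cmod (h x))\<^sup>2)"
  shows Re_autocorr: "Re (autocorr h y) = (\<integral>x. (cmod (h x))\<^sup>2 \<partial>lborel) - (\<integral>x. (cmod (h (x + y) - h x))\<^sup>2 \<partial>lborel) / 2"
    and Re_autocorr_bound: "\<bar>Re (autocorr h y)\<bar> \<le> (\<integral>x. (cmod (h x))\<^sup>2 \<partial>lborel)"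
proof -
  have [measurable]: "h \<in> borel_measurable borel" using h by auto
  note t2 = integrable_translation[OF h2, of y]
  have i: "integrable lborel (\<lambda>x. h (x + y) * cnj (h x))"
  proof (rule integrable_dominated)
    show "integrable lborel (\<lambda>x. (cmod (h (x + y)))\<^sup>2 + (cmod (h x))\<^sup>2)"
      by (intro Bochner_Integration.integrable_add t2 h2)
    fix x
    have "2 * (cmod (h (x + y)) * cmod (h x)) \<le> (cmod (h (x + y)))\<^sup>2 + (cmod (h x))\<^sup>2"
      using sum_squares_bound[of "cmod (h (x + y))" "cmod (h x)"] by simp
    moreover have "0 \<le> cmod (h (x + y)) * cmod (h x)" by simp
    ultimately show "norm (h (x + y) * cnj (h x)) \<le> (cmod (h (x + y)))\<^sup>2 + (cmod (h x))\<^sup>2"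
      unfolding norm_mult complex_mod_cnj by linarith
  qed measurable
  have d: "integrable lborel (\<lambda>x. (cmod (h (x + y) - h x))\<^sup>2)"
    by (intro integrable_cmod_diff_sq t2 h2) measurable
  have iR: "integrable lborel (\<lambda>x. Re (h (x + y) * cnj (h x)))" using i by (rule integrable_Re)
  have "(\<integral>x. (cmod (h (x + y) - h x))\<^sup>2 \<partial>lborel) = (\<integral>x. (cmod (h (x + y)))\<^sup>2 + (cmod (h x))\<^sup>2 - 2 * Re (h (x + y) * cnj (h x)) \<partial>lborel)"
    by (simp only: cmod_diff_sq)
  also have "\<dots> = (\<integral>x. (cmod (h (x + y)))\<^sup>2 \<partial>lborel) + (\<integral>x. (cmod (h x))\<^sup>2 \<partial>lborel) - 2 * (\<integral>x. Re (h (x + y) * cnj (h x)) \<partial>lborel)"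
    using t2 h2 iR by (simp del: complex_cnj_mult times_complex.simps)
  also have "(\<integral>x. (cmod (h (x + y)))\<^sup>2 \<partial>lborel) = (\<integral>x. (cmod (h x))\<^sup>2 \<partial>lborel)"
    by (rule integral_translation) measurable
  also have "(\<integral>x. Re (h (x + y) * cnj (h x)) \<partial>lborel) = Re (autocorr h y)"
    unfolding autocorr_def by (rule integral_Re[OF i])
  finally show eq: "Re (autocorr h y) = (\<integral>x. (cmod (h x))\<^sup>2 \<partial>lborel) - (\<integral>x. (cmod (h (x + y) - h x))\<^sup>2 \<partial>lborel) / 2"
    by linarith
  have "(\<integral>x. (cmod (h (x + y) - h x))\<^sup>2 \<partial>lborel) \<le> (\<integral>x. 2 * (cmod (h (x + y)))\<^sup>2 + 2 * (cmod (h x))\<^sup>2 \<partial>lborel)"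
    by (intro integral_mono d Bochner_Integration.integrable_add integrable_mult_right t2 h2 norm_diff_sq_le)
  also have "\<dots> = 2 * (\<integral>x. (cmod (h (x + y)))\<^sup>2 \<partial>lborel) + 2 * (\<integral>x. (cmod (h x))\<^sup>2 \<partial>lborel)"
    using t2 h2 by simp
  also have "(\<integral>x. (cmod (h (x + y)))\<^sup>2 \<partial>lborel) = (\<integral>x. (cmod (h x))\<^sup>2 \<partial>lborel)"
    by (rule integral_translation) measurable
  finally have "(\<integral>x. (cmod (h (x + y) - h x))\<^sup>2 \<partial>lborel) \<le> 4 * (\<integral>x. (cmod (h x))\<^sup>2 \<partial>lborel)" by simp
  moreover have "0 \<le> (\<integral>x. (cmod (h (x + y) - h x))\<^sup>2 \<partial>lborel)" by simp
  ultimately show "\<bar>Re (autocorr h y)\<bar> \<le> (\<integral>x. (cmod (h x))\<^sup>2 \<partial>lborel)" unfolding eq by linarith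
qed


text \<open>Exchanging the integrals moves the Gaussian onto the side of \<open>a\<close>, where it
  is an approximate identity of width \<open>d\<close>; the powers of \<open>d\<close> from the
  Gaussian integral and from the rescaling \<open>y = d w\<close> cancel.\<close>

lemma fourier_gauss_regularized:
  fixes a :: "'a::euclidean_space \<Rightarrow> complex"
  assumes a: "integrable lborel a" and d: "d > 0"
  shows "(\<integral>b. complex_of_real (exp (- d\<^sup>2 * (norm b)\<^sup>2 / 2)) * fourier a b \<partial>lborel)
    = complex_of_real (sqrt (2 * pi) ^ DIM('a)) * (\<integral>w. complex_of_real (exp (- (norm w)\<^sup>2 / 2)) * a (d *\<^sub>R w) \<partial>lborel)"
proof -
  have [measurable]: "a \<in> borel_measurable borel" using a by auto
  let ?t = "1 / d\<^sup>2"
  have t: "?t > 0" using d by simp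
  let ?G = "\<lambda>b::'a. complex_of_real (exp (- (norm b)\<^sup>2 / (2 * ?t)))"
  let ?F = "\<lambda>(b::'a) y. ?G b * (exp (\<i> * complex_of_real (y \<bullet> b)) * a y)"
  have Geq: "complex_of_real (exp (- d\<^sup>2 * (norm b)\<^sup>2 / 2)) = ?G b" for b
    using d by (simp add: field_simps)
  have iG: "integrable lborel (\<lambda>b. norm (?G b))"
    using integrable_gauss[OF t, where 'a='a] by simp
  have int: "integrable (lborel \<Otimes>\<^sub>M lborel) (case_prod ?F)"
  proof (rule lborel_pair.Fubini_integrable)
    show "AE b in lborel. integrable lborel (\<lambda>y. case_prod ?F (b, y))"
      by (intro AE_I2) (simp only: prod.case, intro integrable_mult_right integrable_character_mult a)
    have "(\<integral>y. norm (case_prod ?F (b, y)) \<partial>lborel) = norm (?G b) * (\<integral>y. cmod (a y) \<partial>lborel)" for b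
      by (simp only: prod.case norm_mult norm_exp_i_times mult_1 integral_mult_right_zero)
    then show "integrable lborel (\<lambda>b. \<integral>y. norm (case_prod ?F (b, y)) \<partial>lborel)"
      using iG by simp
  qed measurable
  have "(\<integral>b. complex_of_real (exp (- d\<^sup>2 * (norm b)\<^sup>2 / 2)) * fourier a b \<partial>lborel) = (\<integral>b. \<integral>y. ?F b y \<partial>lborel \<partial>lborel)"
    unfolding Geq fourier_def by (simp only: integral_mult_right_zero)
  also have "\<dots> = (\<integral>y. \<integral>b. ?F b y \<partial>lborel \<partial>lborel)"
    by (rule lborel_pair.Fubini_integral[OF int, symmetric])
  also have "\<dots> = (\<integral>y. complex_of_real (sqrt (2 * pi * ?t) ^ DIM('a) * exp (- ?t * (norm y)\<^sup>2 / 2)) * a y \<partial>lborel)"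
  proof (intro Bochner_Integration.integral_cong refl)
    fix y :: 'a
    have "(\<integral>b. ?F b y \<partial>lborel) = (\<integral>b. (exp (\<i> * complex_of_real (b \<bullet> y)) * ?G b) * a y \<partial>lborel)"
      by (simp only: mult_ac inner_commute)
    also have "\<dots> = (\<integral>b. exp (\<i> * complex_of_real (b \<bullet> y)) * ?G b \<partial>lborel) * a y"
      by (rule integral_mult_left_zero)
    finally show "(\<integral>b. ?F b y \<partial>lborel) = complex_of_real (sqrt (2 * pi * ?t) ^ DIM('a) * exp (- ?t * (norm y)\<^sup>2 / 2)) * a y"
      by (simp only: integral_gauss_fourier[OF t])
  qed
  also have "\<dots> = \<bar>d\<bar> ^ DIM('a) *\<^sub>R (\<integral>w. complex_of_real (sqrt (2 * pi * ?t) ^ DIM('a) * exp (- ?t * (norm (0 + d *\<^sub>R w))\<^sup>2 / 2)) * a (0 + d *\<^sub>R w) \<partial>lborel)"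
    using d by (intro integral_lborel_affine) auto
  also have "\<dots> = \<bar>d\<bar> ^ DIM('a) *\<^sub>R (\<integral>w. complex_of_real (sqrt (2 * pi * ?t) ^ DIM('a)) * (complex_of_real (exp (- (norm w)\<^sup>2 / 2)) * a (d *\<^sub>R w)) \<partial>lborel)"
    using d by (simp add: power_mult_distrib mult.assoc)
  also have "\<dots> = \<bar>d\<bar> ^ DIM('a) *\<^sub>R (complex_of_real (sqrt (2 * pi * ?t) ^ DIM('a)) * (\<integral>w. complex_of_real (exp (- (norm w)\<^sup>2 / 2)) * a (d *\<^sub>R w) \<partial>lborel))"
    by (simp only: integral_mult_right_zero)
  also have "\<bar>d\<bar> ^ DIM('a) *\<^sub>R (complex_of_real (sqrt (2 * pi * ?t) ^ DIM('a)) * c) = complex_of_real (sqrt (2 * pi) ^ DIM('a)) * c" for c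
  proof -
    have "\<bar>d\<bar> ^ DIM('a) * sqrt (2 * pi * ?t) ^ DIM('a) = sqrt (2 * pi) ^ DIM('a)"
      using d by (simp add: power_mult_distrib[symmetric] real_sqrt_divide real_sqrt_mult)
    then show ?thesis
      by (simp add: scaleR_conv_of_real mult.assoc[symmetric] of_real_mult[symmetric] del: of_real_mult of_real_power)
  qed
  finally show ?thesis .
qed

text \<open>The autocorrelation is regularised by Gaussians of shrinking \<open>d\<close>. On the
  frequency side the integrands increase to the squared transform; on the space side a Gaussian
  average of \<open>Re (autocorr h)\<close> tends to its value at 0. The constant is the square of
  the Gaussian mass \<open>s\<close>.\<close>

theorem plancherel:
  fixes h :: "'a::euclidean_space \<Rightarrow> complex"
  assumes h: "integrable lborel h" and h2: "integrable lborel (\<lambda>x. (cmod (h x))\<^sup>2)"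
  shows "(\<integral>\<^sup>+b. ennreal ((cmod (fourier h b))\<^sup>2) \<partial>lborel) = ennreal ((2 * pi) ^ DIM('a)) * (\<integral>\<^sup>+x. ennreal ((cmod (h x))\<^sup>2) \<partial>lborel)"
proof -
  have [measurable]: "h \<in> borel_measurable borel" using h by auto
  have [measurable]: "autocorr h \<in> borel_measurable borel" using integrable_autocorr[OF h] by auto
  define I where "I = (\<integral>x. (cmod (h x))\<^sup>2 \<partial>lborel)"
  define s where "s = sqrt (2 * pi) ^ DIM('a)"
  have s2: "s * s = (2 * pi) ^ DIM('a)" unfolding s_def by (subst power_mult_distrib[symmetric]) simp
  let ?d = "\<lambda>k. inverse (real (Suc k))"
  let ?A = "\<lambda>k b. exp (- (?d k)\<^sup>2 * (norm b)\<^sup>2 / 2) * (cmod (fourier h b))\<^sup>2"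
  let ?g = "\<lambda>w::'a. exp (- (norm w)\<^sup>2 / 2)"
  have ig: "integrable lborel ?g" "(\<integral>w. ?g w \<partial>lborel) = s"
    using integrable_gauss[of 1, where 'a='a] integral_gauss[of 1, where 'a='a] by (simp_all add: s_def)
  have FB: "cmod (fourier h b) \<le> (\<integral>x. cmod (h x) \<partial>lborel)" for b
    unfolding fourier_def by (rule order_trans[OF integral_norm_bound]) (simp add: norm_mult)
  have iA: "integrable lborel (?A k)" for k
  proof (rule integrable_dominated)
    have "integrable lborel (\<lambda>b::'a. exp (- (norm b)\<^sup>2 / (2 * (1 / (?d k)\<^sup>2))) * (\<integral>x. cmod (h x) \<partial>lborel)\<^sup>2)"
      by (intro integrable_mult_left integrable_gauss) simp
    then show "integrable lborel (\<lambda>b::'a. exp (- (?d k)\<^sup>2 * (norm b)\<^sup>2 / 2) * (\<integral>x. cmod (h x) \<partial>lborel)\<^sup>2)"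
      by (simp add: field_simps)
  qed (auto simp: abs_mult intro!: mult_left_mono power_mono FB)
  have eq: "(\<integral>b. ?A k b \<partial>lborel) = s * (\<integral>w. ?g w * Re (autocorr h (?d k *\<^sub>R w)) \<partial>lborel)" for k
  proof -
    have "complex_of_real (\<integral>b. ?A k b \<partial>lborel) = (\<integral>b. complex_of_real (exp (- (?d k)\<^sup>2 * (norm b)\<^sup>2 / 2)) * fourier (autocorr h) b \<partial>lborel)"
      unfolding fourier_autocorr[OF h] integral_complex_of_real[symmetric] of_real_mult ..
    also have "\<dots> = complex_of_real s * (\<integral>w. complex_of_real (?g w) * autocorr h (?d k *\<^sub>R w) \<partial>lborel)"
      unfolding s_def by (rule fourier_gauss_regularized[OF integrable_autocorr[OF h]]) simp
    finally have cq: "complex_of_real (\<integral>b. ?A k b \<partial>lborel) = complex_of_real s * (\<integral>w. complex_of_real (?g w) * autocorr h (?d k *\<^sub>R w) \<partial>lborel)" .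
    have "(\<integral>b. ?A k b \<partial>lborel) = Re (complex_of_real s * (\<integral>w. complex_of_real (?g w) * autocorr h (?d k *\<^sub>R w) \<partial>lborel))"
      using arg_cong[OF cq, of Re] by (simp only: Re_complex_of_real)
    also have "\<dots> = s * Re (\<integral>w. complex_of_real (?g w) * autocorr h (?d k *\<^sub>R w) \<partial>lborel)" by simp
    also have "Re (\<integral>w. complex_of_real (?g w) * autocorr h (?d k *\<^sub>R w) \<partial>lborel) = (\<integral>w. Re (complex_of_real (?g w) * autocorr h (?d k *\<^sub>R w)) \<partial>lborel)"
    proof (rule integral_Re[symmetric])
      have "integrable lborel (\<lambda>w. autocorr h (0 + ?d k *\<^sub>R w))"
        by (rule integrable_lborel_affine[OF _ integrable_autocorr[OF h]]) simp
      then show "integrable lborel (\<lambda>w. complex_of_real (?g w) * autocorr h (?d k *\<^sub>R w))"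
        by (rule Bochner_Integration.integrable_bound) (auto simp: norm_mult intro!: mult_left_le_one_le)
    qed
    finally show ?thesis by simp
  qed
  have "(\<lambda>k. \<integral>w. ?g w * Re (autocorr h (?d k *\<^sub>R w)) \<partial>lborel) \<longlonglongrightarrow> (\<integral>w. ?g w * I \<partial>lborel)"
  proof (rule integral_dominated_convergence[where w="\<lambda>w. ?g w * I"])
    show "AE w in lborel. (\<lambda>k. ?g w * Re (autocorr h (?d k *\<^sub>R w))) \<longlonglongrightarrow> ?g w * I"
    proof (intro AE_I2 tendsto_mult tendsto_const)
      fix w :: 'a
      have "(\<lambda>k. ?d k *\<^sub>R w) \<longlonglongrightarrow> 0 *\<^sub>R w" by (intro tendsto_intros LIMSEQ_inverse_real_of_nat)
      then have "(\<lambda>k. I - (\<integral>x. (cmod (h (x + ?d k *\<^sub>R w) - h x))\<^sup>2 \<partial>lborel) / 2) \<longlonglongrightarrow> I - 0 / 2"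
        by (intro tendsto_intros L2_translation[OF h h2]) simp_all
      then show "(\<lambda>k. Re (autocorr h (?d k *\<^sub>R w))) \<longlonglongrightarrow> I"
        by (simp add: Re_autocorr[OF h h2] I_def)
    qed
    show "AE w in lborel. norm (?g w * Re (autocorr h (?d k *\<^sub>R w))) \<le> ?g w * I" for k
      using Re_autocorr_bound[OF h h2] by (intro AE_I2) (auto simp: abs_mult I_def intro!: mult_left_mono)
    show "integrable lborel (\<lambda>w. ?g w * I)" using ig by simp
  qed measurable
  then have "(\<lambda>k. s * (\<integral>w. ?g w * Re (autocorr h (?d k *\<^sub>R w)) \<partial>lborel)) \<longlonglongrightarrow> s * (s * I)"
    using ig by (intro tendsto_intros) simp
  then have "(\<lambda>k. ennreal (\<integral>b. ?A k b \<partial>lborel)) \<longlonglongrightarrow> ennreal (s * (s * I))"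
    unfolding eq by (rule tendsto_ennrealI)
  moreover have "ennreal (\<integral>b. ?A k b \<partial>lborel) = (\<integral>\<^sup>+b. ennreal (?A k b) \<partial>lborel)" for k
    by (rule nn_integral_eq_integral[symmetric, OF iA]) (auto intro!: AE_I2)
  ultimately have L1: "(\<lambda>k. \<integral>\<^sup>+b. ennreal (?A k b) \<partial>lborel) \<longlonglongrightarrow> ennreal (s * (s * I))" by simp
  have L2: "(\<lambda>k. \<integral>\<^sup>+b. ennreal (?A k b) \<partial>lborel) \<longlonglongrightarrow> (\<integral>\<^sup>+b. ennreal ((cmod (fourier h b))\<^sup>2) \<partial>lborel)"
  proof (rule nn_integral_LIMSEQ)
    show "incseq (\<lambda>k b. ennreal (?A k b))"
    proof (intro incseq_SucI le_funI ennreal_leI mult_right_mono)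
      fix k and b :: 'a
      have "(?d (Suc k))\<^sup>2 \<le> (?d k)\<^sup>2" by (intro power_mono le_imp_inverse_le) auto
      then have "(?d (Suc k))\<^sup>2 * (norm b)\<^sup>2 \<le> (?d k)\<^sup>2 * (norm b)\<^sup>2" by (rule mult_right_mono) simp
      then show "exp (- (?d k)\<^sup>2 * (norm b)\<^sup>2 / 2) \<le> exp (- (?d (Suc k))\<^sup>2 * (norm b)\<^sup>2 / 2)" by simp
    qed simp
    show "(\<lambda>k. ennreal (?A k b)) \<longlonglongrightarrow> ennreal ((cmod (fourier h b))\<^sup>2)" for b
    proof (rule tendsto_ennrealI)
      have "(\<lambda>k. ?A k b) \<longlonglongrightarrow> exp (- 0\<^sup>2 * (norm b)\<^sup>2 / 2) * (cmod (fourier h b))\<^sup>2"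
        by (intro tendsto_intros LIMSEQ_inverse_real_of_nat) simp
      then show "(\<lambda>k. ?A k b) \<longlonglongrightarrow> (cmod (fourier h b))\<^sup>2" by simp
    qed
  qed measurable
  have "(\<integral>\<^sup>+b. ennreal ((cmod (fourier h b))\<^sup>2) \<partial>lborel) = ennreal (s * (s * I))"
    by (rule LIMSEQ_unique[OF L2 L1])
  also have "\<dots> = ennreal ((2 * pi) ^ DIM('a)) * ennreal I"
    unfolding mult.assoc[symmetric] s2 by (rule ennreal_mult'') (simp add: I_def)
  also have "ennreal I = (\<integral>\<^sup>+x. ennreal ((cmod (h x))\<^sup>2) \<partial>lborel)"
    unfolding I_def by (rule nn_integral_eq_integral[symmetric, OF h2]) auto
  finally show ?thesis .
qed

section \<open>Fundamental domains\<close>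

text \<open>Used for \<open>\<Gamma>\<close> in the real space and for the image of
  \<open>\<Gamma>'\<close> under \<open>cvec\<close> in the complex space. Since
  \<open>fundamental_domain\<close> tolerates null sets, the covering statements below hold almost
  everywhere.\<close>

locale periodic_domain =
  fixes G D :: "'a::euclidean_space set"
  assumes countable_G: "countable G"
    and uminus_G: "\<And>g. g \<in> G \<Longrightarrow> - g \<in> G"
    and domain: "fundamental_domain G D"
begin

lemma domain_borel [measurable]: "D \<in> sets borel"
  using domain by (simp add: fundamental_domain_def)

lemma domain_unique: "AE x in lborel. \<exists>!g. g \<in> G \<and> x - g \<in> D"
  using domain by (simp add: fundamental_domain_def)

text \<open>The translates of \<open>D\<close> form a partition of unity; writing the sum as an
  integral over \<open>count_space\<close> makes Tonelli available.\<close>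

lemma count_domain_minus: "AE x in lborel. (\<integral>\<^sup>+g. indicator D (x - g) \<partial>count_space G) = (1::ennreal)"
  using domain_unique
proof eventually_elim
  case (elim x)
  then obtain g where g: "g \<in> G" "x - g \<in> D" "\<And>g'. g' \<in> G \<Longrightarrow> x - g' \<in> D \<Longrightarrow> g' = g" by blast
  have "0 < (indicator D (x - a) :: ennreal) \<longleftrightarrow> x - a \<in> D" for a by (simp add: indicator_def)
  then have "{a \<in> G. 0 < (indicator D (x - a) :: ennreal)} = {g}" using g by blast
  then show ?case using g(2) by (subst nn_integral_count_space) simp_all
qed

lemma count_domain_plus: "AE x in lborel. (\<integral>\<^sup>+g. indicator D (x + g) \<partial>count_space G) = (1::ennreal)"
  using count_domain_minus
proof eventually_elim
  case (elim x)
  have "bij_betw uminus G G"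
    by (rule bij_betwI[of _ _ _ uminus]) (auto simp: uminus_G)
  from nn_integral_bij_count_space[OF this, of "\<lambda>g. indicator D (x - g) :: ennreal"] elim
  show ?case by simp
qed

text \<open>Countably many translates of a null set cannot cover almost every point.\<close>

lemma domain_not_null: "emeasure lborel D \<noteq> 0"
proof
  assume "emeasure lborel D = 0"
  then have N: "AE x in lborel. x \<notin> D" by (intro AE_not_in) (auto intro: null_setsI)
  have "AE x in lborel. \<forall>g\<in>G. x + - g \<notin> D"
    by (subst AE_ball_countable[OF countable_G]) (intro ballI AE_translation[OF N])
  with domain_unique have "AE x in (lborel::'a measure). False" by eventually_elim auto
  then have "emeasure (lborel::'a measure) UNIV = 0" by (subst (asm) AE_iff_measurable[OF _ refl]) auto
  then show False by simp
qed

end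

text \<open>The unfolding argument: insert the partition of unity of \<open>D'\<close>, exchange sum
  and integral, shift by \<open>g\<close> using the periodicity of \<open>h\<close>, and collect the
  partition of unity of \<open>D\<close>.\<close>

lemma nn_integral_domain_independent:
  fixes h :: "'a::euclidean_space \<Rightarrow> ennreal"
  assumes "periodic_domain G D" "periodic_domain G D'"
    and [measurable]: "h \<in> borel_measurable borel"
    and h: "\<And>g. g \<in> G \<Longrightarrow> AE x in lborel. h (x + g) = h x"
  shows "(\<integral>\<^sup>+x. indicator D x * h x \<partial>lborel) = (\<integral>\<^sup>+x. indicator D' x * h x \<partial>lborel)"
proof -
  interpret D: periodic_domain G D by fact
  interpret D': periodic_domain G D' by fact
  have "(\<integral>\<^sup>+x. indicator D x * h x \<partial>lborel) = (\<integral>\<^sup>+x. \<integral>\<^sup>+g. indicator D x * h x * indicator D' (x - g) \<partial>count_space G \<partial>lborel)"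
  proof (rule nn_integral_cong_AE)
    show "AE x in lborel. indicator D x * h x = (\<integral>\<^sup>+g. indicator D x * h x * indicator D' (x - g) \<partial>count_space G)"
      using D'.count_domain_minus by eventually_elim (simp add: nn_integral_cmult)
  qed
  also have "\<dots> = (\<integral>\<^sup>+g. \<integral>\<^sup>+x. indicator D x * h x * indicator D' (x - g) \<partial>lborel \<partial>count_space G)"
    by (rule nn_integral_count_space_nn_integral[OF D.countable_G]) measurable
  also have "\<dots> = (\<integral>\<^sup>+g. \<integral>\<^sup>+x. indicator D' x * h x * indicator D (x + g) \<partial>lborel \<partial>count_space G)"
  proof (rule nn_integral_cong)
    fix g assume "g \<in> space (count_space G)"
    then have g: "g \<in> G" by simp
    have "(\<integral>\<^sup>+x. indicator D x * h x * indicator D' (x - g) \<partial>lborel) = (\<integral>\<^sup>+x. indicator D (x + g) * h (x + g) * indicator D' (x + g - g) \<partial>lborel)"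
      by (rule nn_integral_translation[symmetric]) measurable
    also have "\<dots> = (\<integral>\<^sup>+x. indicator D' x * h x * indicator D (x + g) \<partial>lborel)"
    proof (rule nn_integral_cong_AE)
      show "AE x in lborel. indicator D (x + g) * h (x + g) * indicator D' (x + g - g) = indicator D' x * h x * indicator D (x + g)"
        using h[OF g] by eventually_elim (simp add: mult_ac)
    qed
    finally show "(\<integral>\<^sup>+x. indicator D x * h x * indicator D' (x - g) \<partial>lborel) = (\<integral>\<^sup>+x. indicator D' x * h x * indicator D (x + g) \<partial>lborel)" .
  qed
  also have "\<dots> = (\<integral>\<^sup>+x. \<integral>\<^sup>+g. indicator D' x * h x * indicator D (x + g) \<partial>count_space G \<partial>lborel)"
    by (rule nn_integral_count_space_nn_integral[OF D.countable_G, symmetric]) measurable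
  also have "\<dots> = (\<integral>\<^sup>+x. indicator D' x * h x \<partial>lborel)"
  proof (rule nn_integral_cong_AE)
    show "AE x in lborel. (\<integral>\<^sup>+g. indicator D' x * h x * indicator D (x + g) \<partial>count_space G) = indicator D' x * h x"
      using D.count_domain_plus by eventually_elim (simp add: nn_integral_cmult)
  qed
  finally show ?thesis .
qed

context periodic_domain begin

lemma periodic_domain_translate: "periodic_domain G {x. x - t \<in> D}"
proof
  have m: "{x. x - t \<in> D} \<in> sets borel" by measurable
  have "AE x in lborel. \<exists>!g. g \<in> G \<and> (x + - t) - g \<in> D"
    by (rule AE_translation[OF domain_unique])
  then have "AE x in lborel. \<exists>!g. g \<in> G \<and> x - g \<in> {x. x - t \<in> D}"
    by (simp add: algebra_simps)
  with m show "fundamental_domain G {x. x - t \<in> D}" by (simp add: fundamental_domain_def)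
qed (auto simp: countable_G uminus_G)

lemma nn_integral_domain_translate:
  fixes h :: "'a \<Rightarrow> ennreal"
  assumes [measurable]: "h \<in> borel_measurable borel"
    and h: "\<And>g. g \<in> G \<Longrightarrow> AE x in lborel. h (x + g) = h x"
  shows "(\<integral>\<^sup>+x. indicator D x * h (x + t) \<partial>lborel) = (\<integral>\<^sup>+x. indicator D x * h x \<partial>lborel)"
proof -
  have [measurable]: "{x. x - t \<in> D} \<in> sets borel" by measurable
  have "(\<integral>\<^sup>+x. indicator D x * h (x + t) \<partial>lborel) = (\<integral>\<^sup>+x. indicator {x. x - t \<in> D} (x + t) * h (x + t) \<partial>lborel)"
    by (simp add: indicator_def)
  also have "\<dots> = (\<integral>\<^sup>+x. indicator {x. x - t \<in> D} x * h x \<partial>lborel)"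
    by (rule nn_integral_translation) measurable
  also have "\<dots> = (\<integral>\<^sup>+x. indicator D x * h x \<partial>lborel)"
    by (rule nn_integral_domain_independent[OF periodic_domain_translate periodic_domain_axioms assms])
  finally show ?thesis .
qed

text \<open>Tonelli and translation invariance over \<open>D\<close>: averaging the centre of
  \<open>k\<close> over a domain amounts to integrating \<open>k\<close> freely and \<open>h\<close>
  over the domain. This takes the place of summing the kernel over lattice translates.\<close>

lemma nn_integral_domain_convolution:
  fixes h k :: "'a \<Rightarrow> ennreal"
  assumes [measurable]: "h \<in> borel_measurable borel" "k \<in> borel_measurable borel"
    and h: "\<And>g. g \<in> G \<Longrightarrow> AE x in lborel. h (x + g) = h x"
  shows "(\<integral>\<^sup>+a. indicator D a * (\<integral>\<^sup>+x. k (x - a) * h x \<partial>lborel) \<partial>lborel)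
    = (\<integral>\<^sup>+x. k x \<partial>lborel) * (\<integral>\<^sup>+x. indicator D x * h x \<partial>lborel)"
proof -
  have "(\<integral>\<^sup>+x. k (x - a) * h x \<partial>lborel) = (\<integral>\<^sup>+x. k x * h (a + x) \<partial>lborel)" for a
    using nn_integral_translation[of "\<lambda>x. k (x - a) * h x" a] by (simp add: add.commute)
  then have "(\<integral>\<^sup>+a. indicator D a * (\<integral>\<^sup>+x. k (x - a) * h x \<partial>lborel) \<partial>lborel)
     = (\<integral>\<^sup>+a. \<integral>\<^sup>+x. k x * (indicator D a * h (a + x)) \<partial>lborel \<partial>lborel)"
    by (simp add: nn_integral_cmult[symmetric] mult_ac)
  also have "\<dots> = (\<integral>\<^sup>+x. \<integral>\<^sup>+a. k x * (indicator D a * h (a + x)) \<partial>lborel \<partial>lborel)"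
    by (rule lborel_pair.Fubini'[symmetric]) measurable
  also have "\<dots> = (\<integral>\<^sup>+x. k x * (\<integral>\<^sup>+a. indicator D a * h a \<partial>lborel) \<partial>lborel)"
    by (simp add: nn_integral_cmult nn_integral_domain_translate[OF assms(1) h])
  also have "\<dots> = (\<integral>\<^sup>+x. k x \<partial>lborel) * (\<integral>\<^sup>+x. indicator D x * h x \<partial>lborel)"
    by (rule nn_integral_multc) measurable
  finally show ?thesis .
qed

text \<open>The integral against a Gaussian centred at 0 is compared with those centred at points
  \<open>a\<close> of a bounded non-null piece of \<open>D\<close>; averaging over these
  \<open>a\<close> and enlarging the average to all of \<open>D\<close> leads to
  \<open>nn_integral_domain_convolution\<close>. The constant does not depend on
  \<open>h\<close>.\<close>

lemma gauss_weighted_bound: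
  assumes "\<mu> > 0"
  obtains C :: ennreal where "C < \<infinity>"
    "\<And>h :: 'a \<Rightarrow> ennreal. h \<in> borel_measurable borel \<Longrightarrow> (\<And>g. g \<in> G \<Longrightarrow> AE x in lborel. h (x + g) = h x) \<Longrightarrow>
      (\<integral>\<^sup>+x. ennreal (exp (- \<mu> * (norm x)\<^sup>2)) * h x \<partial>lborel) \<le> C * (\<integral>\<^sup>+x. indicator D x * h x \<partial>lborel)"
proof -
  \<comment> \<open>\<open>D\<close> may be unbounded and of infinite measure, so a bounded piece of
    positive measure is cut out.\<close>
  have "\<exists>n::nat. emeasure lborel (D \<inter> ball 0 n) \<noteq> 0"
  proof (rule ccontr)
    assume "\<not> ?thesis"
    then have "(\<Union>n::nat. D \<inter> ball 0 (real n)) \<in> null_sets lborel"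
      by (intro null_sets_UN) (auto intro!: null_setsI)
    moreover have "(\<Union>n::nat. D \<inter> ball 0 (real n)) = D"
      using reals_Archimedean2 by auto
    ultimately show False using domain_not_null by (simp add: null_sets_def)
  qed
  then obtain n :: nat where n: "emeasure lborel (D \<inter> ball 0 n) \<noteq> 0" by blast
  define m where "m = emeasure lborel (D \<inter> ball 0 (real n))"
  have "m \<le> emeasure lborel (ball (0::'a) (real n))" unfolding m_def by (intro emeasure_mono) auto
  then have mfin: "m < \<infinity>" using emeasure_lborel_ball_finite by (rule order_le_less_trans)
  then obtain r where r: "m = ennreal r" "0 < r"
    using n unfolding m_def[symmetric] by (cases m) (auto simp: less_le)
  have im: "inverse m = ennreal (inverse r)" using r by (simp add: inverse_ennreal)
  have im1: "inverse m * m = 1" unfolding r(1) using r(2) by (simp add: inverse_ennreal ennreal_mult[symmetric])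
  \<comment> \<open>Rate \<open>\<mu> / 2\<close>: half of the decay is spent in
    \<open>|x - a|^2 \<le> 2 |x|^2 + 2 |a|^2\<close>, which moves the centre from 0 to
    \<open>a\<close>.\<close>
  let ?k = "\<lambda>x::'a. ennreal (exp (- (norm x)\<^sup>2 / (2 * (1 / \<mu>))))"
  define K where "K = (\<integral>\<^sup>+x. ?k x \<partial>lborel)"
  have "K = ennreal (sqrt (2 * pi * (1 / \<mu>)) ^ DIM('a))"
    unfolding K_def by (rule nn_integral_gauss) (use assms in simp)
  then have Kfin: "K < \<infinity>" by (simp only: ennreal_less_top infinity_ennreal_def)
  show thesis
  proof
    show "inverse m * (ennreal (exp (\<mu> * n\<^sup>2)) * K) < \<infinity>"
      unfolding im using Kfin by (simp add: ennreal_mult_less_top)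
    fix h :: "'a \<Rightarrow> ennreal"
    assume [measurable]: "h \<in> borel_measurable borel" and h: "\<And>g. g \<in> G \<Longrightarrow> AE x in lborel. h (x + g) = h x"
    define I where "I = (\<integral>\<^sup>+x. ennreal (exp (- \<mu> * (norm x)\<^sup>2)) * h x \<partial>lborel)"
    have "indicator (D \<inter> ball 0 n) a * I \<le> indicator D a * (ennreal (exp (\<mu> * n\<^sup>2)) * (\<integral>\<^sup>+x. ?k (x - a) * h x \<partial>lborel))" for a
    proof (cases "a \<in> D \<inter> ball 0 n")
      case True
      have "I \<le> (\<integral>\<^sup>+x. ennreal (exp (\<mu> * n\<^sup>2)) * (?k (x - a) * h x) \<partial>lborel)"
        unfolding I_def
      proof (rule nn_integral_mono)
        fix x :: 'a
        have "(norm (x - a))\<^sup>2 \<le> 2 * (norm x)\<^sup>2 + 2 * (norm a)\<^sup>2" by (rule norm_diff_sq_le)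
        also have "\<dots> \<le> 2 * (norm x)\<^sup>2 + 2 * (real n)\<^sup>2"
          using True by (intro add_left_mono mult_left_mono power_mono) auto
        finally have "\<mu> * (norm (x - a))\<^sup>2 \<le> \<mu> * (2 * (norm x)\<^sup>2 + 2 * (real n)\<^sup>2)"
          using assms by (intro mult_left_mono) auto
        then have "exp (- \<mu> * (norm x)\<^sup>2) \<le> exp (\<mu> * n\<^sup>2 + - (norm (x - a))\<^sup>2 / (2 * (1 / \<mu>)))"
          by (simp add: algebra_simps)
        also have "\<dots> = exp (\<mu> * n\<^sup>2) * exp (- (norm (x - a))\<^sup>2 / (2 * (1 / \<mu>)))" by (rule exp_add)
        finally have "ennreal (exp (- \<mu> * (norm x)\<^sup>2)) \<le> ennreal (exp (\<mu> * n\<^sup>2)) * ?k (x - a)"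
          by (subst ennreal_mult[symmetric]) (auto intro: ennreal_leI)
        then show "ennreal (exp (- \<mu> * (norm x)\<^sup>2)) * h x \<le> ennreal (exp (\<mu> * n\<^sup>2)) * (?k (x - a) * h x)"
          unfolding mult.assoc[symmetric] by (rule mult_right_mono) simp
      qed
      also have "\<dots> = ennreal (exp (\<mu> * n\<^sup>2)) * (\<integral>\<^sup>+x. ?k (x - a) * h x \<partial>lborel)"
        by (rule nn_integral_cmult) measurable
      finally show ?thesis using True by (simp add: indicator_def)
    qed (simp add: indicator_def)
    then have "(\<integral>\<^sup>+a. indicator (D \<inter> ball 0 n) a * I \<partial>lborel) \<le> (\<integral>\<^sup>+a. ennreal (exp (\<mu> * n\<^sup>2)) * (indicator D a * (\<integral>\<^sup>+x. ?k (x - a) * h x \<partial>lborel)) \<partial>lborel)"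
      by (intro nn_integral_mono) (simp add: mult_ac)
    also have "\<dots> = ennreal (exp (\<mu> * n\<^sup>2)) * (\<integral>\<^sup>+a. indicator D a * (\<integral>\<^sup>+x. ?k (x - a) * h x \<partial>lborel) \<partial>lborel)"
      by (rule nn_integral_cmult) measurable
    also have "(\<integral>\<^sup>+a. indicator D a * (\<integral>\<^sup>+x. ?k (x - a) * h x \<partial>lborel) \<partial>lborel) = K * (\<integral>\<^sup>+x. indicator D x * h x \<partial>lborel)"
      unfolding K_def by (rule nn_integral_domain_convolution) (auto intro: h)
    also have "(\<integral>\<^sup>+a. indicator (D \<inter> ball 0 n) a * I \<partial>lborel) = m * I"
      unfolding m_def by (subst nn_integral_multc) (auto intro!: sets.Int domain_borel borel_measurable_indicator)
    finally have "m * I \<le> ennreal (exp (\<mu> * n\<^sup>2)) * (K * (\<integral>\<^sup>+x. indicator D x * h x \<partial>lborel))" .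
    then have "inverse m * (m * I) \<le> inverse m * (ennreal (exp (\<mu> * n\<^sup>2)) * (K * (\<integral>\<^sup>+x. indicator D x * h x \<partial>lborel)))"
      by (rule mult_left_mono) simp
    moreover have "inverse m * (m * I) = I" by (simp only: mult.assoc[symmetric] im1 mult_1)
    ultimately show "(\<integral>\<^sup>+x. ennreal (exp (- \<mu> * (norm x)\<^sup>2)) * h x \<partial>lborel) \<le> inverse m * (ennreal (exp (\<mu> * n\<^sup>2)) * K) * (\<integral>\<^sup>+x. indicator D x * h x \<partial>lborel)"
      unfolding I_def[symmetric] by (simp only: mult.assoc)
  qed
qed

end

section \<open>Complex coordinate space\<close>

definition cpx :: "real^'n \<Rightarrow> real^'n \<Rightarrow> complex^'n" where
  "cpx a b = (\<chi> j. Complex (a $ j) (b $ j))"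

definition re_vec :: "complex^'n \<Rightarrow> real^'n" where "re_vec z = (\<chi> j. Re (z $ j))"
definition im_vec :: "complex^'n \<Rightarrow> real^'n" where "im_vec z = (\<chi> j. Im (z $ j))"

lemma cpx_nth [simp]: "cpx a b $ j = Complex (a $ j) (b $ j)" by (simp add: cpx_def)
lemma cvec_nth [simp]: "cvec a $ j = complex_of_real (a $ j)" by (simp add: cvec_def)
lemma re_vec_nth [simp]: "re_vec z $ j = Re (z $ j)" by (simp add: re_vec_def)
lemma im_vec_nth [simp]: "im_vec z $ j = Im (z $ j)" by (simp add: im_vec_def)

lemma re_vec_cpx [simp]: "re_vec (cpx a b) = a" by (simp add: vec_eq_iff)
lemma im_vec_cpx [simp]: "im_vec (cpx a b) = b" by (simp add: vec_eq_iff)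
lemma cpx_re_im [simp]: "cpx (re_vec z) (im_vec z) = z" by (simp add: vec_eq_iff)
lemma cpx_zero_right: "cpx a 0 = cvec a" by (simp add: vec_eq_iff complex_eq_iff)
lemma cpx_add: "cpx a b + cpx c d = cpx (a + c) (b + d)" by (simp add: vec_eq_iff complex_eq_iff)
lemma cpx_scaleR: "r *\<^sub>R cpx a b = cpx (r *\<^sub>R a) (r *\<^sub>R b)" by (simp add: vec_eq_iff complex_eq_iff)
lemma cpx_add_cvec: "cpx a b + cvec c = cpx (a + c) b" by (simp add: vec_eq_iff complex_eq_iff)
lemma cpx_diff_cvec: "cpx a b - cvec c = cpx (a - c) b" by (simp add: vec_eq_iff complex_eq_iff)
lemma cvec_add: "cvec (a + b) = cvec a + cvec b" by (simp add: vec_eq_iff)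
lemma cvec_diff: "cvec (a - b) = cvec a - cvec b" by (simp add: vec_eq_iff)
lemma cvec_minus: "cvec (- a) = - cvec a" by (simp add: vec_eq_iff)
lemma cvec_scaleR: "cvec (r *\<^sub>R a) = r *\<^sub>R cvec a" by (simp add: vec_eq_iff) (simp add: scaleR_conv_of_real)
lemma re_vec_cvec [simp]: "re_vec (cvec a) = a" by (simp add: vec_eq_iff)
lemma re_vec_diff: "re_vec (z - w) = re_vec z - re_vec w" by (simp add: vec_eq_iff)

lemma inner_cart_sum: "(a::real^'n) \<bullet> b = (\<Sum>j\<in>UNIV. a $ j * b $ j)"
  by (simp add: inner_vec_def)

lemma bilin_cpx: "bilin (cpx a b) (cpx c d) = Complex (a \<bullet> c - b \<bullet> d) (a \<bullet> d + b \<bullet> c)"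
  unfolding bilin_def inner_cart_sum
  by (simp add: complex_eq_iff sum_subtractf sum.distrib)

lemma bilin_cpx_cvec: "bilin (cpx a b) (cvec c) = Complex (a \<bullet> c) (b \<bullet> c)"
  using bilin_cpx[of a b c 0] by (simp add: cpx_zero_right)

lemma bilin_cpx_self: "bilin (cpx a b) (cpx a b) = Complex ((norm a)\<^sup>2 - (norm b)\<^sup>2) (2 * (a \<bullet> b))"
  by (simp add: bilin_cpx power2_norm_eq_inner inner_commute)

lemma bilin_cvec: "bilin (cvec a) (cvec b) = complex_of_real (a \<bullet> b)"
  using bilin_cpx_cvec[of a 0 b] by (simp add: cpx_zero_right complex_eq_iff)

lemma bilin_commute: "bilin z w = bilin w z" by (simp add: bilin_def mult.commute)
lemma bilin_add_left: "bilin (z + z') w = bilin z w + bilin z' w"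
  by (simp add: bilin_def distrib_right sum.distrib)
lemma bilin_add_right: "bilin w (z + z') = bilin w z + bilin w z'"
  by (simp add: bilin_def distrib_left sum.distrib)
lemma bilin_minus_left: "bilin (- z) w = - bilin z w"
  by (simp add: bilin_def sum_negf)
lemma bilin_minus_right: "bilin w (- z) = - bilin w z"
  by (simp add: bilin_def sum_negf)
lemma bilin_diff_left: "bilin (z - z') w = bilin z w - bilin z' w"
  using bilin_add_left[of z "- z'"] by (simp add: bilin_minus_left)
lemma bilin_diff_right: "bilin w (z - z') = bilin w z - bilin w z'"
  using bilin_add_right[of w z "- z'"] by (simp add: bilin_minus_right)
lemma bilin_scaleR_left: "bilin (r *\<^sub>R z) w = complex_of_real r * bilin z w"
  unfolding bilin_def sum_distrib_left vector_scaleR_component by (simp add: scaleR_conv_of_real mult.assoc)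
lemma bilin_scaleR_right: "bilin w (r *\<^sub>R z) = complex_of_real r * bilin w z"
  using bilin_scaleR_left[of r z w] by (simp add: bilin_commute)
lemma bilin_scale_left: "bilin (c *s z) w = c * bilin z w"
  unfolding bilin_def sum_distrib_left by (simp add: mult.assoc)

lemma herm_cpx_self: "herm (cpx a b) (cpx a b) = complex_of_real ((norm a)\<^sup>2 + (norm b)\<^sup>2)"
proof -
  have "(\<chi> j. cnj (cpx a b $ j)) = cpx a (- b)" by (simp add: vec_eq_iff complex_eq_iff)
  then show ?thesis
    by (simp add: herm_def bilin_cpx power2_norm_eq_inner inner_commute complex_eq_iff)
qed

lemma herm_cvec: "herm z (cvec g) = bilin z (cvec g)"
proof -
  have "(\<chi> j. cnj (cvec g $ j)) = cvec g" by (simp add: vec_eq_iff)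
  then show ?thesis by (simp add: herm_def)
qed

lemma norm_bilin_cvec_le: "cmod (bilin z (cvec x)) \<le> norm z * norm x"
proof -
  have "cmod (bilin z (cvec x)) \<le> (\<Sum>j\<in>UNIV. \<bar>cmod (z $ j)\<bar> * \<bar>x $ j\<bar>)"
    unfolding bilin_def by (rule order_trans[OF norm_sum]) (simp add: norm_mult)
  also have "\<dots> \<le> L2_set (\<lambda>j. cmod (z $ j)) UNIV * L2_set (\<lambda>j. x $ j) UNIV"
    by (rule L2_set_mult_ineq)
  finally show ?thesis by (simp add: norm_vec_def L2_set_def)
qed

section \<open>Lebesgue measure on the complex space in real and imaginary coordinates\<close>

lemma continuous_cpx: "continuous_on UNIV (\<lambda>p. cpx (fst p) (snd p))"
  unfolding cpx_def Complex_eq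
  by (intro continuous_on_vec_lambda continuous_intros)

lemma borel_measurable_cpx [measurable]:
  "(\<lambda>p. cpx (fst p) (snd p)) \<in> borel \<Otimes>\<^sub>M borel \<rightarrow>\<^sub>M borel"
  using borel_measurable_continuous_onI[OF continuous_cpx] by (simp add: borel_prod)

lemma borel_measurable_cpx2 [measurable (raw)]:
  "f \<in> M \<rightarrow>\<^sub>M borel \<Longrightarrow> g \<in> M \<rightarrow>\<^sub>M borel \<Longrightarrow> (\<lambda>x. cpx (f x) (g x)) \<in> M \<rightarrow>\<^sub>M borel"
  using measurable_compose[OF measurable_Pair borel_measurable_cpx, of f M g] by simp

lemma borel_measurable_cvec [measurable]: "cvec \<in> borel \<rightarrow>\<^sub>M borel"
  unfolding cpx_zero_right[symmetric] by measurable

lemma borel_measurable_re_vec [measurable]: "re_vec \<in> borel \<rightarrow>\<^sub>M borel"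
  unfolding re_vec_def
  by (intro borel_measurable_continuous_onI continuous_on_vec_lambda continuous_intros)

lemma borel_measurable_bilin [measurable (raw)]:
  assumes "f \<in> M \<rightarrow>\<^sub>M borel" "g \<in> M \<rightarrow>\<^sub>M borel"
  shows "(\<lambda>x. bilin (f x) (g x)) \<in> M \<rightarrow>\<^sub>M borel"
proof -
  have "(\<lambda>x. f x $ j) \<in> M \<rightarrow>\<^sub>M borel" "(\<lambda>x. g x $ j) \<in> M \<rightarrow>\<^sub>M borel" for j
    using assms by (auto intro!: borel_measurable_continuous_on[where f="\<lambda>z. z $ j"] continuous_intros)
  then show ?thesis unfolding bilin_def by (intro borel_measurable_sum borel_measurable_times)
qed

lemma prod_Basis_vec:
  fixes f :: "'a::euclidean_space^'n \<Rightarrow> 'b::comm_monoid_mult"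
  shows "(\<Prod>b\<in>Basis. f b) = (\<Prod>j\<in>UNIV. \<Prod>u\<in>Basis. f (axis j u))"
proof -
  have inj: "inj_on (\<lambda>(j, u). axis j u) (UNIV \<times> (Basis::'a set))"
    by (auto simp: inj_on_def axis_eq_axis)
  have B: "(Basis :: ('a^'n) set) = (\<lambda>(j, u). axis j u) ` (UNIV \<times> Basis)"
    by (auto simp: Basis_vec_def)
  show ?thesis
    unfolding B prod.reindex[OF inj] by (simp add: prod.cartesian_product split_def comp_def)
qed

text \<open>Both measures agree on boxes: the basis of \<open>complex^'n\<close> consists of the
  vectors \<open>axis j 1\<close> and \<open>axis j \<i>\<close>, so a complex box is the product of
  a box of real parts and a box of imaginary parts.\<close>

lemma lborel_cpx: "distr (lborel \<Otimes>\<^sub>M lborel) borel (\<lambda>p. cpx (fst p) (snd p)) = (lborel :: (complex^'n) measure)"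
proof (rule lborel_eqI[symmetric])
  fix l u :: "complex^'n"
  assume le: "\<And>b. b \<in> Basis \<Longrightarrow> l \<bullet> b \<le> u \<bullet> b"
  have inn: "z \<bullet> axis j 1 = Re (z $ j)" "z \<bullet> axis j \<i> = Im (z $ j)" for z :: "complex^'n" and j
    by (simp_all add: inner_axis)
  have ax: "axis j 1 \<in> (Basis::(complex^'n) set)" "axis j \<i> \<in> (Basis::(complex^'n) set)" for j
    by (auto simp: Basis_vec_def Basis_complex_def)
  have mem: "z \<in> box l u \<longleftrightarrow> re_vec z \<in> box (re_vec l) (re_vec u) \<and> im_vec z \<in> box (im_vec l) (im_vec u)" for z
    unfolding mem_box_cart by (auto simp: box_def Basis_vec_def Basis_complex_def inner_axis)
  have le': "re_vec l $ j \<le> re_vec u $ j" "im_vec l $ j \<le> im_vec u $ j" for j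
    using le[OF ax(1)[of j]] le[OF ax(2)[of j]] by (simp_all add: inn)
  have eb: "emeasure lborel (box a b) = ennreal (\<Prod>j\<in>UNIV. b $ j - a $ j)" if "\<And>j. a $ j \<le> b $ j" for a b :: "real^'n"
  proof (subst emeasure_lborel_box)
    show "a \<bullet> i \<le> b \<bullet> i" if "i \<in> Basis" for i
      using that \<open>\<And>j. a $ j \<le> b $ j\<close> by (auto simp: Basis_vec_def inner_axis)
  qed (simp add: prod_Basis_vec inner_axis)
  have "(\<lambda>p. cpx (fst p) (snd p)) -` box l u \<inter> space (lborel \<Otimes>\<^sub>M lborel) = box (re_vec l) (re_vec u) \<times> box (im_vec l) (im_vec u)"
    by (auto simp: mem space_pair_measure)
  then have "emeasure (distr (lborel \<Otimes>\<^sub>M lborel) borel (\<lambda>p. cpx (fst p) (snd p))) (box l u)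
     = emeasure lborel (box (re_vec l) (re_vec u)) * emeasure lborel (box (im_vec l) (im_vec u))"
    by (subst emeasure_distr) (auto simp: lborel.emeasure_pair_measure_Times)
  also have "\<dots> = ennreal (\<Prod>j\<in>UNIV. (re_vec u $ j - re_vec l $ j) * (im_vec u $ j - im_vec l $ j))"
    using le' by (simp add: eb prod.distrib ennreal_mult[symmetric] prod_nonneg del: re_vec_nth im_vec_nth)
  also have "(\<Prod>j\<in>UNIV. (re_vec u $ j - re_vec l $ j) * (im_vec u $ j - im_vec l $ j)) = (\<Prod>b\<in>Basis. (u - l) \<bullet> b)"
    by (simp add: prod_Basis_vec Basis_complex_def inner_axis)
  finally show "emeasure (distr (lborel \<Otimes>\<^sub>M lborel) borel (\<lambda>p. cpx (fst p) (snd p))) (box l u) = ennreal (\<Prod>b\<in>Basis. (u - l) \<bullet> b)" .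
qed simp

lemma nn_integral_cpx:
  fixes f :: "complex^'n \<Rightarrow> ennreal"
  assumes [measurable]: "f \<in> borel_measurable borel"
  shows "(\<integral>\<^sup>+z. f z \<partial>lborel) = (\<integral>\<^sup>+a. \<integral>\<^sup>+b. f (cpx a b) \<partial>lborel \<partial>lborel)"
proof -
  have "(\<integral>\<^sup>+z. f z \<partial>lborel) = (\<integral>\<^sup>+p. f (cpx (fst p) (snd p)) \<partial>(lborel \<Otimes>\<^sub>M lborel))"
    by (subst lborel_cpx[symmetric], subst nn_integral_distr) auto
  also have "\<dots> = (\<integral>\<^sup>+a. \<integral>\<^sup>+b. f (cpx a b) \<partial>lborel \<partial>lborel)"
    by (subst lborel.nn_integral_fst[symmetric]) auto
  finally show ?thesis .
qed

lemma AE_re_vec: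
  fixes P :: "real^'n \<Rightarrow> bool"
  assumes "AE x in lborel. P x"
  shows "AE z in lborel. P (re_vec z)"
proof -
  obtain N where N: "{x. \<not> P x} \<subseteq> N" "N \<in> sets lborel" "emeasure lborel N = 0"
    using assms by (auto elim!: AE_E)
  have [measurable]: "N \<in> sets borel" using N by simp
  have "(\<integral>\<^sup>+z. indicator N (re_vec z) \<partial>(lborel::(complex^'n) measure)) = (\<integral>\<^sup>+a. indicator N a * \<infinity> \<partial>(lborel::(real^'n) measure))"
    by (subst nn_integral_cpx) (auto simp: nn_integral_const)
  \<comment> \<open>Each fibre over \<open>N\<close> has infinite measure, but
    \<open>0 * \<infinity> = 0\<close> in \<open>ennreal\<close>.\<close>
  also have "\<dots> = 0" using N by (subst nn_integral_multc) auto
  finally have "AE z in (lborel::(complex^'n) measure). indicator N (re_vec z) = (0::ennreal)"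
    by (subst (asm) nn_integral_0_iff_AE) auto
  then show ?thesis
    by eventually_elim (use N in \<open>auto simp: indicator_def split: if_splits\<close>)
qed

section \<open>Entire functions of several variables\<close>

lemma clinear_iff:
  fixes f :: "complex^'n \<Rightarrow> complex"
  shows "Vector_Spaces.linear (*s) (*) f \<longleftrightarrow> (\<forall>x y. f (x + y) = f x + f y) \<and> (\<forall>c x. f (c *s x) = c * f x)"
proof -
  have 1: "vector_space ((*s) :: complex \<Rightarrow> complex^'n \<Rightarrow> complex^'n)" by unfold_locales
  have 2: "vector_space ((*) :: complex \<Rightarrow> complex \<Rightarrow> complex)"
    by unfold_locales (simp_all add: algebra_simps)
  show ?thesis unfolding Vector_Spaces.linear_iff using 1 2 by blast
qed

lemma entireI:
  assumes "\<And>z. (F has_derivative F' z) (at z)"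
    and "\<And>z x y. F' z (x + y) = F' z x + F' z y" "\<And>z c x. F' z (c *s x) = c * F' z x"
  shows "entire F"
  unfolding entire_def clinear_iff using assms by blast

lemma entireD:
  assumes "entire F"
  shows "\<exists>F'. (F has_derivative F') (at z) \<and> (\<forall>x y. F' (x + y) = F' x + F' y) \<and> (\<forall>c x. F' (c *s x) = c * F' x)"
  using assms unfolding entire_def clinear_iff by blast

lemma entire_imp_continuous: "entire F \<Longrightarrow> continuous_on UNIV F"
  by (metis entire_def has_derivative_continuous continuous_at_imp_continuous_on)

lemma entire_imp_borel_measurable [measurable_dest]: "entire F \<Longrightarrow> F \<in> borel_measurable borel"
  by (intro borel_measurable_continuous_onI entire_imp_continuous)

lemma entire_mult:
  assumes "entire F" "entire G" shows "entire (\<lambda>z. F z * G z)"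
proof -
  have "\<exists>H. ((\<lambda>z. F z * G z) has_derivative H) (at z) \<and> Vector_Spaces.linear (*s) (*) H" for z
  proof -
    obtain F' where F: "(F has_derivative F') (at z)" "\<And>x y. F' (x + y) = F' x + F' y" "\<And>c x. F' (c *s x) = c * F' x"
      using entireD[OF assms(1), of "z"] by blast
    obtain G' where G: "(G has_derivative G') (at z)" "\<And>x y. G' (x + y) = G' x + G' y" "\<And>c x. G' (c *s x) = c * G' x"
      using entireD[OF assms(2), of "z"] by blast
    show ?thesis
      by (rule exI[of _ "\<lambda>h. F z * G' h + F' h * G z"])
         (use has_derivative_mult[OF F(1) G(1)] F G in \<open>auto simp: clinear_iff algebra_simps\<close>)
  qed
  then show ?thesis by (simp add: entire_def)
qed

lemma entire_cmult: "entire F \<Longrightarrow> entire (\<lambda>z. c * F z)"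
proof (rule entire_mult)
  show "entire (\<lambda>z. c)" by (rule entireI[where F'="\<lambda>_ _. 0"]) auto
qed

lemma entire_scaleR:
  assumes "entire F" shows "entire (\<lambda>z. F (r *\<^sub>R z))"
proof -
  have "\<exists>H. ((\<lambda>z. F (r *\<^sub>R z)) has_derivative H) (at z) \<and> Vector_Spaces.linear (*s) (*) H" for z
  proof -
    obtain F' where F: "(F has_derivative F') (at (r *\<^sub>R z))" "\<And>x y. F' (x + y) = F' x + F' y" "\<And>c x. F' (c *s x) = c * F' x"
      using entireD[OF assms, of "r *\<^sub>R z"] by blast
    have "((\<lambda>z. r *\<^sub>R z) has_derivative (\<lambda>h. r *\<^sub>R h)) (at z)" by (auto intro!: derivative_eq_intros)
    from has_derivative_compose[OF this F(1)] have d: "((\<lambda>z. F (r *\<^sub>R z)) has_derivative (\<lambda>h. F' (r *\<^sub>R h))) (at z)" .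
    have c: "r *\<^sub>R (c *s x) = c *s (r *\<^sub>R x)" for c and x :: "complex^'a" by (simp add: vec_eq_iff)
    show ?thesis
      by (rule exI[of _ "\<lambda>h. F' (r *\<^sub>R h)"]) (use d F in \<open>auto simp: clinear_iff scaleR_add_right c\<close>)
  qed
  then show ?thesis by (simp add: entire_def)
qed

lemma has_derivative_bilin_self: "((\<lambda>z. bilin z z) has_derivative (\<lambda>h. 2 * bilin z h)) (at z)"
proof -
  have "((\<lambda>z. \<Sum>j\<in>UNIV. z $ j * z $ j) has_derivative (\<lambda>h. \<Sum>j\<in>UNIV. z $ j * h $ j + h $ j * z $ j)) (at z)"
    by (intro has_derivative_sum has_derivative_mult bounded_linear_imp_has_derivative bounded_linear_vec_nth)
  then show ?thesis by (simp add: bilin_def sum_distrib_left mult.commute)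
qed

lemma bilin_scale_right: "bilin w (c *s z) = c * bilin w z"
  using bilin_scale_left[of c z w] by (simp add: bilin_commute)

lemma entire_exp_bilin: "entire (\<lambda>z. exp (c * bilin z z))"
proof (rule entireI[where F'="\<lambda>z h. exp (c * bilin z z) * (c * (2 * bilin z h))"])
  fix z :: "complex^'n"
  have "((\<lambda>z. c * bilin z z) has_derivative (\<lambda>h. c * (2 * bilin z h))) (at z)"
    by (rule has_derivative_mult_right[OF has_derivative_bilin_self])
  from has_derivative_compose[OF this, of exp "(*) (exp (c * bilin z z))"]
  show "((\<lambda>z. exp (c * bilin z z)) has_derivative (\<lambda>h. exp (c * bilin z z) * (c * (2 * bilin z h)))) (at z)"
    using DERIV_exp[of "c * bilin z z"] by (simp add: has_field_derivative_def)
qed (auto simp: bilin_add_right bilin_scale_right algebra_simps)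

text \<open>By complex linearity the derivative along a complex line is multiplication by
  \<open>F' v\<close>, so one-variable theory applies on every such line.\<close>

lemma entire_line_holomorphic:
  assumes "entire F" shows "(\<lambda>\<zeta>. F (w + \<zeta> *s v)) holomorphic_on UNIV"
proof -
  have "\<exists>d. ((\<lambda>\<zeta>. F (w + \<zeta> *s v)) has_field_derivative d) (at \<zeta>)" for \<zeta>
  proof -
    obtain F' where F: "(F has_derivative F') (at (w + \<zeta> *s v))" "\<And>x y. F' (x + y) = F' x + F' y" "\<And>c x. F' (c *s x) = c * F' x"
      using entireD[OF assms, of "w + \<zeta> *s v"] by blast
    have "((\<lambda>\<zeta>. w + \<zeta> *s v) has_derivative (\<lambda>h. h *s v)) (at \<zeta>)"
    proof -
      have "bounded_linear (\<lambda>h::complex. h *s v)"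
        by (intro linear_conv_bounded_linear[THEN iffD1] linearI) (simp_all add: vec_eq_iff algebra_simps)
      then have "((\<lambda>\<zeta>. w + \<zeta> *s v) has_derivative (\<lambda>h. 0 + h *s v)) (at \<zeta>)"
        by (intro has_derivative_add has_derivative_const bounded_linear_imp_has_derivative)
      then show ?thesis by simp
    qed
    from has_derivative_compose[OF this F(1)] F(3)
    have "((\<lambda>\<zeta>. F (w + \<zeta> *s v)) has_derivative (\<lambda>h. F' v * h)) (at \<zeta>)" by (simp add: mult.commute)
    then show ?thesis by (auto simp: has_field_derivative_def)
  qed
  then show ?thesis by (auto simp: holomorphic_on_def field_differentiable_def)
qed

text \<open>The line \<open>a + \<zeta> b\<close> through real vectors \<open>a\<close>,
  \<open>b\<close> is real for real \<open>\<zeta>\<close> and reaches \<open>a + i b\<close> at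
  \<open>\<zeta> = i\<close>, so the identity theorem in one variable is enough.\<close>

lemma entire_eq_on_real:
  fixes F G :: "complex^'n \<Rightarrow> complex"
  assumes "entire F" "entire G" and eq: "\<And>x. F (cvec x) = G (cvec x)"
  shows "F = G"
proof
  fix z :: "complex^'n"
  let ?l = "\<lambda>\<zeta>. cvec (re_vec z) + \<zeta> *s cvec (im_vec z)"
  have zeq: "?l \<i> = z" by (simp add: vec_eq_iff complex_eq_iff)
  have "F (?l \<i>) - G (?l \<i>) = 0"
  proof (rule analytic_continuation[where f="\<lambda>\<zeta>. F (?l \<zeta>) - G (?l \<zeta>)" and S=UNIV and U="\<real>" and \<xi>=0])
    show "(\<lambda>\<zeta>. F (?l \<zeta>) - G (?l \<zeta>)) holomorphic_on UNIV"
      by (intro holomorphic_on_diff entire_line_holomorphic assms)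
    show "(0::complex) islimpt \<real>"
    proof (rule islimptI)
      fix T assume "(0::complex) \<in> T" "open T"
      then obtain e where e: "e > 0" "ball 0 e \<subseteq> T" by (auto elim: openE)
      show "\<exists>y\<in>\<real>. y \<in> T \<and> y \<noteq> 0"
        using e by (intro bexI[of _ "complex_of_real (e/2)"]) (auto simp: subset_iff dist_norm)
    qed
    show "F (?l \<zeta>) - G (?l \<zeta>) = 0" if "\<zeta> \<in> \<real>" for \<zeta>
    proof -
      from that obtain r where r: "\<zeta> = complex_of_real r" by (auto elim: Reals_cases)
      have "?l \<zeta> = cvec (re_vec z + r *\<^sub>R im_vec z)" by (simp add: vec_eq_iff r)
      then show ?thesis using eq by simp
    qed
  qed auto
  then show "F z = G z" unfolding zeq by simp
qed

lemma norm_exp_remainder_le: "cmod (exp w - 1 - w) \<le> (cmod w)\<^sup>2 * exp (cmod w)"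
proof -
  have "cmod (exp w - (\<Sum>k\<le>1. w ^ k / fact k)) \<le> exp \<bar>Re w\<bar> * cmod w ^ Suc 1 / fact 1"
    by (rule Taylor_exp)
  also have "(\<Sum>k\<le>1. w ^ k / fact k) = 1 + w" by simp
  also have "exp \<bar>Re w\<bar> * cmod w ^ Suc 1 / fact 1 \<le> (cmod w)\<^sup>2 * exp (cmod w)"
    using abs_Re_le_cmod[of w] by (simp add: power2_eq_square mult.commute mult_right_mono mult_left_mono)
  finally show ?thesis by (simp add: diff_diff_eq)
qed

lemma square_le_exp: "0 \<le> x \<Longrightarrow> x\<^sup>2 \<le> 2 * exp (x::real)"
  using exp_lower_Taylor_quadratic[of x] by (simp add: power2_eq_square)

text \<open>Complex differentiability under the integral sign comes from the quadratic remainder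
  of the exponential; no differentiation theorem for parameter integrals is needed.\<close>

lemma entire_laplace:
  fixes w :: "real^'n \<Rightarrow> complex"
  assumes w: "w \<in> borel_measurable borel"
    and int: "\<And>K. integrable lborel (\<lambda>x. exp (K * norm x) * cmod (w x))"
  shows "integrable lborel (\<lambda>x. exp (bilin z (cvec x)) * w x)"
    and "entire (\<lambda>z. \<integral>x. exp (bilin z (cvec x)) * w x \<partial>lborel)"
proof -
  note [measurable] = w
  have ne: "cmod (exp (bilin z (cvec x))) \<le> exp (norm z * norm x)" for z :: "complex^'n" and x
  proof -
    have "cmod (exp (bilin z (cvec x))) \<le> exp (cmod (bilin z (cvec x)))" by (rule norm_exp)
    also have "\<dots> \<le> exp (norm z * norm x)" using norm_bilin_cvec_le by simp
    finally show ?thesis .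
  qed
  have i0: "integrable lborel (\<lambda>x. exp (bilin z (cvec x)) * w x)" for z
    by (rule integrable_dominated[OF int[of "norm z"]]) (use ne in \<open>simp_all add: norm_mult mult_right_mono\<close>)
  then show "integrable lborel (\<lambda>x. exp (bilin z (cvec x)) * w x)" .
  have i1: "integrable lborel (\<lambda>x. bilin h (cvec x) * (exp (bilin z (cvec x)) * w x))" for z h
  proof (rule integrable_dominated)
    show "integrable lborel (\<lambda>x. norm h * exp ((norm z + 1) * norm x) * cmod (w x))"
      unfolding mult.assoc by (intro integrable_mult_right int)
    fix x :: "real^'n"
    have "norm x \<le> exp (norm x)" using exp_ge_add_one_self[of "norm x"] by linarith
    then have "cmod (bilin h (cvec x)) * cmod (exp (bilin z (cvec x))) \<le> (norm h * exp (norm x)) * exp (norm z * norm x)"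
      by (intro mult_mono ne order_trans[OF norm_bilin_cvec_le] mult_left_mono) auto
    also have "\<dots> = norm h * exp ((norm z + 1) * norm x)" by (simp add: exp_add distrib_right)
    finally show "norm (bilin h (cvec x) * (exp (bilin z (cvec x)) * w x)) \<le> norm h * exp ((norm z + 1) * norm x) * cmod (w x)"
      unfolding norm_mult mult.assoc[symmetric] by (rule mult_right_mono) simp
  qed measurable
  let ?F = "\<lambda>z. \<integral>x. exp (bilin z (cvec x)) * w x \<partial>lborel"
  let ?F' = "\<lambda>z h. \<integral>x. bilin h (cvec x) * (exp (bilin z (cvec x)) * w x) \<partial>lborel"
  have add: "?F' z (h + k) = ?F' z h + ?F' z k" for z h k
    using i1 by (simp add: bilin_add_left distrib_right)
  have scale: "?F' z (c *s h) = c * ?F' z h" for z c h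
    by (simp add: bilin_scale_left mult.assoc)
  have scaleR: "?F' z (r *\<^sub>R h) = r *\<^sub>R ?F' z h" for z r h
    unfolding bilin_scaleR_left mult.assoc by (simp add: scaleR_conv_of_real)
  show "entire ?F"
  proof (rule entireI[where F'="?F'"])
    fix z :: "complex^'n"
    \<comment> \<open>The factor 2 and one unit in the exponent absorb \<open>|x|^2\<close>; the
      other unit bounds the exponential in the quadratic remainder for
      \<open>norm h \<le> 1\<close>.\<close>
    define M where "M = 2 * (\<integral>x. exp ((norm z + 2) * norm x) * cmod (w x) \<partial>lborel)"
    have err: "cmod (?F (z + h) - ?F z - ?F' z h) \<le> M * (norm h)\<^sup>2" if h: "norm h \<le> 1" for h
    proof -
      have ident: "(exp (bilin h (cvec x)) - 1 - bilin h (cvec x)) * (exp (bilin z (cvec x)) * w x)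
        = exp (bilin (z + h) (cvec x)) * w x - exp (bilin z (cvec x)) * w x - bilin h (cvec x) * (exp (bilin z (cvec x)) * w x)" for x
        by (simp add: bilin_add_left exp_add algebra_simps)
      have "?F (z + h) - ?F z - ?F' z h = (\<integral>x. (exp (bilin h (cvec x)) - 1 - bilin h (cvec x)) * (exp (bilin z (cvec x)) * w x) \<partial>lborel)"
        unfolding ident by (simp add: i0 i1)
      also have "cmod \<dots> \<le> (\<integral>x. (norm h)\<^sup>2 * (2 * (exp ((norm z + 2) * norm x) * cmod (w x))) \<partial>lborel)"
      proof (rule order_trans[OF integral_norm_bound integral_mono])
        show "integrable lborel (\<lambda>x. cmod ((exp (bilin h (cvec x)) - 1 - bilin h (cvec x)) * (exp (bilin z (cvec x)) * w x)))"
          unfolding ident by (simp add: i0 i1)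
        show "integrable lborel (\<lambda>x. (norm h)\<^sup>2 * (2 * (exp ((norm z + 2) * norm x) * cmod (w x))))"
          by (intro integrable_mult_right int)
        fix x :: "real^'n"
        have b: "cmod (bilin h (cvec x)) \<le> norm h * norm x" by (rule norm_bilin_cvec_le)
        have b1: "norm h * norm x \<le> norm x" using h by (simp add: mult_left_le_one_le)
        have "cmod (exp (bilin h (cvec x)) - 1 - bilin h (cvec x)) \<le> (norm h * norm x)\<^sup>2 * exp (norm x)"
          by (rule order_trans[OF norm_exp_remainder_le]) (use b b1 in \<open>intro mult_mono power_mono; simp\<close>)
        also have "\<dots> \<le> (norm h)\<^sup>2 * (2 * exp (norm x)) * exp (norm x)"
          using square_le_exp[of "norm x"] by (simp add: power_mult_distrib mult_left_mono mult_right_mono)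
        finally have "cmod (exp (bilin h (cvec x)) - 1 - bilin h (cvec x)) * cmod (exp (bilin z (cvec x))) \<le> (norm h)\<^sup>2 * (2 * exp (norm x)) * exp (norm x) * exp (norm z * norm x)"
          by (intro mult_mono ne) auto
        also have "\<dots> = (norm h)\<^sup>2 * (2 * exp ((norm z + 2) * norm x))"
          by (simp add: exp_add[symmetric] mult.assoc) (simp add: algebra_simps)
        finally have "cmod (exp (bilin h (cvec x)) - 1 - bilin h (cvec x)) * cmod (exp (bilin z (cvec x))) * cmod (w x) \<le> (norm h)\<^sup>2 * (2 * exp ((norm z + 2) * norm x)) * cmod (w x)"
          by (rule mult_right_mono) simp
        then show "cmod ((exp (bilin h (cvec x)) - 1 - bilin h (cvec x)) * (exp (bilin z (cvec x)) * w x)) \<le> (norm h)\<^sup>2 * (2 * (exp ((norm z + 2) * norm x) * cmod (w x)))"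
          by (simp add: norm_mult mult.assoc)
      qed
      also have "\<dots> = M * (norm h)\<^sup>2" by (simp add: M_def)
      finally show ?thesis .
    qed
    show "(?F has_derivative ?F' z) (at z)"
      unfolding has_derivative_at
    proof (intro conjI)
      show "bounded_linear (?F' z)"
        by (intro linear_conv_bounded_linear[THEN iffD1] linearI add scaleR)
      show "(\<lambda>h. norm (?F (z + h) - ?F z - ?F' z h) / norm h) \<midarrow>0\<rightarrow> 0"
      proof (rule Lim_null_comparison)
        have "\<forall>\<^sub>F h in at (0::complex^'n). dist h 0 < 1" by (auto simp: eventually_at intro: exI[of _ 1])
        then show "\<forall>\<^sub>F h in at 0. norm (norm (?F (z + h) - ?F z - ?F' z h) / norm h) \<le> M * norm h"
        proof eventually_elim
          case (elim h)
          have "norm (?F (z + h) - ?F z - ?F' z h) \<le> (M * norm h) * norm h"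
            using err[of h] elim by (simp add: power2_eq_square mult.assoc)
          then have "norm (?F (z + h) - ?F z - ?F' z h) / norm h \<le> M * norm h"
            by (cases "h = 0") (simp_all add: pos_divide_le_eq)
          then show ?case by simp
        qed
        show "(\<lambda>h. M * norm h) \<midarrow>0\<rightarrow> 0" by (auto intro!: tendsto_eq_intros)
      qed
    qed
  qed (rule add scale)+
qed

section \<open>The heat transform\<close>

definition gauss_kernel :: "real \<Rightarrow> real^'n \<Rightarrow> real" where
  "gauss_kernel t x = exp (- (norm x)\<^sup>2 / (2 * t)) / sqrt (2 * pi * t) ^ CARD('n)"

text \<open>The analytic continuation of \<open>gauss_kernel t\<close>, with \<open>bilin\<close> in
  place of the squared norm. In imaginary directions its modulus grows like
  \<open>exp (|b|^2 / (2 t))\<close>, the growth that the weight in \<open>fock_energy\<close>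
  compensates.\<close>

definition heat_kernel :: "real \<Rightarrow> complex^'n \<Rightarrow> complex" where
  "heat_kernel t z = exp (- bilin z z / complex_of_real (2 * t)) / complex_of_real (sqrt (2 * pi * t) ^ CARD('n))"

definition heat :: "real \<Rightarrow> (real^'n \<Rightarrow> complex) \<Rightarrow> complex^'n \<Rightarrow> complex" where
  "heat t u z = (\<integral>x. heat_kernel t (z - cvec x) * u x \<partial>lborel)"

text \<open>The growth class in which everything converges: square integrable against every
  Gaussian, however flat. It contains the quasi-periodic functions of finite energy, and its members
  have an entire heat transform at every positive time.\<close>

definition tame :: "('a::euclidean_space \<Rightarrow> complex) \<Rightarrow> bool" where
  "tame u \<longleftrightarrow> u \<in> borel_measurable borel \<and>
     (\<forall>\<mu>>0. integrable lborel (\<lambda>x. exp (- \<mu> * (norm x)\<^sup>2) * (cmod (u x))\<^sup>2))"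

lemma tame_borel_measurable [measurable_dest]: "tame u \<Longrightarrow> u \<in> borel_measurable borel"
  by (simp add: tame_def)

lemma tame_L2: "tame u \<Longrightarrow> \<mu> > 0 \<Longrightarrow> integrable lborel (\<lambda>x. exp (- \<mu> * (norm x)\<^sup>2) * (cmod (u x))\<^sup>2)"
  by (simp add: tame_def)

lemma le_one_plus_square: "x \<le> 1 + (x::real)\<^sup>2"
proof -
  have "0 \<le> (x - 1/2)\<^sup>2" by simp
  then show ?thesis by (simp add: power2_eq_square algebra_simps)
qed

lemma tame_L1:
  fixes u :: "'a::euclidean_space \<Rightarrow> complex"
  assumes u: "tame u" and \<mu>: "\<mu> > 0"
  shows "integrable lborel (\<lambda>x. exp (- \<mu> * (norm x)\<^sup>2) * cmod (u x))"
proof (rule integrable_dominated)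
  have "integrable lborel (\<lambda>x::'a. exp (- \<mu> * (norm x)\<^sup>2))"
    using integrable_gauss[of "1 / (2 * \<mu>)", where 'a='a] \<mu> by (simp add: mult.commute)
  then show "integrable lborel (\<lambda>x. exp (- \<mu> * (norm x)\<^sup>2) + exp (- \<mu> * (norm x)\<^sup>2) * (cmod (u x))\<^sup>2)"
    by (intro Bochner_Integration.integrable_add tame_L2 assms)
  show "norm (exp (- \<mu> * (norm x)\<^sup>2) * cmod (u x)) \<le> exp (- \<mu> * (norm x)\<^sup>2) + exp (- \<mu> * (norm x)\<^sup>2) * (cmod (u x))\<^sup>2" for x
    using mult_left_mono[OF le_one_plus_square[of "cmod (u x)"], of "exp (- \<mu> * (norm x)\<^sup>2)"]
    by (simp add: distrib_left)
qed (use tame_borel_measurable[OF u] in measurable)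

text \<open>Completing the square: half of the Gaussian decay pays for the linear
  exponential.\<close>

lemma exp_linear_gauss_le:
  assumes "\<mu> > 0"
  shows "exp (K * r) * exp (- \<mu> * r\<^sup>2) \<le> exp (K\<^sup>2 / (2 * \<mu>)) * exp (- (\<mu> / 2) * (r::real)\<^sup>2)"
proof -
  have "0 \<le> (\<mu> * r - K)\<^sup>2 / (2 * \<mu>)" using assms by simp
  also have "\<dots> = K\<^sup>2 / (2 * \<mu>) + \<mu> / 2 * r\<^sup>2 - K * r"
    using assms by (simp add: power2_eq_square field_simps)
  finally have "K * r - \<mu> * r\<^sup>2 \<le> K\<^sup>2 / (2 * \<mu>) - \<mu> / 2 * r\<^sup>2" by (simp add: algebra_simps)
  then show ?thesis by (simp add: exp_add[symmetric])
qed

lemma tame_exp: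
  fixes u :: "'a::euclidean_space \<Rightarrow> complex"
  assumes u: "tame u" and \<mu>: "\<mu> > 0"
  shows "integrable lborel (\<lambda>x. exp (K * norm x) * (exp (- \<mu> * (norm x)\<^sup>2) * cmod (u x)))"
proof (rule integrable_dominated)
  show "integrable lborel (\<lambda>x. exp (K\<^sup>2 / (2 * \<mu>)) * (exp (- (\<mu> / 2) * (norm x)\<^sup>2) * cmod (u x)))"
    by (intro integrable_mult_right tame_L1 u) (use \<mu> in simp)
  show "norm (exp (K * norm x) * (exp (- \<mu> * (norm x)\<^sup>2) * cmod (u x))) \<le> exp (K\<^sup>2 / (2 * \<mu>)) * (exp (- (\<mu> / 2) * (norm x)\<^sup>2) * cmod (u x))" for x
    using mult_right_mono[OF exp_linear_gauss_le[OF \<mu>, of K "norm x"] norm_ge_zero[of "u x"]]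
    by (simp only: real_norm_def abs_mult abs_exp_cancel abs_norm_cancel mult.assoc)
qed (use tame_borel_measurable[OF u] in measurable)

section \<open>The complex heat kernel and the entire heat transform\<close>

lemma heat_kernel_cpx:
  "heat_kernel t (cpx a b) = complex_of_real (gauss_kernel t a * exp ((norm b)\<^sup>2 / (2 * t))) * exp (- \<i> * complex_of_real (a \<bullet> b / t))"
proof -
  have e: "- bilin (cpx a b) (cpx a b) / complex_of_real (2 * t)
     = complex_of_real (- (norm a)\<^sup>2 / (2 * t)) + complex_of_real ((norm b)\<^sup>2 / (2 * t)) + (- \<i> * complex_of_real (a \<bullet> b / t))"
    unfolding bilin_cpx_self by (cases "t = 0") (simp_all add: complex_eq_iff field_simps)
  show ?thesis
    unfolding heat_kernel_def gauss_kernel_def e exp_add exp_of_real by simp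
qed

lemma heat_kernel_cvec: "heat_kernel t (cvec a) = complex_of_real (gauss_kernel t a)"
  using heat_kernel_cpx[of t a 0] by (simp add: cpx_zero_right)

lemma gauss_kernel_nonneg: "t > 0 \<Longrightarrow> gauss_kernel t x \<ge> 0" by (simp add: gauss_kernel_def)
lemma gauss_kernel_minus: "gauss_kernel t (- x) = gauss_kernel t x" by (simp add: gauss_kernel_def)

lemma cmod_heat_kernel_cpx:
  "t > 0 \<Longrightarrow> cmod (heat_kernel t (cpx a b)) = gauss_kernel t a * exp ((norm b)\<^sup>2 / (2 * t))"
  unfolding heat_kernel_cpx by (simp add: norm_mult gauss_kernel_nonneg del: of_real_divide of_real_mult)

lemma borel_measurable_gauss_kernel [measurable]: "gauss_kernel t \<in> borel_measurable borel"
  unfolding gauss_kernel_def by measurable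

lemma borel_measurable_heat_kernel [measurable]: "heat_kernel t \<in> borel_measurable borel"
  unfolding heat_kernel_def by measurable

lemma integrable_gauss_kernel: "t > 0 \<Longrightarrow> integrable lborel (gauss_kernel t :: real^'n \<Rightarrow> real)"
  unfolding gauss_kernel_def[abs_def] by (intro integrable_divide integrable_gauss)

lemma integral_gauss_kernel: "t > 0 \<Longrightarrow> (\<integral>x. gauss_kernel t x \<partial>(lborel::(real^'n) measure)) = 1"
  unfolding gauss_kernel_def[abs_def]
  using integral_gauss[of t, where 'a="real^'n"] by simp

lemma nn_integral_gauss_kernel: "t > 0 \<Longrightarrow> (\<integral>\<^sup>+x. ennreal (gauss_kernel t x) \<partial>(lborel::(real^'n) measure)) = 1"
  by (subst nn_integral_eq_integral[OF integrable_gauss_kernel])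
     (auto simp: gauss_kernel_nonneg integral_gauss_kernel)

text \<open>Expanding the square separates a factor in \<open>z\<close> alone from a Gaussian in
  \<open>x\<close> alone; what couples them is the exponential kernel of
  \<open>entire_laplace\<close> at the point \<open>z / t\<close>.\<close>

lemma heat_kernel_factor:
  fixes z :: "complex^'n"
  assumes "t > 0"
  shows "heat_kernel t (z - cvec x) * u x
    = (inverse (complex_of_real (sqrt (2 * pi * t) ^ CARD('n))) * exp (complex_of_real (- 1 / (2 * t)) * bilin z z))
      * (exp (bilin ((1 / t) *\<^sub>R z) (cvec x)) * (complex_of_real (exp (- (1 / (2 * t)) * (norm x)\<^sup>2)) * u x))"
proof -
  have e: "- bilin (z - cvec x) (z - cvec x) / complex_of_real (2 * t)
    = complex_of_real (- 1 / (2 * t)) * bilin z z + bilin ((1 / t) *\<^sub>R z) (cvec x) + complex_of_real (- (1 / (2 * t)) * (norm x)\<^sup>2)"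
    using assms
    by (simp add: bilin_diff_left bilin_diff_right bilin_cvec bilin_scaleR_left bilin_commute[of "cvec x" z] power2_norm_eq_inner field_simps)
  show ?thesis
    unfolding heat_kernel_def e exp_add exp_of_real by (simp only: divide_inverse mult_ac)
qed

lemma
  fixes u :: "real^'n \<Rightarrow> complex"
  assumes u: "tame u" and t: "t > 0"
  shows integrable_heat: "integrable lborel (\<lambda>x. heat_kernel t (z - cvec x) * u x)"
    and entire_heat: "entire (heat t u)"
proof -
  note [measurable] = tame_borel_measurable[OF u]
  let ?w = "\<lambda>x. complex_of_real (exp (- (1 / (2 * t)) * (norm x)\<^sup>2)) * u x"
  have w: "?w \<in> borel_measurable borel" by measurable
  have i: "integrable lborel (\<lambda>x. exp (K * norm x) * cmod (?w x))" for K
    using tame_exp[OF u, of "1 / (2 * t)" K] t by (simp add: norm_mult)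
  show "integrable lborel (\<lambda>x. heat_kernel t (z - cvec x) * u x)"
    unfolding heat_kernel_factor[OF t] by (intro integrable_mult_right entire_laplace(1) w i)
  have "heat t u = (\<lambda>z. (inverse (complex_of_real (sqrt (2 * pi * t) ^ CARD('n))) * exp (complex_of_real (- 1 / (2 * t)) * bilin z z))
      * (\<integral>x. exp (bilin ((1 / t) *\<^sub>R z) (cvec x)) * ?w x \<partial>lborel))"
    unfolding heat_def heat_kernel_factor[OF t] by (simp only: integral_mult_right_zero)
  moreover have "entire (\<lambda>z. (inverse (complex_of_real (sqrt (2 * pi * t) ^ CARD('n))) * exp (complex_of_real (- 1 / (2 * t)) * bilin z z))
      * (\<integral>x. exp (bilin ((1 / t) *\<^sub>R z) (cvec x)) * ?w x \<partial>lborel))"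
    by (rule entire_mult[OF entire_cmult[OF entire_exp_bilin] entire_scaleR[OF entire_laplace(2)[OF w i]]])
  ultimately show "entire (heat t u)" by simp
qed

text \<open>The weight \<open>exp (- |b|^2 / t)\<close> is the inverse square of the growth factor
  of the kernel, so on the fibre over \<open>a\<close> exactly the squared Fourier transform of
  \<open>h\<close> at \<open>b / t\<close> remains, divided by \<open>c^2\<close>. The Jacobian
  \<open>t^d\<close> and the \<open>(2 pi)^d\<close> of Plancherel cancel that constant.\<close>

lemma heat_isometry_fiber:
  fixes u :: "real^'n \<Rightarrow> complex"
  assumes u: "tame u" and t: "t > 0"
  shows "(\<integral>\<^sup>+b. ennreal ((cmod (heat t u (cpx a b)))\<^sup>2 * exp (- (norm b)\<^sup>2 / t)) \<partial>lborel)
     = (\<integral>\<^sup>+x. ennreal (exp (- (norm (x - a))\<^sup>2 / t)) * ennreal ((cmod (u x))\<^sup>2) \<partial>lborel)"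
proof -
  note [measurable] = tame_borel_measurable[OF u]
  define c where "c = sqrt (2 * pi * t) ^ CARD('n)"
  have c: "c > 0" "c\<^sup>2 = (2 * pi * t) ^ CARD('n)"
    using t by (auto simp: c_def power_mult[symmetric] mult.commute[of _ 2] power_mult)
  define h where "h x = complex_of_real (exp (- (norm (x - a))\<^sup>2 / (2 * t))) * u x" for x
  have [measurable]: "h \<in> borel_measurable borel" unfolding h_def by measurable
  \<comment> \<open>\<open>tame\<close> speaks of Gaussians centred at 0; recentring from
    \<open>a\<close> costs half of the rate.\<close>
  have sq: "- (norm (x - a))\<^sup>2 \<le> - (1/2) * (norm x)\<^sup>2 + (norm a)\<^sup>2" for x
    using norm_add_sq_le[of "x - a" a] by simp
  have ge: "exp (- (norm (x - a))\<^sup>2 / s) \<le> exp ((norm a)\<^sup>2 / s) * exp (- (1 / (2 * s)) * (norm x)\<^sup>2)" if "s > 0" for x s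
  proof -
    have "- (norm (x - a))\<^sup>2 / s \<le> (- (1/2) * (norm x)\<^sup>2 + (norm a)\<^sup>2) / s"
      using that by (intro divide_right_mono sq) simp
    also have "\<dots> = (norm a)\<^sup>2 / s + - (1 / (2 * s)) * (norm x)\<^sup>2" using that by (simp add: field_simps)
    finally show ?thesis by (simp only: exp_add[symmetric] exp_le_cancel_iff)
  qed
  have hi: "integrable lborel h"
  proof (rule integrable_dominated)
    show "integrable lborel (\<lambda>x. exp ((norm a)\<^sup>2 / (2 * t)) * exp (- (1 / (2 * (2 * t))) * (norm x)\<^sup>2) * cmod (u x))"
      unfolding mult.assoc[of "exp _"] using t by (intro integrable_mult_right tame_L1 u) simp
    show "norm (h x) \<le> exp ((norm a)\<^sup>2 / (2 * t)) * exp (- (1 / (2 * (2 * t))) * (norm x)\<^sup>2) * cmod (u x)" for x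
      using mult_right_mono[OF ge[of "2 * t" x] norm_ge_zero[of "u x"]] t by (simp add: h_def norm_mult)
  qed measurable
  have hsq: "(cmod (h x))\<^sup>2 = exp (- (norm (x - a))\<^sup>2 / t) * (cmod (u x))\<^sup>2" for x
    unfolding h_def by (simp add: norm_mult power_mult_distrib exp_double[symmetric])
  have hi2: "integrable lborel (\<lambda>x. (cmod (h x))\<^sup>2)"
  proof (rule integrable_dominated)
    show "integrable lborel (\<lambda>x. exp ((norm a)\<^sup>2 / t) * exp (- (1 / (2 * t)) * (norm x)\<^sup>2) * (cmod (u x))\<^sup>2)"
      unfolding mult.assoc[of "exp _"] using t by (intro integrable_mult_right tame_L2 u) simp
    show "norm ((cmod (h x))\<^sup>2) \<le> exp ((norm a)\<^sup>2 / t) * exp (- (1 / (2 * t)) * (norm x)\<^sup>2) * (cmod (u x))\<^sup>2" for x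
      using mult_right_mono[OF ge[of t x] zero_le_power2[of "cmod (u x)"]] t by (simp add: hsq)
  qed measurable
  have eq: "(cmod (heat t u (cpx a b)))\<^sup>2 * exp (- (norm b)\<^sup>2 / t) = (cmod (fourier h (0 + (1 / t) *\<^sub>R b)))\<^sup>2 / c\<^sup>2" for b
  proof -
    have k: "heat_kernel t (cpx a b - cvec x) * u x
      = (complex_of_real (exp ((norm b)\<^sup>2 / (2 * t)) / c) * exp (- \<i> * complex_of_real (a \<bullet> b / t)))
        * (exp (\<i> * complex_of_real (x \<bullet> ((1 / t) *\<^sub>R b))) * h x)" for x
    proof -
      have e: "exp (- \<i> * complex_of_real ((a - x) \<bullet> b / t)) = exp (- \<i> * complex_of_real (a \<bullet> b / t)) * exp (\<i> * complex_of_real (x \<bullet> ((1 / t) *\<^sub>R b)))"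
        unfolding exp_add[symmetric] by (simp add: inner_diff_left diff_divide_distrib right_diff_distrib)
      show ?thesis
        unfolding cpx_diff_cvec heat_kernel_cpx gauss_kernel_def h_def c_def[symmetric] e norm_minus_commute[of a x]
        by (simp only: of_real_mult of_real_divide divide_inverse mult_ac)
    qed
    have "heat t u (cpx a b) = (complex_of_real (exp ((norm b)\<^sup>2 / (2 * t)) / c) * exp (- \<i> * complex_of_real (a \<bullet> b / t))) * fourier h ((1 / t) *\<^sub>R b)"
      unfolding heat_def fourier_def k by (rule integral_mult_right_zero)
    then have "cmod (heat t u (cpx a b)) = exp ((norm b)\<^sup>2 / (2 * t)) / c * cmod (fourier h ((1 / t) *\<^sub>R b))"
      using c by (simp add: norm_mult norm_divide)
    then have "(cmod (heat t u (cpx a b)))\<^sup>2 = exp ((norm b)\<^sup>2 / t) * ((cmod (fourier h ((1 / t) *\<^sub>R b)))\<^sup>2 / c\<^sup>2)"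
      by (simp add: power_mult_distrib power_divide exp_double[symmetric])
    then show ?thesis by (simp add: exp_minus field_simps)
  qed
  have m: "(\<lambda>b. ennreal ((cmod (fourier h b))\<^sup>2)) \<in> borel_measurable borel" by measurable
  have "(\<integral>\<^sup>+b. ennreal ((cmod (heat t u (cpx a b)))\<^sup>2 * exp (- (norm b)\<^sup>2 / t)) \<partial>lborel)
    = (\<integral>\<^sup>+b. ennreal (1 / c\<^sup>2) * ennreal ((cmod (fourier h (0 + (1 / t) *\<^sub>R b)))\<^sup>2) \<partial>lborel)"
    unfolding eq using c(1) by (simp add: ennreal_mult[symmetric])
  also have "\<dots> = ennreal (1 / c\<^sup>2) * (\<integral>\<^sup>+b. ennreal ((cmod (fourier h (0 + (1 / t) *\<^sub>R b)))\<^sup>2) \<partial>lborel)"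
    by (rule nn_integral_cmult) (simp add: measurable_compose[OF borel_measurable_affine m])
  also have "(\<integral>\<^sup>+b. ennreal ((cmod (fourier h (0 + (1 / t) *\<^sub>R b)))\<^sup>2) \<partial>lborel) = ennreal (t ^ CARD('n)) * (\<integral>\<^sup>+b. ennreal ((cmod (fourier h b))\<^sup>2) \<partial>lborel)"
  proof -
    have "(\<integral>\<^sup>+b. ennreal ((cmod (fourier h b))\<^sup>2) \<partial>lborel) = ennreal ((1 / t) ^ CARD('n)) * (\<integral>\<^sup>+b. ennreal ((cmod (fourier h (0 + (1 / t) *\<^sub>R b)))\<^sup>2) \<partial>lborel)"
      using nn_integral_lborel_affine[OF _ m, of "1 / t" 0] t by simp
    then show ?thesis using t by (simp add: mult.assoc[symmetric] ennreal_mult[symmetric] power_divide)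
  qed
  also have "\<dots> = ennreal (t ^ CARD('n)) * (ennreal ((2 * pi) ^ CARD('n)) * (\<integral>\<^sup>+x. ennreal ((cmod (h x))\<^sup>2) \<partial>lborel))"
    using plancherel[OF hi hi2] by simp
  also have "ennreal (1 / c\<^sup>2) * (ennreal (t ^ CARD('n)) * (ennreal ((2 * pi) ^ CARD('n)) * (\<integral>\<^sup>+x. ennreal ((cmod (h x))\<^sup>2) \<partial>lborel)))
     = (\<integral>\<^sup>+x. ennreal ((cmod (h x))\<^sup>2) \<partial>lborel)"
  proof -
    have "1 / c\<^sup>2 * (t ^ CARD('n) * (2 * pi) ^ CARD('n)) = 1"
      using c t by (simp add: power_mult_distrib field_simps)
    then have "ennreal (1 / c\<^sup>2) * (ennreal (t ^ CARD('n)) * ennreal ((2 * pi) ^ CARD('n))) = 1"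
      using t by (subst ennreal_mult[symmetric], simp, simp, subst ennreal_mult[symmetric], simp, simp) (simp only: ennreal_1)
    then show ?thesis by (simp only: mult.assoc[symmetric] mult_1)
  qed
  finally show ?thesis unfolding hsq by (simp add: ennreal_mult)
qed

section \<open>Heat semigroup and isometry over a fundamental domain\<close>

text \<open>Completing the square in \<open>y\<close>: \<open>m\<close> and \<open>\<rho>\<close>
  are mean and variance of one of two independent Gaussian vectors, of variances
  \<open>\<tau>\<close> and \<open>s\<close>, given that their sum is \<open>a\<close>. The
  imaginary part \<open>b\<close> contributes a constant factor and a character in \<open>y\<close>,
  hence a Gaussian Fourier transform.\<close>

lemma gauss_kernel_convolution:
  fixes a b :: "real^'n"
  assumes \<tau>: "\<tau> > 0" and s: "s > 0"
  shows "integrable lborel (\<lambda>y. gauss_kernel \<tau> y * gauss_kernel s (a - y))"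
    and "(\<integral>y. heat_kernel \<tau> (cvec y) * heat_kernel s (cpx a b - cvec y) \<partial>lborel) = heat_kernel (s + \<tau>) (cpx a b)"
proof -
  define \<rho> where "\<rho> = s * \<tau> / (s + \<tau>)"
  have st: "s + \<tau> > 0" using \<tau> s by simp
  have \<rho>: "\<rho> > 0" using \<tau> s by (simp add: \<rho>_def)
  define m where "m = (\<tau> / (s + \<tau>)) *\<^sub>R a"
  define K where "K = sqrt (2 * pi * \<tau>) ^ CARD('n) * sqrt (2 * pi * s) ^ CARD('n)"
  have K: "sqrt (2 * pi * \<rho>) ^ CARD('n) / K = 1 / sqrt (2 * pi * (s + \<tau>)) ^ CARD('n)"
  proof -
    have "sqrt (2 * pi * \<rho>) * sqrt (2 * pi * (s + \<tau>)) = sqrt (2 * pi * \<tau>) * sqrt (2 * pi * s)"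
      unfolding real_sqrt_mult[symmetric] \<rho>_def using \<tau> s by (intro arg_cong[where f=sqrt]) (simp add: field_simps)
    then have "sqrt (2 * pi * \<rho>) ^ CARD('n) * sqrt (2 * pi * (s + \<tau>)) ^ CARD('n) = K"
      unfolding K_def power_mult_distrib[symmetric] by simp
    moreover have "K > 0" using \<tau> s by (simp add: K_def)
    ultimately show ?thesis using st by (simp add: frac_eq_eq)
  qed
  have sq: "(norm y)\<^sup>2 / (2 * \<tau>) + (norm (a - y))\<^sup>2 / (2 * s) = (norm (y - m))\<^sup>2 / (2 * \<rho>) + (norm a)\<^sup>2 / (2 * (s + \<tau>))" for y
  proof -
    have e: "(norm (a - y))\<^sup>2 = (norm a)\<^sup>2 - 2 * (a \<bullet> y) + (norm y)\<^sup>2" "(norm (y - m))\<^sup>2 = (norm y)\<^sup>2 - 2 * (\<tau> / (s + \<tau>)) * (a \<bullet> y) + (\<tau> / (s + \<tau>))\<^sup>2 * (norm a)\<^sup>2"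
      unfolding m_def power2_norm_eq_inner by (simp_all add: inner_diff_left inner_diff_right inner_commute power2_eq_square)
    show ?thesis unfolding e \<rho>_def using \<tau> s st
      by (simp add: divide_simps) (simp add: algebra_simps power2_eq_square)
  qed
  have prod: "gauss_kernel \<tau> y * gauss_kernel s (a - y) = exp (- (norm a)\<^sup>2 / (2 * (s + \<tau>))) / K * exp (- (norm (y - m))\<^sup>2 / (2 * \<rho>))" for y
  proof -
    have "- (norm y)\<^sup>2 / (2 * \<tau>) + - (norm (a - y))\<^sup>2 / (2 * s) = - (norm a)\<^sup>2 / (2 * (s + \<tau>)) + - (norm (y - m))\<^sup>2 / (2 * \<rho>)"
      using sq[of y] by simp
    then have "exp (- (norm y)\<^sup>2 / (2 * \<tau>)) * exp (- (norm (a - y))\<^sup>2 / (2 * s)) = exp (- (norm a)\<^sup>2 / (2 * (s + \<tau>))) * exp (- (norm (y - m))\<^sup>2 / (2 * \<rho>))"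
      by (simp only: exp_add[symmetric])
    then show ?thesis unfolding gauss_kernel_def K_def by simp
  qed
  have "integrable lborel (\<lambda>y. exp (- (norm (y + - m))\<^sup>2 / (2 * \<rho>)))"
    by (intro integrable_translation[of "\<lambda>y. exp (- (norm y)\<^sup>2 / (2 * \<rho>))"] integrable_gauss \<rho>)
  then show "integrable lborel (\<lambda>y. gauss_kernel \<tau> y * gauss_kernel s (a - y))"
    unfolding prod by (intro integrable_mult_right) simp
  let ?c = "complex_of_real (exp ((norm b)\<^sup>2 / (2 * s)) * (exp (- (norm a)\<^sup>2 / (2 * (s + \<tau>))) / K))"
  let ?G = "\<lambda>w. exp (\<i> * complex_of_real (w \<bullet> ((1 / s) *\<^sub>R b))) * complex_of_real (exp (- (norm w)\<^sup>2 / (2 * \<rho>)))"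
  let ?ph = "exp (- \<i> * complex_of_real (a \<bullet> b / (s + \<tau>)))"
  have am: "(a - (w + m)) \<bullet> b / s = a \<bullet> b / (s + \<tau>) - w \<bullet> ((1 / s) *\<^sub>R b)" for w
    unfolding m_def using s st by (simp add: inner_diff_left inner_add_left) (simp add: field_simps)
  have ker: "heat_kernel \<tau> (cvec (w + m)) * heat_kernel s (cpx a b - cvec (w + m)) = (?c * ?ph) * ?G w" for w
  proof -
    have "heat_kernel \<tau> (cvec (w + m)) * heat_kernel s (cpx a b - cvec (w + m))
      = complex_of_real (exp ((norm b)\<^sup>2 / (2 * s)) * (gauss_kernel \<tau> (w + m) * gauss_kernel s (a - (w + m)))) * exp (- \<i> * complex_of_real ((a - (w + m)) \<bullet> b / s))"
      unfolding cpx_diff_cvec heat_kernel_cpx heat_kernel_cvec of_real_mult by (simp only: mult_ac)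
    also have "exp (- \<i> * complex_of_real ((a - (w + m)) \<bullet> b / s)) = ?ph * exp (\<i> * complex_of_real (w \<bullet> ((1 / s) *\<^sub>R b)))"
      unfolding am exp_add[symmetric] by (simp add: algebra_simps)
    finally show ?thesis unfolding prod by (simp add: mult_ac)
  qed
  have "(\<integral>y. heat_kernel \<tau> (cvec y) * heat_kernel s (cpx a b - cvec y) \<partial>lborel)
    = (\<integral>w. heat_kernel \<tau> (cvec (w + m)) * heat_kernel s (cpx a b - cvec (w + m)) \<partial>lborel)"
    by (rule integral_translation[symmetric]) measurable
  also have "\<dots> = (?c * ?ph) * (\<integral>w. ?G w \<partial>lborel)"
    unfolding ker by (rule integral_mult_right_zero)
  also have "(\<integral>w. ?G w \<partial>lborel) = complex_of_real (sqrt (2 * pi * \<rho>) ^ CARD('n) * exp (- \<rho> * (norm ((1 / s) *\<^sub>R b))\<^sup>2 / 2))"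
    using integral_gauss_fourier[OF \<rho>, of "(1 / s) *\<^sub>R b"] by simp
  also have "(?c * ?ph) * complex_of_real (sqrt (2 * pi * \<rho>) ^ CARD('n) * exp (- \<rho> * (norm ((1 / s) *\<^sub>R b))\<^sup>2 / 2)) = heat_kernel (s + \<tau>) (cpx a b)"
  proof -
    have r: "e1 * (ea / K) * (k * e2) = ea * (k / K) * (e1 * e2)" for e1 ea k e2 :: real
      by simp
    have "(norm b)\<^sup>2 / (2 * s) + - \<rho> * (norm ((1 / s) *\<^sub>R b))\<^sup>2 / 2 = (norm b)\<^sup>2 / (2 * (s + \<tau>))"
      using s st \<tau> by (simp add: \<rho>_def power_mult_distrib power_divide power2_eq_square divide_simps) (simp add: algebra_simps)
    then have "exp ((norm b)\<^sup>2 / (2 * s)) * exp (- \<rho> * (norm ((1 / s) *\<^sub>R b))\<^sup>2 / 2) = exp ((norm b)\<^sup>2 / (2 * (s + \<tau>)))"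
      by (simp only: exp_add[symmetric])
    then have "exp ((norm b)\<^sup>2 / (2 * s)) * (exp (- (norm a)\<^sup>2 / (2 * (s + \<tau>))) / K) * (sqrt (2 * pi * \<rho>) ^ CARD('n) * exp (- \<rho> * (norm ((1 / s) *\<^sub>R b))\<^sup>2 / 2))
       = exp (- (norm a)\<^sup>2 / (2 * (s + \<tau>))) * (sqrt (2 * pi * \<rho>) ^ CARD('n) / K) * exp ((norm b)\<^sup>2 / (2 * (s + \<tau>)))"
      by (subst r) (simp only:)
    also have "\<dots> = gauss_kernel (s + \<tau>) a * exp ((norm b)\<^sup>2 / (2 * (s + \<tau>)))"
      unfolding K gauss_kernel_def by simp
    finally have eq: "exp ((norm b)\<^sup>2 / (2 * s)) * (exp (- (norm a)\<^sup>2 / (2 * (s + \<tau>))) / K) * (sqrt (2 * pi * \<rho>) ^ CARD('n) * exp (- \<rho> * (norm ((1 / s) *\<^sub>R b))\<^sup>2 / 2))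
      = gauss_kernel (s + \<tau>) a * exp ((norm b)\<^sup>2 / (2 * (s + \<tau>)))" .
    show ?thesis
      unfolding heat_kernel_cpx eq[symmetric] of_real_mult by (simp only: mult_ac)
  qed
  finally show "(\<integral>y. heat_kernel \<tau> (cvec y) * heat_kernel s (cpx a b - cvec y) \<partial>lborel) = heat_kernel (s + \<tau>) (cpx a b)" .
qed

lemma integral_gauss_kernel_convolution:
  fixes a :: "real^'n"
  assumes "\<tau> > 0" "s > 0"
  shows "(\<integral>y. gauss_kernel \<tau> y * gauss_kernel s (a - y) \<partial>lborel) = gauss_kernel (s + \<tau>) a"
proof -
  have "complex_of_real (\<integral>y. gauss_kernel \<tau> y * gauss_kernel s (a - y) \<partial>lborel) = (\<integral>y. heat_kernel \<tau> (cvec y) * heat_kernel s (cpx a 0 - cvec y) \<partial>lborel)"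
    by (simp only: cpx_zero_right cvec_diff[symmetric] heat_kernel_cvec of_real_mult[symmetric] integral_complex_of_real)
  also have "\<dots> = complex_of_real (gauss_kernel (s + \<tau>) a)"
    unfolding gauss_kernel_convolution(2)[OF assms] by (simp only: cpx_zero_right heat_kernel_cvec)
  finally show ?thesis by (simp only: of_real_eq_iff)
qed

text \<open>Fubini and the convolution identity. The modulus of the complex kernel is a real
  Gaussian times a factor in \<open>b\<close> alone, so absolute integrability reduces to the same
  identity for real kernels.\<close>

lemma heat_semigroup:
  fixes u :: "real^'n \<Rightarrow> complex"
  assumes u: "tame u" and \<tau>: "\<tau> > 0" and s: "s > 0"
  shows "(\<integral>y. complex_of_real (gauss_kernel \<tau> y) * heat s u (z - cvec y) \<partial>lborel) = heat (s + \<tau>) u z"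
proof -
  note [measurable] = tame_borel_measurable[OF u]
  obtain a b where z: "z = cpx a b" using cpx_re_im[of z] by metis
  let ?F = "\<lambda>x y. (heat_kernel \<tau> (cvec y) * heat_kernel s (cpx (a - x) b - cvec y)) * u x"
  have nF: "norm (?F x y) = (exp ((norm b)\<^sup>2 / (2 * s)) * cmod (u x)) * (gauss_kernel \<tau> y * gauss_kernel s (a - x - y))" for x y
    unfolding cpx_diff_cvec norm_mult cmod_heat_kernel_cpx[OF s] heat_kernel_cvec
    using gauss_kernel_nonneg[OF \<tau>, of y] by (simp add: mult_ac)
  have int: "integrable (lborel \<Otimes>\<^sub>M lborel) (case_prod ?F)"
  proof (rule lborel_pair.Fubini_integrable)
    have "integrable lborel (\<lambda>y. norm (?F x y))" for x
      unfolding nF by (intro integrable_mult_right gauss_kernel_convolution(1) \<tau> s)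
    then have "integrable lborel (?F x)" for x
      by (subst integrable_norm_iff[symmetric]) auto
    then show "AE x in lborel. integrable lborel (\<lambda>y. case_prod ?F (x, y))" by simp
    have "(\<integral>y. norm (case_prod ?F (x, y)) \<partial>lborel) = exp ((norm b)\<^sup>2 / (2 * s)) * norm (heat_kernel (s + \<tau>) (cvec a - cvec x) * u x)" for x
    proof -
      have "(\<integral>y. norm (case_prod ?F (x, y)) \<partial>lborel) = exp ((norm b)\<^sup>2 / (2 * s)) * cmod (u x) * gauss_kernel (s + \<tau>) (a - x)"
        unfolding prod.case nF integral_mult_right_zero integral_gauss_kernel_convolution[OF \<tau> s] ..
      also have "\<dots> = exp ((norm b)\<^sup>2 / (2 * s)) * norm (heat_kernel (s + \<tau>) (cvec a - cvec x) * u x)"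
        unfolding cvec_diff[symmetric] heat_kernel_cvec norm_mult
        using gauss_kernel_nonneg[of "s + \<tau>" "a - x"] \<tau> s by simp
      finally show ?thesis .
    qed
    then show "integrable lborel (\<lambda>x. \<integral>y. norm (case_prod ?F (x, y)) \<partial>lborel)"
      using integrable_heat[OF u, of "s + \<tau>" "cvec a"] \<tau> s by simp
  qed measurable
  have "(\<integral>y. complex_of_real (gauss_kernel \<tau> y) * heat s u (z - cvec y) \<partial>lborel) = (\<integral>y. \<integral>x. ?F x y \<partial>lborel \<partial>lborel)"
  proof (intro Bochner_Integration.integral_cong refl)
    fix y
    have "complex_of_real (gauss_kernel \<tau> y) * heat s u (z - cvec y) = (\<integral>x. complex_of_real (gauss_kernel \<tau> y) * (heat_kernel s (z - cvec y - cvec x) * u x) \<partial>lborel)"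
      unfolding heat_def by (rule integral_mult_right_zero[symmetric])
    also have "\<dots> = (\<integral>x. ?F x y \<partial>lborel)"
      unfolding z heat_kernel_cvec cpx_diff_cvec by (simp only: mult.assoc diff_diff_add add.commute)
    finally show "complex_of_real (gauss_kernel \<tau> y) * heat s u (z - cvec y) = (\<integral>x. ?F x y \<partial>lborel)" .
  qed
  also have "\<dots> = (\<integral>x. \<integral>y. ?F x y \<partial>lborel \<partial>lborel)"
    by (rule lborel_pair.Fubini_integral[OF int])
  also have "\<dots> = (\<integral>x. heat_kernel (s + \<tau>) (cpx (a - x) b) * u x \<partial>lborel)"
    by (simp only: integral_mult_left_zero gauss_kernel_convolution(2)[OF \<tau> s])
  also have "\<dots> = heat (s + \<tau>) u z"
    unfolding heat_def z cpx_diff_cvec ..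
  finally show ?thesis .
qed

text \<open>Cauchy-Schwarz after splitting \<open>k\<close> into two factors
  \<open>sqrt (k x)\<close>. Where the product is not integrable the left side is 0 by the
  convention for Bochner integrals.\<close>

lemma jensen_square:
  fixes f :: "'a \<Rightarrow> complex"
  assumes [measurable]: "k \<in> borel_measurable M" "f \<in> borel_measurable M"
    and k: "\<And>x. 0 \<le> k x" "(\<integral>\<^sup>+x. ennreal (k x) \<partial>M) = 1"
  shows "ennreal ((cmod (\<integral>x. complex_of_real (k x) * f x \<partial>M))\<^sup>2) \<le> (\<integral>\<^sup>+x. ennreal (k x * (cmod (f x))\<^sup>2) \<partial>M)"
proof (cases "integrable M (\<lambda>x. complex_of_real (k x) * f x)")
  case True
  have "ennreal (cmod (\<integral>x. complex_of_real (k x) * f x \<partial>M)) \<le> (\<integral>\<^sup>+x. ennreal (norm (complex_of_real (k x) * f x)) \<partial>M)"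
    by (rule integral_norm_bound_ennreal[OF True])
  also have "\<dots> = (\<integral>\<^sup>+x. ennreal (sqrt (k x)) * ennreal (sqrt (k x) * cmod (f x)) \<partial>M)"
    using k(1) by (intro nn_integral_cong) (simp add: norm_mult ennreal_mult[symmetric] mult.assoc[symmetric])
  finally have "(ennreal (cmod (\<integral>x. complex_of_real (k x) * f x \<partial>M)))\<^sup>2 \<le> (\<integral>\<^sup>+x. ennreal (sqrt (k x)) * ennreal (sqrt (k x) * cmod (f x)) \<partial>M)\<^sup>2"
    by (rule power_mono) simp
  also have "\<dots> \<le> (\<integral>\<^sup>+x. (ennreal (sqrt (k x)))\<^sup>2 \<partial>M) * (\<integral>\<^sup>+x. (ennreal (sqrt (k x) * cmod (f x)))\<^sup>2 \<partial>M)"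
    by (rule Cauchy_Schwarz_nn_integral) auto
  also have "\<dots> = (\<integral>\<^sup>+x. ennreal (k x * (cmod (f x))\<^sup>2) \<partial>M)"
    using k by (simp add: ennreal_power power_mult_distrib)
  finally show ?thesis by (simp add: ennreal_power)
qed (simp add: not_integrable_integral_eq)

text \<open>The squared Fock norm up to scaling, over \<open>D\<close> times the imaginary space,
  after removal of the factor \<open>exp (\<nu>/2 <z,z>)\<close>; this removal is why the weight
  involves the imaginary part only.\<close>

definition fock_energy :: "(real^'n) set \<Rightarrow> real \<Rightarrow> (complex^'n \<Rightarrow> complex) \<Rightarrow> ennreal" where
  "fock_energy D t p = (\<integral>\<^sup>+a. indicator D a * (\<integral>\<^sup>+b. ennreal ((cmod (p (cpx a b)))\<^sup>2 * exp (- (norm b)\<^sup>2 / t)) \<partial>lborel) \<partial>lborel)"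

definition dom_energy :: "(real^'n) set \<Rightarrow> (real^'n \<Rightarrow> complex) \<Rightarrow> ennreal" where
  "dom_energy D u = (\<integral>\<^sup>+x. indicator D x * ennreal ((cmod (u x))\<^sup>2) \<partial>lborel)"

section \<open>Quasi-periodic functions and the isometry over a fundamental domain\<close>

locale character_domain = periodic_domain G D for G D :: "(real^'n) set" +
  fixes ch :: "real^'n \<Rightarrow> complex"
  assumes cmod_ch: "\<And>g. g \<in> G \<Longrightarrow> cmod (ch g) = 1"
begin

definition quasi_periodic :: "(real^'n \<Rightarrow> complex) \<Rightarrow> bool" where
  "quasi_periodic u \<longleftrightarrow> u \<in> borel_measurable borel \<and> (\<forall>g\<in>G. AE x in lborel. u (x + g) = ch g * u x)"

lemma quasi_periodic_cmod:
  assumes "quasi_periodic u" "g \<in> G"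
  shows "AE x in lborel. ennreal ((cmod (u (x + g)))\<^sup>2) = ennreal ((cmod (u x))\<^sup>2)"
proof -
  have "AE x in lborel. u (x + g) = ch g * u x" using assms by (simp add: quasi_periodic_def)
  then show ?thesis by eventually_elim (simp add: norm_mult cmod_ch[OF assms(2)])
qed

lemma quasi_periodic_diff: "quasi_periodic u \<Longrightarrow> quasi_periodic v \<Longrightarrow> quasi_periodic (\<lambda>x. u x - v x)"
  unfolding quasi_periodic_def
proof (intro conjI ballI)
  fix g assume *: "u \<in> borel_measurable borel \<and> (\<forall>g\<in>G. AE x in lborel. u (x + g) = ch g * u x)"
    "v \<in> borel_measurable borel \<and> (\<forall>g\<in>G. AE x in lborel. v (x + g) = ch g * v x)" and g: "g \<in> G"
  from * g have "AE x in lborel. u (x + g) = ch g * u x" "AE x in lborel. v (x + g) = ch g * v x" by auto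
  then show "AE x in lborel. u (x + g) - v (x + g) = ch g * (u x - v x)"
    by eventually_elim (simp add: right_diff_distrib)
qed auto

text \<open>Uniformity in \<open>u\<close> is the point: it yields tameness, bounded point
  evaluations, and the passage from energy 0 on \<open>D\<close> to vanishing almost
  everywhere.\<close>

lemma weighted_bound:
  assumes "\<mu> > 0"
  shows "\<exists>C<\<infinity>. \<forall>u. quasi_periodic u \<longrightarrow> (\<integral>\<^sup>+x. ennreal (exp (- \<mu> * (norm x)\<^sup>2) * (cmod (u x))\<^sup>2) \<partial>lborel) \<le> C * dom_energy D u"
proof (rule gauss_weighted_bound[OF assms])
  fix C :: ennreal
  assume C: "C < \<infinity>" "\<And>h :: real^'n \<Rightarrow> ennreal. h \<in> borel_measurable borel \<Longrightarrow> (\<And>g. g \<in> G \<Longrightarrow> AE x in lborel. h (x + g) = h x) \<Longrightarrow>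
      (\<integral>\<^sup>+x. ennreal (exp (- \<mu> * (norm x)\<^sup>2)) * h x \<partial>lborel) \<le> C * (\<integral>\<^sup>+x. indicator D x * h x \<partial>lborel)"
  show ?thesis
  proof (intro exI[of _ C] conjI allI impI C(1))
    fix u assume u: "quasi_periodic u"
    have [measurable]: "u \<in> borel_measurable borel" using u by (simp add: quasi_periodic_def)
    have "(\<integral>\<^sup>+x. ennreal (exp (- \<mu> * (norm x)\<^sup>2)) * ennreal ((cmod (u x))\<^sup>2) \<partial>lborel) \<le> C * dom_energy D u"
      unfolding dom_energy_def
    proof (rule C(2))
      show "(\<lambda>x. ennreal ((cmod (u x))\<^sup>2)) \<in> borel_measurable borel" by measurable
    qed (rule quasi_periodic_cmod[OF u])
    then show "(\<integral>\<^sup>+x. ennreal (exp (- \<mu> * (norm x)\<^sup>2) * (cmod (u x))\<^sup>2) \<partial>lborel) \<le> C * dom_energy D u"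
      by (simp add: ennreal_mult)
  qed
qed

lemma quasi_periodic_tame:
  assumes u: "quasi_periodic u" and e: "dom_energy D u < \<infinity>"
  shows "tame u"
  unfolding tame_def
proof (intro conjI allI impI)
  show [measurable]: "u \<in> borel_measurable borel" using u by (simp add: quasi_periodic_def)
  fix \<mu> :: real assume \<mu>: "\<mu> > 0"
  obtain C where C: "C < \<infinity>" "\<And>u. quasi_periodic u \<Longrightarrow> (\<integral>\<^sup>+x. ennreal (exp (- \<mu> * (norm x)\<^sup>2) * (cmod (u x))\<^sup>2) \<partial>lborel) \<le> C * dom_energy D u"
    using weighted_bound[OF \<mu>] by blast
  have "(\<integral>\<^sup>+x. ennreal (exp (- \<mu> * (norm x)\<^sup>2) * (cmod (u x))\<^sup>2) \<partial>lborel) < \<infinity>"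
    using C(2)[OF u] by (rule order_le_less_trans) (use C(1) e in \<open>simp add: ennreal_mult_less_top\<close>)
  then show "integrable lborel (\<lambda>x. exp (- \<mu> * (norm x)\<^sup>2) * (cmod (u x))\<^sup>2)"
    by (intro integrableI_nonneg) auto
qed

text \<open>Integrating the fibre identity over \<open>D\<close> leaves a convolution of a periodic
  function with \<open>exp (- |x|^2 / t)\<close>, whose total mass is the constant in front.\<close>

lemma heat_isometry:
  assumes u: "quasi_periodic u" "dom_energy D u < \<infinity>" and t: "t > 0"
  shows "fock_energy D t (heat t u) = ennreal (sqrt (pi * t) ^ CARD('n)) * dom_energy D u"
proof -
  have [measurable]: "u \<in> borel_measurable borel" using u by (simp add: quasi_periodic_def)
  have "fock_energy D t (heat t u) = (\<integral>\<^sup>+a. indicator D a * (\<integral>\<^sup>+x. ennreal (exp (- (norm (x - a))\<^sup>2 / t)) * ennreal ((cmod (u x))\<^sup>2) \<partial>lborel) \<partial>lborel)"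
    unfolding fock_energy_def heat_isometry_fiber[OF quasi_periodic_tame[OF u] t] ..
  also have "\<dots> = (\<integral>\<^sup>+x. ennreal (exp (- (norm x)\<^sup>2 / t)) \<partial>(lborel::(real^'n) measure)) * dom_energy D u"
    unfolding dom_energy_def
    using nn_integral_domain_convolution[of "\<lambda>x. ennreal ((cmod (u x))\<^sup>2)" "\<lambda>x. ennreal (exp (- (norm x)\<^sup>2 / t))", OF _ _ quasi_periodic_cmod[OF u(1)]]
    by simp
  also have "(\<integral>\<^sup>+x. ennreal (exp (- (norm x)\<^sup>2 / t)) \<partial>(lborel::(real^'n) measure)) = ennreal (sqrt (pi * t) ^ CARD('n))"
    using nn_integral_gauss[of "t / 2", where 'a="real^'n"] t by simp
  finally show ?thesis .
qed

lemma heat_translate: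
  assumes u: "quasi_periodic u" and g: "g \<in> G"
  shows "heat t u (z + cvec g) = ch g * heat t u z"
proof -
  have [measurable]: "u \<in> borel_measurable borel" using u by (simp add: quasi_periodic_def)
  have "heat t u (z + cvec g) = (\<integral>x. heat_kernel t (z + cvec g - cvec (x + g)) * u (x + g) \<partial>lborel)"
    unfolding heat_def by (rule integral_translation[symmetric]) measurable
  also have "\<dots> = (\<integral>x. ch g * (heat_kernel t (z - cvec x) * u x) \<partial>lborel)"
  proof (rule integral_cong_AE)
    have "AE x in lborel. u (x + g) = ch g * u x" using u g by (simp add: quasi_periodic_def)
    then show "AE x in lborel. heat_kernel t (z + cvec g - cvec (x + g)) * u (x + g) = ch g * (heat_kernel t (z - cvec x) * u x)"
      by eventually_elim (simp add: cvec_add)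
  qed measurable
  also have "\<dots> = ch g * heat t u z" unfolding heat_def by (rule integral_mult_right_zero)
  finally show ?thesis .
qed

text \<open>Real convolution only moves the fibre index \<open>a\<close>. Jensen's inequality for
  the probability density \<open>gauss_kernel \<tau>\<close> bounds each fibre, and the fibre energy
  \<open>\<Phi>\<close> is periodic, so its integral over \<open>D\<close> is unaffected by the
  shift.\<close>

lemma fock_energy_contraction:
  fixes p :: "complex^'n \<Rightarrow> complex"
  assumes [measurable]: "p \<in> borel_measurable borel"
    and p: "\<And>z g. g \<in> G \<Longrightarrow> p (z + cvec g) = ch g * p z" and \<tau>: "\<tau> > 0"
  shows "fock_energy D t (\<lambda>z. \<integral>y. complex_of_real (gauss_kernel \<tau> y) * p (z - cvec y) \<partial>lborel) \<le> fock_energy D t p"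
proof -
  define \<Phi> where "\<Phi> a = (\<integral>\<^sup>+b. ennreal ((cmod (p (cpx a b)))\<^sup>2 * exp (- (norm b)\<^sup>2 / t)) \<partial>lborel)" for a
  have [measurable]: "\<Phi> \<in> borel_measurable borel" unfolding \<Phi>_def by measurable
  have per: "\<Phi> (a + g) = \<Phi> a" if "g \<in> G" for a g
    unfolding \<Phi>_def cpx_add_cvec[symmetric] p[OF that] by (simp add: norm_mult cmod_ch[OF that])
  have "(\<integral>\<^sup>+b. ennreal ((cmod (\<integral>y. complex_of_real (gauss_kernel \<tau> y) * p (cpx a b - cvec y) \<partial>lborel))\<^sup>2 * exp (- (norm b)\<^sup>2 / t)) \<partial>lborel)
    \<le> (\<integral>\<^sup>+y. ennreal (gauss_kernel \<tau> y) * \<Phi> (a + - y) \<partial>lborel)" for a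
  proof -
    have "(\<integral>\<^sup>+b. ennreal ((cmod (\<integral>y. complex_of_real (gauss_kernel \<tau> y) * p (cpx a b - cvec y) \<partial>lborel))\<^sup>2 * exp (- (norm b)\<^sup>2 / t)) \<partial>lborel)
      \<le> (\<integral>\<^sup>+b. (\<integral>\<^sup>+y. ennreal (gauss_kernel \<tau> y) * ennreal ((cmod (p (cpx (a + - y) b)))\<^sup>2 * exp (- (norm b)\<^sup>2 / t)) \<partial>lborel) \<partial>lborel)"
    proof (rule nn_integral_mono)
      fix b
      have "ennreal ((cmod (\<integral>y. complex_of_real (gauss_kernel \<tau> y) * p (cpx a b - cvec y) \<partial>lborel))\<^sup>2 * exp (- (norm b)\<^sup>2 / t))
        \<le> (\<integral>\<^sup>+y. ennreal (gauss_kernel \<tau> y * (cmod (p (cpx a b - cvec y)))\<^sup>2) \<partial>lborel) * ennreal (exp (- (norm b)\<^sup>2 / t))"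
        by (subst ennreal_mult) (auto intro!: mult_right_mono jensen_square simp: gauss_kernel_nonneg[OF \<tau>] nn_integral_gauss_kernel[OF \<tau>])
      also have "\<dots> = (\<integral>\<^sup>+y. ennreal (gauss_kernel \<tau> y * (cmod (p (cpx a b - cvec y)))\<^sup>2) * ennreal (exp (- (norm b)\<^sup>2 / t)) \<partial>lborel)"
        by (rule nn_integral_multc[symmetric]) measurable
      also have "\<dots> = (\<integral>\<^sup>+y. ennreal (gauss_kernel \<tau> y) * ennreal ((cmod (p (cpx (a + - y) b)))\<^sup>2 * exp (- (norm b)\<^sup>2 / t)) \<partial>lborel)"
        by (intro nn_integral_cong) (simp add: ennreal_mult[symmetric] gauss_kernel_nonneg[OF \<tau>] cpx_diff_cvec mult.assoc)
      finally show "ennreal ((cmod (\<integral>y. complex_of_real (gauss_kernel \<tau> y) * p (cpx a b - cvec y) \<partial>lborel))\<^sup>2 * exp (- (norm b)\<^sup>2 / t))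
        \<le> (\<integral>\<^sup>+y. ennreal (gauss_kernel \<tau> y) * ennreal ((cmod (p (cpx (a + - y) b)))\<^sup>2 * exp (- (norm b)\<^sup>2 / t)) \<partial>lborel)" .
    qed
    also have "\<dots> = (\<integral>\<^sup>+y. (\<integral>\<^sup>+b. ennreal (gauss_kernel \<tau> y) * ennreal ((cmod (p (cpx (a + - y) b)))\<^sup>2 * exp (- (norm b)\<^sup>2 / t)) \<partial>lborel) \<partial>lborel)"
      by (rule lborel_pair.Fubini'[symmetric]) measurable
    also have "\<dots> = (\<integral>\<^sup>+y. ennreal (gauss_kernel \<tau> y) * \<Phi> (a + - y) \<partial>lborel)"
      unfolding \<Phi>_def by (intro nn_integral_cong nn_integral_cmult) measurable
    finally show ?thesis .
  qed
  then have "fock_energy D t (\<lambda>z. \<integral>y. complex_of_real (gauss_kernel \<tau> y) * p (z - cvec y) \<partial>lborel)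
    \<le> (\<integral>\<^sup>+a. indicator D a * (\<integral>\<^sup>+y. ennreal (gauss_kernel \<tau> y) * \<Phi> (a + - y) \<partial>lborel) \<partial>lborel)"
    unfolding fock_energy_def by (rule nn_integral_mono[OF mult_left_mono]) simp_all
  also have "\<dots> = (\<integral>\<^sup>+a. (\<integral>\<^sup>+y. ennreal (gauss_kernel \<tau> y) * (indicator D a * \<Phi> (a + - y)) \<partial>lborel) \<partial>lborel)"
    by (intro nn_integral_cong) (simp add: nn_integral_cmult[symmetric] mult_ac)
  also have "\<dots> = (\<integral>\<^sup>+y. (\<integral>\<^sup>+a. ennreal (gauss_kernel \<tau> y) * (indicator D a * \<Phi> (a + - y)) \<partial>lborel) \<partial>lborel)"
    by (rule lborel_pair.Fubini'[symmetric]) measurable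
  also have "\<dots> = (\<integral>\<^sup>+y. ennreal (gauss_kernel \<tau> y) * (\<integral>\<^sup>+a. indicator D a * \<Phi> a \<partial>lborel) \<partial>(lborel::(real^'n) measure))"
  proof (rule nn_integral_cong)
    fix y :: "real^'n"
    have "(\<integral>\<^sup>+a. ennreal (gauss_kernel \<tau> y) * (indicator D a * \<Phi> (a + - y)) \<partial>lborel) = ennreal (gauss_kernel \<tau> y) * (\<integral>\<^sup>+a. indicator D a * \<Phi> (a + - y) \<partial>lborel)"
      by (rule nn_integral_cmult) measurable
    also have "(\<integral>\<^sup>+a. indicator D a * \<Phi> (a + - y) \<partial>lborel) = (\<integral>\<^sup>+a. indicator D a * \<Phi> a \<partial>lborel)"
      by (rule nn_integral_domain_translate) (simp_all add: per)
    finally show "(\<integral>\<^sup>+a. ennreal (gauss_kernel \<tau> y) * (indicator D a * \<Phi> (a + - y)) \<partial>lborel) = ennreal (gauss_kernel \<tau> y) * (\<integral>\<^sup>+a. indicator D a * \<Phi> a \<partial>lborel)" .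
  qed
  also have "\<dots> = (\<integral>\<^sup>+a. indicator D a * \<Phi> a \<partial>lborel)"
    by (subst nn_integral_multc) (simp_all add: nn_integral_gauss_kernel[OF \<tau>])
  also have "\<dots> = fock_energy D t p" unfolding fock_energy_def \<Phi>_def ..
  finally show ?thesis .
qed

end

section \<open>Gaussian mean value property\<close>

lemma nn_integral_shear_fst:
  fixes F :: "'a::euclidean_space \<times> 'a \<Rightarrow> ennreal"
  assumes [measurable]: "F \<in> borel_measurable (lborel \<Otimes>\<^sub>M lborel)"
  shows "(\<integral>\<^sup>+p. F (fst p + k *\<^sub>R snd p, snd p) \<partial>(lborel \<Otimes>\<^sub>M lborel)) = (\<integral>\<^sup>+p. F p \<partial>(lborel \<Otimes>\<^sub>M lborel))"
proof -
  have "(\<integral>\<^sup>+p. F (fst p + k *\<^sub>R snd p, snd p) \<partial>(lborel \<Otimes>\<^sub>M lborel)) = (\<integral>\<^sup>+b. \<integral>\<^sup>+a. F (a + k *\<^sub>R b, b) \<partial>lborel \<partial>lborel)"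
    by (subst lborel_pair.nn_integral_snd[symmetric]) (auto simp: split_def)
  also have "\<dots> = (\<integral>\<^sup>+b. \<integral>\<^sup>+a. F (a, b) \<partial>lborel \<partial>lborel)"
    by (intro nn_integral_cong nn_integral_translation[where f="\<lambda>a. F (a, _)"]) measurable
  also have "\<dots> = (\<integral>\<^sup>+p. F p \<partial>(lborel \<Otimes>\<^sub>M lborel))"
    by (rule lborel_pair.nn_integral_snd) (auto simp: split_def)
  finally show ?thesis .
qed

lemma nn_integral_shear_snd:
  fixes F :: "'a::euclidean_space \<times> 'a \<Rightarrow> ennreal"
  assumes [measurable]: "F \<in> borel_measurable (lborel \<Otimes>\<^sub>M lborel)"
  shows "(\<integral>\<^sup>+p. F (fst p, snd p + k *\<^sub>R fst p) \<partial>(lborel \<Otimes>\<^sub>M lborel)) = (\<integral>\<^sup>+p. F p \<partial>(lborel \<Otimes>\<^sub>M lborel))"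
proof -
  have "(\<integral>\<^sup>+p. F (fst p, snd p + k *\<^sub>R fst p) \<partial>(lborel \<Otimes>\<^sub>M lborel)) = (\<integral>\<^sup>+a. \<integral>\<^sup>+b. F (a, b + k *\<^sub>R a) \<partial>lborel \<partial>lborel)"
    by (subst lborel.nn_integral_fst[symmetric]) auto
  also have "\<dots> = (\<integral>\<^sup>+a. \<integral>\<^sup>+b. F (a, b) \<partial>lborel \<partial>lborel)"
    by (intro nn_integral_cong nn_integral_translation[where f="\<lambda>b. F (_, b)"]) measurable
  also have "\<dots> = (\<integral>\<^sup>+p. F p \<partial>(lborel \<Otimes>\<^sub>M lborel))"
    by (rule lborel.nn_integral_fst) auto
  finally show ?thesis .
qed

text \<open>Multiplication by \<open>exp (i \<theta>)\<close> on pairs \<open>(a, b)\<close> read as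
  \<open>a + i b\<close>, written in real terms so that it acts on the product measure;
  \<open>exp_scale_cpx\<close> makes the link.\<close>

definition rotate :: "real \<Rightarrow> 'a::real_vector \<times> 'a \<Rightarrow> 'a \<times> 'a" where
  "rotate \<theta> p = (cos \<theta> *\<^sub>R fst p - sin \<theta> *\<^sub>R snd p, sin \<theta> *\<^sub>R fst p + cos \<theta> *\<^sub>R snd p)"

lemma rotate_rotate: "rotate \<alpha> (rotate \<beta> p) = rotate (\<alpha> + \<beta>) p"
  by (simp add: rotate_def cos_add sin_add scaleR_add_right scaleR_diff_right scaleR_add_left scaleR_diff_left algebra_simps)

lemma borel_measurable_rotate [measurable]:
  "rotate \<theta> \<in> borel \<Otimes>\<^sub>M borel \<rightarrow>\<^sub>M (borel \<Otimes>\<^sub>M borel :: ('a::euclidean_space \<times> 'a) measure)"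
  unfolding rotate_def by measurable

text \<open>A plane rotation is a product of three shears unless its angle is an odd multiple of
  \<open>\<pi>\<close>; that case is reached by rotating twice by half the angle.\<close>

lemma nn_integral_rotate:
  fixes F :: "'a::euclidean_space \<times> 'a \<Rightarrow> ennreal"
  assumes [measurable]: "F \<in> borel_measurable (lborel \<Otimes>\<^sub>M lborel)"
  shows "(\<integral>\<^sup>+p. F (rotate \<theta> p) \<partial>(lborel \<Otimes>\<^sub>M lborel)) = (\<integral>\<^sup>+p. F p \<partial>(lborel \<Otimes>\<^sub>M lborel))"
proof -
  have gen: "(\<integral>\<^sup>+p. F (rotate \<theta> p) \<partial>(lborel \<Otimes>\<^sub>M lborel)) = (\<integral>\<^sup>+p. F p \<partial>(lborel \<Otimes>\<^sub>M lborel))"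
    if c: "cos (\<theta> / 2) \<noteq> 0" and m [measurable]: "F \<in> borel_measurable (lborel \<Otimes>\<^sub>M lborel)" for \<theta> and F :: "'a \<times> 'a \<Rightarrow> ennreal"
  proof -
    \<comment> \<open>Chosen so that the diagonal entry comes out right,
      \<open>1 + k sin \<theta> = cos \<theta>\<close>; the tangent of the half angle is meaningful
      because of \<open>c\<close>.\<close>
    define k where "k = - tan (\<theta> / 2)"
    have s: "sin \<theta> = 2 * sin (\<theta> / 2) * cos (\<theta> / 2)" using sin_double[of "\<theta> / 2"] by simp
    have co: "cos \<theta> = 2 * (cos (\<theta> / 2))\<^sup>2 - 1" using cos_double_cos[of "\<theta> / 2"] by simp
    have k1: "1 + k * sin \<theta> = cos \<theta>"
    proof -
      have "k * sin \<theta> = - 2 * (sin (\<theta> / 2))\<^sup>2" using c by (simp add: k_def tan_def s power2_eq_square)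
      then show ?thesis unfolding co sin_squared_eq by simp
    qed
    have k2: "k * (1 + cos \<theta>) = - sin \<theta>" using c by (simp add: k_def tan_def s co power2_eq_square)
    let ?S = "\<lambda>p::'a \<times> 'a. (fst p + k *\<^sub>R snd p, snd p)"
    let ?T = "\<lambda>p::'a \<times> 'a. (fst p, snd p + sin \<theta> *\<^sub>R fst p)"
    have "rotate \<theta> p = ?S (?T (?S p))" for p
    proof -
      have 1: "sin \<theta> *\<^sub>R fst p + cos \<theta> *\<^sub>R snd p = snd p + sin \<theta> *\<^sub>R (fst p + k *\<^sub>R snd p)"
        unfolding k1[symmetric] by (simp add: scaleR_add_left scaleR_add_right mult.commute)
      have "cos \<theta> *\<^sub>R fst p - sin \<theta> *\<^sub>R snd p = (1 + k * sin \<theta>) *\<^sub>R fst p + (k * (1 + cos \<theta>)) *\<^sub>R snd p"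
        unfolding k1 k2 by simp
      also have "\<dots> = fst p + k *\<^sub>R snd p + k *\<^sub>R (sin \<theta> *\<^sub>R fst p + cos \<theta> *\<^sub>R snd p)"
        by (simp add: scaleR_add_left scaleR_add_right distrib_left)
      finally show ?thesis unfolding rotate_def 1 by simp
    qed
    then have "(\<integral>\<^sup>+p. F (rotate \<theta> p) \<partial>(lborel \<Otimes>\<^sub>M lborel)) = (\<integral>\<^sup>+p. F (?S (?T (?S p))) \<partial>(lborel \<Otimes>\<^sub>M lborel))"
      by simp
    also have "\<dots> = (\<integral>\<^sup>+p. F (?S (?T p)) \<partial>(lborel \<Otimes>\<^sub>M lborel))"
      by (rule nn_integral_shear_fst[where F="\<lambda>p. F (?S (?T p))"]) measurable
    also have "\<dots> = (\<integral>\<^sup>+p. F (?S p) \<partial>(lborel \<Otimes>\<^sub>M lborel))"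
      by (rule nn_integral_shear_snd[where F="\<lambda>p. F (?S p)"]) measurable
    also have "\<dots> = (\<integral>\<^sup>+p. F p \<partial>(lborel \<Otimes>\<^sub>M lborel))"
      by (rule nn_integral_shear_fst) (rule m)
    finally show ?thesis .
  qed
  show ?thesis
  proof (cases "cos (\<theta> / 2) = 0")
    case True
    \<comment> \<open>\<open>cos (\<theta> / 2) = 0\<close> gives
      \<open>cos (\<theta> / 4)^2 = 1/2\<close>, so the generic case covers the half angle.\<close>
    then have c: "cos (\<theta> / 2 / 2) \<noteq> 0" using cos_double_cos[of "\<theta> / 2 / 2"] by auto
    have "(\<integral>\<^sup>+p. F (rotate \<theta> p) \<partial>(lborel \<Otimes>\<^sub>M lborel)) = (\<integral>\<^sup>+p. F (rotate (\<theta> / 2) (rotate (\<theta> / 2) p)) \<partial>(lborel \<Otimes>\<^sub>M lborel))"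
      by (simp add: rotate_rotate)
    also have "\<dots> = (\<integral>\<^sup>+p. F (rotate (\<theta> / 2) p) \<partial>(lborel \<Otimes>\<^sub>M lborel))"
      by (rule gen[OF c, of "\<lambda>p. F (rotate (\<theta> / 2) p)"]) measurable
    also have "\<dots> = (\<integral>\<^sup>+p. F p \<partial>(lborel \<Otimes>\<^sub>M lborel))" by (rule gen[OF c assms])
    finally show ?thesis .
  qed (rule gen[OF _ assms])
qed

lemma integral_rotate:
  fixes F :: "'a::euclidean_space \<times> 'a \<Rightarrow> complex"
  assumes [measurable]: "F \<in> borel_measurable (lborel \<Otimes>\<^sub>M lborel)"
  shows "(\<integral>p. F (rotate \<theta> p) \<partial>(lborel \<Otimes>\<^sub>M lborel)) = (\<integral>p. F p \<partial>(lborel \<Otimes>\<^sub>M lborel))"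
proof -
  let ?P = "lborel \<Otimes>\<^sub>M lborel :: ('a \<times> 'a) measure"
  have "distr ?P ?P (rotate \<theta>) = ?P"
  proof (rule measure_eqI)
    fix A assume A: "A \<in> sets (distr ?P ?P (rotate \<theta>))"
    then have [measurable]: "A \<in> sets ?P" by simp
    have "emeasure (distr ?P ?P (rotate \<theta>)) A = (\<integral>\<^sup>+p. indicator A p \<partial>distr ?P ?P (rotate \<theta>))"
      using A by simp
    also have "\<dots> = (\<integral>\<^sup>+p. indicator A (rotate \<theta> p) \<partial>?P)"
      by (rule nn_integral_distr) measurable
    also have "\<dots> = (\<integral>\<^sup>+p. indicator A p \<partial>?P)"
      by (rule nn_integral_rotate) measurable
    also have "\<dots> = emeasure ?P A" using A by (intro nn_integral_indicator) simp
    finally show "emeasure (distr ?P ?P (rotate \<theta>)) A = emeasure ?P A" .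
  qed simp
  then have "(\<integral>p. F p \<partial>?P) = (\<integral>p. F p \<partial>distr ?P ?P (rotate \<theta>))" by simp
  also have "\<dots> = (\<integral>p. F (rotate \<theta> p) \<partial>?P)" by (rule integral_distr) measurable
  finally show ?thesis by simp
qed

text \<open>Cauchy's formula on the unit circle, parametrised by the unit interval as in
  \<open>circlepath\<close>, and transferred from the gauge integral to \<open>lborel\<close>, where
  Fubini is available.\<close>

lemma circle_mean_value:
  assumes g: "g holomorphic_on UNIV"
  shows "(\<integral>x. indicator {0..1} x *\<^sub>R g (exp (2 * complex_of_real pi * \<i> * complex_of_real x)) \<partial>lborel) = g 0"
proof -
  let ?e = "\<lambda>x::real. exp (2 * complex_of_real pi * \<i> * complex_of_real x)"
  have "((\<lambda>u. g u / (u - 0)) has_contour_integral (2 * complex_of_real pi * \<i> * g 0)) (circlepath 0 1)"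
    by (rule Cauchy_integral_circlepath_simple) (use g in \<open>auto intro: holomorphic_on_subset\<close>)
  then have "((\<lambda>x. g (?e x) / ?e x * (2 * complex_of_real pi * \<i> * ?e x)) has_integral (2 * complex_of_real pi * \<i> * g 0)) {0..1}"
    unfolding has_contour_integral_def
    by (rule has_integral_eq[rotated])
       (subst vector_derivative_circlepath01, simp, simp, simp add: circlepath mult_ac)
  then have "((\<lambda>x. (2 * complex_of_real pi * \<i>) * g (?e x)) has_integral (2 * complex_of_real pi * \<i>) * g 0) {0..1}"
    by (simp add: mult_ac)
  then have "((\<lambda>x. (1 / (2 * complex_of_real pi * \<i>)) * ((2 * complex_of_real pi * \<i>) * g (?e x))) has_integral (1 / (2 * complex_of_real pi * \<i>)) * ((2 * complex_of_real pi * \<i>) * g 0)) {0..1}"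
    by (rule has_integral_mult_right)
  then have hk: "((\<lambda>x. g (?e x)) has_integral g 0) {0..1}" by simp
  have "continuous_on UNIV g" using g by (rule holomorphic_on_imp_continuous_on)
  then have "continuous_on {0..1} (\<lambda>x. g (?e x))"
    by (rule continuous_on_compose2) (auto intro!: continuous_intros)
  then have "set_integrable lborel {0..1} (\<lambda>x. g (?e x))"
    by (rule borel_integrable_compact[unfolded set_integrable_def[symmetric], rotated]) simp
  from set_borel_integral_eq_integral(2)[OF this] integral_unique[OF hk] show ?thesis
    by (simp add: set_lebesgue_integral_def)
qed

lemma exp_scale_cpx:
  "exp (\<i> * complex_of_real \<theta>) *s cpx (fst p) (snd p) = cpx (fst (rotate \<theta> p)) (snd (rotate \<theta> p))"
  by (simp add: rotate_def vec_eq_iff complex_eq_iff exp_Euler cos_of_real sin_of_real algebra_simps)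

text \<open>A rotation invariant weight turns the mean value property on circles in the complex
  lines through 0 into a mean value property on the whole space.\<close>

lemma gauss_mean_value:
  fixes f :: "complex^'n \<Rightarrow> complex"
  assumes f: "entire f" and s: "s > 0"
    and int: "integrable (lborel \<Otimes>\<^sub>M lborel) (\<lambda>p. complex_of_real (gauss_kernel s (fst p) * gauss_kernel s (snd p)) * f (cpx (fst p) (snd p)))"
  shows "(\<integral>p. complex_of_real (gauss_kernel s (fst p) * gauss_kernel s (snd p)) * f (cpx (fst p) (snd p)) \<partial>(lborel \<Otimes>\<^sub>M lborel)) = f 0"
proof -
  note [measurable] = entire_imp_borel_measurable[OF f]
  let ?P = "lborel \<Otimes>\<^sub>M lborel :: ((real^'n) \<times> (real^'n)) measure"
  define m :: "((real^'n) \<times> (real^'n)) \<Rightarrow> real" where "m p = gauss_kernel s (fst p) * gauss_kernel s (snd p)" for p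
  have [measurable]: "m \<in> borel_measurable ?P" unfolding m_def[abs_def] by measurable
  \<comment> \<open>A product of two Gaussians of equal variance depends on
    \<open>|a|^2 + |b|^2\<close> only.\<close>
  have mrot: "m (rotate \<theta> p) = m p" for \<theta> p
  proof -
    have "(norm (c *\<^sub>R x - d *\<^sub>R y))\<^sup>2 + (norm (d *\<^sub>R x + c *\<^sub>R y))\<^sup>2 = (c\<^sup>2 + d\<^sup>2) * ((norm x)\<^sup>2 + (norm y)\<^sup>2)"
      for c d and x y :: "real^'n"
      unfolding power2_norm_eq_inner
      by (simp add: inner_add_left inner_add_right inner_diff_left inner_diff_right inner_commute power2_eq_square algebra_simps)
    from this[of "cos \<theta>" "fst p" "sin \<theta>" "snd p"]
    have n: "(norm (fst (rotate \<theta> p)))\<^sup>2 + (norm (snd (rotate \<theta> p)))\<^sup>2 = (norm (fst p))\<^sup>2 + (norm (snd p))\<^sup>2"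
      by (simp add: rotate_def)
    have "m q = exp (- ((norm (fst q))\<^sup>2 + (norm (snd q))\<^sup>2) / (2 * s)) / (sqrt (2 * pi * s) ^ CARD('n))\<^sup>2" for q
      unfolding m_def gauss_kernel_def power2_eq_square[of "sqrt _ ^ _"] by (simp add: exp_add[symmetric] add_divide_distrib diff_divide_distrib)
    then show ?thesis by (simp only: n)
  qed
  let ?h = "\<lambda>p. complex_of_real (m p) * f (cpx (fst p) (snd p))"
  have int': "integrable ?P ?h" using int by (simp add: m_def)
  define I where "I = (\<integral>p. ?h p \<partial>?P)"
  let ?e = "\<lambda>x::real. exp (2 * complex_of_real pi * \<i> * complex_of_real x)"
  let ?F = "\<lambda>(x::real) p. indicator {0..1} x *\<^sub>R (complex_of_real (m p) * f (?e x *s cpx (fst p) (snd p)))"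
  have e: "?e x *s cpx (fst p) (snd p) = cpx (fst (rotate (2 * pi * x) p)) (snd (rotate (2 * pi * x) p))" for x and p :: "(real^'n) \<times> (real^'n)"
    using exp_scale_cpx[of "2 * pi * x" p] by (simp add: mult_ac)
  have rot: "complex_of_real (m p) * f (?e x *s cpx (fst p) (snd p)) = ?h (rotate (2 * pi * x) p)" for x p
    unfolding e mrot ..
  have slice: "(\<integral>p. ?F x p \<partial>?P) = indicator {0..1} x *\<^sub>R I" for x
    unfolding rot I_def integral_scaleR_right by (subst integral_rotate) auto
  \<comment> \<open>Two evaluations of one integral over angle and point: each angle contributes
    \<open>I\<close> by rotation invariance, each point contributes \<open>m p * f 0\<close> by the
    mean value on its circle.\<close>
  have fub: "(\<integral>p. \<integral>x. ?F x p \<partial>lborel \<partial>?P) = (\<integral>x. \<integral>p. ?F x p \<partial>?P \<partial>lborel)"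
  proof -
    interpret pair_sigma_finite "lborel :: real measure" ?P
      by (intro pair_sigma_finite.intro sigma_finite_lborel lborel_pair.sigma_finite_measure_axioms lborel_pair.P.sigma_finite_measure_axioms)
    have meas: "case_prod ?F \<in> borel_measurable (lborel \<Otimes>\<^sub>M ?P)"
      unfolding e rotate_def by measurable
    have "integrable (lborel \<Otimes>\<^sub>M ?P) (case_prod ?F)"
    proof (rule Fubini_integrable[OF meas])
      have ir: "integrable ?P (\<lambda>p. ?h (rotate (2 * pi * x) p))" for x
      proof (rule integrableI_bounded)
        have "(\<integral>\<^sup>+p. ennreal (norm (?h (rotate (2 * pi * x) p))) \<partial>?P) = (\<integral>\<^sup>+p. ennreal (norm (?h p)) \<partial>?P)"
          by (rule nn_integral_rotate[where F="\<lambda>p. ennreal (norm (?h p))"]) measurable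
        also have "\<dots> < \<infinity>" using int' by (simp add: integrable_iff_bounded)
        finally show "(\<integral>\<^sup>+p. ennreal (norm (?h (rotate (2 * pi * x) p))) \<partial>?P) < \<infinity>" .
      qed measurable
      then show "AE x in lborel. integrable ?P (\<lambda>p. case_prod ?F (x, p))"
        unfolding prod.case rot by (intro AE_I2 integrable_scaleR_right)
      have nF: "(\<integral>p. norm (case_prod ?F (x, p)) \<partial>?P) = indicator {0..1} x * (\<integral>p. norm (?h p) \<partial>?P)" for x
      proof -
        have "complex_of_real (\<integral>p. norm (?h (rotate (2 * pi * x) p)) \<partial>?P) = complex_of_real (\<integral>p. norm (?h p) \<partial>?P)"
          unfolding integral_complex_of_real[symmetric]
          by (rule integral_rotate[where F="\<lambda>p. complex_of_real (norm (?h p))"]) measurable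
        then have "(\<integral>p. norm (?h (rotate (2 * pi * x) p)) \<partial>?P) = (\<integral>p. norm (?h p) \<partial>?P)"
          by (simp only: of_real_eq_iff)
        then show ?thesis unfolding prod.case rot norm_scaleR integral_mult_right_zero by simp
      qed
      show "integrable lborel (\<lambda>x. \<integral>p. norm (case_prod ?F (x, p)) \<partial>?P)"
        unfolding nF by (simp add: integrable_indicator_iff)
    qed
    then show ?thesis by (rule Fubini_integral)
  qed
  have "(\<integral>x. ?F x p \<partial>lborel) = complex_of_real (m p) * f 0" for p
  proof -
    have "(\<lambda>\<zeta>. f (0 + \<zeta> *s cpx (fst p) (snd p))) holomorphic_on UNIV" by (rule entire_line_holomorphic[OF f])
    from circle_mean_value[OF this]
    have c: "(\<integral>x. indicator {0..1} x *\<^sub>R f (?e x *s cpx (fst p) (snd p)) \<partial>lborel) = f 0" by simp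
    have "(\<integral>x. ?F x p \<partial>lborel) = (\<integral>x. complex_of_real (m p) * (indicator {0..1} x *\<^sub>R f (?e x *s cpx (fst p) (snd p))) \<partial>lborel)"
      by (simp only: mult_scaleR_right)
    also have "\<dots> = complex_of_real (m p) * (\<integral>x. indicator {0..1} x *\<^sub>R f (?e x *s cpx (fst p) (snd p)) \<partial>lborel)"
      by (rule integral_mult_right_zero)
    finally show ?thesis unfolding c .
  qed
  then have "(\<integral>p. \<integral>x. ?F x p \<partial>lborel \<partial>?P) = (\<integral>p. complex_of_real (m p) * f 0 \<partial>?P)" by simp
  also have "\<dots> = complex_of_real (\<integral>p. m p \<partial>?P) * f 0" by (simp add: integral_complex_of_real)
  also have "(\<integral>p. m p \<partial>?P) = 1"
  proof -
    have "integrable ?P m"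
    proof (rule lborel_pair.Fubini_integrable)
      show "integrable lborel (\<lambda>x. \<integral>y. norm (m (x, y)) \<partial>lborel)"
        using integrable_gauss_kernel[OF s, where 'n='n] by (simp add: m_def abs_mult)
      show "AE x in lborel. integrable lborel (\<lambda>y. m (x, y))"
        using integrable_gauss_kernel[OF s, where 'n='n] by (simp add: m_def)
    qed measurable
    then have "(\<integral>p. m p \<partial>?P) = (\<integral>x. \<integral>y. m (x, y) \<partial>lborel \<partial>lborel)" by (rule lborel_pair.integral_fst'[symmetric])
    then show ?thesis by (simp add: m_def integral_gauss_kernel[OF s])
  qed
  finally have "f 0 = (\<integral>x. indicator {0..1} x *\<^sub>R I \<partial>(lborel::real measure))" unfolding fub slice by simp
  also have "\<dots> = I" by simp
  finally show ?thesis by (simp add: I_def m_def)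
qed

section \<open>Convergence in the mean\<close>

lemma parallelogram_cmod:
  "(cmod (a - b))\<^sup>2 + (cmod (a + b))\<^sup>2 = 2 * (cmod a)\<^sup>2 + 2 * (cmod b)\<^sup>2"
  unfolding cmod_power2 by (simp add: power2_eq_square algebra_simps)

text \<open>Pointwise convergence without loss of norm is norm convergence: Fatou's lemma applied to
  the sums, combined with the parallelogram law.\<close>

lemma L2_tendsto_of_norm_le:
  fixes f :: "'a \<Rightarrow> complex"
  assumes [measurable]: "\<And>k. F k \<in> borel_measurable M" "f \<in> borel_measurable M"
    and lim: "\<And>x. (\<lambda>k. F k x) \<longlonglongrightarrow> f x"
    and le: "\<And>k. (\<integral>\<^sup>+x. ennreal ((cmod (F k x))\<^sup>2) \<partial>M) \<le> (\<integral>\<^sup>+x. ennreal ((cmod (f x))\<^sup>2) \<partial>M)"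
    and fin: "(\<integral>\<^sup>+x. ennreal ((cmod (f x))\<^sup>2) \<partial>M) < \<infinity>"
  shows "(\<lambda>k. \<integral>\<^sup>+x. ennreal ((cmod (F k x - f x))\<^sup>2) \<partial>M) \<longlonglongrightarrow> 0"
proof -
  define E where "E = 4 * (\<integral>\<^sup>+x. ennreal ((cmod (f x))\<^sup>2) \<partial>M)"
  have Efin: "E < \<infinity>" using fin by (simp add: E_def ennreal_mult_less_top)
  define A where "A k = (\<integral>\<^sup>+x. ennreal ((cmod (F k x - f x))\<^sup>2) \<partial>M)" for k
  define B where "B k = (\<integral>\<^sup>+x. ennreal ((cmod (F k x + f x))\<^sup>2) \<partial>M)" for k
  have AB: "A k + B k \<le> E" for k
  proof -
    have "A k + B k = (\<integral>\<^sup>+x. ennreal ((cmod (F k x - f x))\<^sup>2) + ennreal ((cmod (F k x + f x))\<^sup>2) \<partial>M)"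
      unfolding A_def B_def by (rule nn_integral_add[symmetric]) measurable
    also have "\<dots> = (\<integral>\<^sup>+x. 2 * ennreal ((cmod (F k x))\<^sup>2) + 2 * ennreal ((cmod (f x))\<^sup>2) \<partial>M)"
    proof (rule nn_integral_cong)
      fix x
      have "ennreal ((cmod (F k x - f x))\<^sup>2) + ennreal ((cmod (F k x + f x))\<^sup>2) = ennreal (2 * (cmod (F k x))\<^sup>2 + 2 * (cmod (f x))\<^sup>2)"
        by (simp add: ennreal_plus[symmetric] parallelogram_cmod del: ennreal_plus)
      also have "\<dots> = 2 * ennreal ((cmod (F k x))\<^sup>2) + 2 * ennreal ((cmod (f x))\<^sup>2)"
        by (simp add: ennreal_mult)
      finally show "ennreal ((cmod (F k x - f x))\<^sup>2) + ennreal ((cmod (F k x + f x))\<^sup>2) = 2 * ennreal ((cmod (F k x))\<^sup>2) + 2 * ennreal ((cmod (f x))\<^sup>2)" .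
    qed
    also have "\<dots> = 2 * (\<integral>\<^sup>+x. ennreal ((cmod (F k x))\<^sup>2) \<partial>M) + 2 * (\<integral>\<^sup>+x. ennreal ((cmod (f x))\<^sup>2) \<partial>M)"
      by (simp add: nn_integral_add nn_integral_cmult)
    also have "\<dots> \<le> 2 * (\<integral>\<^sup>+x. ennreal ((cmod (f x))\<^sup>2) \<partial>M) + 2 * (\<integral>\<^sup>+x. ennreal ((cmod (f x))\<^sup>2) \<partial>M)"
      by (intro add_mono mult_left_mono le) simp_all
    also have "\<dots> = E" unfolding E_def by (simp add: distrib_right[symmetric])
    finally show ?thesis .
  qed
  have EB: "E \<le> liminf B"
  proof -
    have "liminf (\<lambda>k. ennreal ((cmod (F k x + f x))\<^sup>2)) = 4 * ennreal ((cmod (f x))\<^sup>2)" for x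
    proof -
      have "(\<lambda>k. ennreal ((cmod (F k x + f x))\<^sup>2)) \<longlonglongrightarrow> ennreal ((cmod (f x + f x))\<^sup>2)"
        by (intro tendsto_ennrealI tendsto_intros lim)
      moreover have "(cmod (f x + f x))\<^sup>2 = 4 * (cmod (f x))\<^sup>2"
        by (simp add: mult_2[symmetric] norm_mult power_mult_distrib)
      ultimately show ?thesis by (simp add: lim_imp_Liminf ennreal_mult)
    qed
    then have "E = (\<integral>\<^sup>+x. liminf (\<lambda>k. ennreal ((cmod (F k x + f x))\<^sup>2)) \<partial>M)"
      unfolding E_def by (simp add: nn_integral_cmult)
    also have "\<dots> \<le> liminf B" unfolding B_def by (rule nn_integral_liminf) measurable
    finally show ?thesis .
  qed
  have "A \<longlonglongrightarrow> 0"
  proof (rule order_tendstoI)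
    fix a :: ennreal assume "0 < a"
    then obtain e where e: "0 < e" "e < a" using dense by blast
    show "\<forall>\<^sub>F k in sequentially. A k < a"
    \<comment> \<open>Subtraction in \<open>ennreal\<close> is truncated, and
      \<open>E - e < E\<close> can fail for \<open>E = 0\<close>; when \<open>E < e\<close> the
      bound \<open>AB\<close> alone suffices.\<close>
    proof (cases "E < e")
      case True
      have "A k \<le> A k + B k" for k by simp
      then have "A k < a" for k using AB[of k] True e(2) by (meson order.strict_trans1 order.strict_trans order.trans)
      then show ?thesis by simp
    next
      case False
      then have eE: "e \<le> E" by simp
      then have "e < \<infinity>" using Efin by (rule order_le_less_trans)
      then have "E - e < E" using e(1) eE Efin
        by (cases E; cases e) (auto simp: ennreal_minus ennreal_less_iff)
      then have "\<forall>\<^sub>F k in sequentially. E - e < B k"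
        by (intro less_LiminfD) (rule order.strict_trans2[OF _ EB])
      then show ?thesis
      proof eventually_elim
        case (elim k)
        show "A k < a"
        proof (rule ccontr)
          assume "\<not> A k < a"
          then have "e \<le> A k" using e by simp
          then have "e + B k \<le> E" using AB[of k] by (meson add_right_mono order_trans)
          moreover have "E = e + (E - e)" using eE by (simp add: add_diff_inverse_ennreal)
          moreover have "e < \<infinity>" using eE Efin by (rule order_le_less_trans)
          ultimately have "e + B k \<le> e + (E - e)" by simp
          then have "B k \<le> E - e" using \<open>e < \<infinity>\<close> by (auto simp: ennreal_add_left_cancel_le)
          then show False using elim by simp
        qed
      qed
    qed
  qed simp
  then show ?thesis unfolding A_def .
qed

section \<open>Completeness of L2 along rapidly Cauchy sequences\<close>

lemma convergent_if_geometric_increments: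
  fixes w :: "nat \<Rightarrow> 'a::banach"
  assumes "\<And>j. norm (w (Suc j) - w j) \<le> B * c ^ j" "0 \<le> c" "c < 1"
  shows "convergent w"
proof -
  have "summable (\<lambda>j. w (Suc j) - w j)"
    by (rule summable_comparison_test'[of "\<lambda>j. B * c ^ j" 0]) (use assms in \<open>auto intro!: summable_mult summable_geometric\<close>)
  then have "(\<lambda>n. \<Sum>j<n. w (Suc j) - w j) \<longlonglongrightarrow> (\<Sum>j. w (Suc j) - w j)" by (rule summable_LIMSEQ)
  then have "(\<lambda>n. w n - w 0) \<longlonglongrightarrow> (\<Sum>j. w (Suc j) - w j)" by (simp add: sum_lessThan_telescope)
  from tendsto_add[OF this tendsto_const[of "w 0"]] show ?thesis by (auto simp: convergent_def)
qed

text \<open>A limit defined at every point: the default 0 keeps it measurable and is compatible with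
  multiplication by a nonzero constant, so quasi-periodicity passes to the limit.\<close>

definition lim_or_zero :: "(nat \<Rightarrow> 'a \<Rightarrow> complex) \<Rightarrow> 'a \<Rightarrow> complex" where
  "lim_or_zero w x = (if convergent (\<lambda>j. w j x) then lim (\<lambda>j. w j x) else 0)"

lemma borel_measurable_lim_or_zero:
  assumes [measurable]: "\<And>j. w j \<in> borel_measurable M"
  shows "lim_or_zero w \<in> borel_measurable M"
  unfolding lim_or_zero_def[abs_def] Cauchy_convergent_iff[symmetric] by measurable

text \<open>The Riesz-Fischer argument. The weight \<open>2^j\<close> is below the decay
  \<open>4^(-j)\<close> of the squared increments, so the weighted sum has finite integral; yet
  where it is finite it forces increments of order \<open>2^(-j/2)\<close>, hence pointwise
  convergence. The distance to the limit follows from Fatou's lemma.\<close>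

lemma L2_complete_fast:
  fixes w :: "nat \<Rightarrow> 'a \<Rightarrow> complex"
  assumes w [measurable]: "\<And>j. w j \<in> borel_measurable M" and C: "C < \<infinity>"
    and cauchy: "\<And>j m. j \<le> m \<Longrightarrow> (\<integral>\<^sup>+x. ennreal ((cmod (w m x - w j x))\<^sup>2) \<partial>M) \<le> C * ennreal ((1 / 4) ^ j)"
  shows "(\<integral>\<^sup>+x. ennreal ((cmod (lim_or_zero w x - w j x))\<^sup>2) \<partial>M) \<le> C * ennreal ((1 / 4) ^ j)"
proof -
  have "(\<integral>\<^sup>+x. (\<Sum>j. ennreal (2 ^ j * (cmod (w (Suc j) x - w j x))\<^sup>2)) \<partial>M) = (\<Sum>j. \<integral>\<^sup>+x. ennreal (2 ^ j * (cmod (w (Suc j) x - w j x))\<^sup>2) \<partial>M)"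
    by (rule nn_integral_suminf) measurable
  also have "\<dots> \<le> (\<Sum>j. C * ennreal ((1 / 2) ^ j))"
  proof (rule suminf_le)
    fix j
    have "(\<integral>\<^sup>+x. ennreal (2 ^ j * (cmod (w (Suc j) x - w j x))\<^sup>2) \<partial>M) = ennreal (2 ^ j) * (\<integral>\<^sup>+x. ennreal ((cmod (w (Suc j) x - w j x))\<^sup>2) \<partial>M)"
      by (subst nn_integral_cmult[symmetric]) (auto simp: ennreal_mult)
    also have "\<dots> \<le> ennreal (2 ^ j) * (C * ennreal ((1 / 4) ^ j))"
      by (intro mult_left_mono cauchy) simp_all
    also have "\<dots> = C * ennreal (2 ^ j * (1 / 4) ^ j)"
      by (subst ennreal_mult) (simp_all add: mult_ac)
    also have "(2::real) ^ j * (1 / 4) ^ j = (1 / 2) ^ j" by (simp add: power_mult_distrib[symmetric])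
    finally show "(\<integral>\<^sup>+x. ennreal (2 ^ j * (cmod (w (Suc j) x - w j x))\<^sup>2) \<partial>M) \<le> C * ennreal ((1 / 2) ^ j)" .
  qed auto
  also have "\<dots> = C * ennreal (\<Sum>j. (1 / 2) ^ j)"
    by (simp add: suminf_ennreal2 summable_geometric del: suminf_geometric ennreal_power)
  also have "\<dots> < \<infinity>" using C by (simp add: ennreal_mult_less_top)
  finally have "AE x in M. (\<Sum>j. ennreal (2 ^ j * (cmod (w (Suc j) x - w j x))\<^sup>2)) \<noteq> \<infinity>"
    by (intro nn_integral_noteq_infinite) auto
  then have ae: "AE x in M. (\<lambda>m. w m x) \<longlonglongrightarrow> lim_or_zero w x"
  proof eventually_elim
    case (elim x)
    define T where "T j = ennreal (2 ^ j * (cmod (w (Suc j) x - w j x))\<^sup>2)" for j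
    define S where "S = (\<Sum>j. T j)"
    have "S \<noteq> \<infinity>" using elim unfolding S_def T_def .
    then obtain B where B: "S = ennreal B" "0 \<le> B" by (cases S) auto
    have "cmod (w (Suc j) x - w j x) \<le> sqrt B * (1 / sqrt 2) ^ j" for j
    proof -
      have "sum T {j} \<le> S" unfolding S_def by (rule sum_le_suminf) (simp_all add: summableI)
      then have "ennreal (2 ^ j * (cmod (w (Suc j) x - w j x))\<^sup>2) \<le> ennreal B" by (simp add: T_def B(1))
      then have "2 ^ j * (cmod (w (Suc j) x - w j x))\<^sup>2 \<le> B" using B(2) by simp
      then have "(cmod (w (Suc j) x - w j x))\<^sup>2 \<le> B * (1 / 2) ^ j" by (simp add: field_simps power_divide)
      then have "cmod (w (Suc j) x - w j x) \<le> sqrt (B * (1 / 2) ^ j)" by (rule real_le_rsqrt)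
      then show ?thesis by (simp add: real_sqrt_mult real_sqrt_power real_sqrt_divide power_divide)
    qed
    then have "convergent (\<lambda>j. w j x)" by (rule convergent_if_geometric_increments) simp_all
    then show ?case by (simp add: lim_or_zero_def convergent_LIMSEQ_iff)
  qed
  have [measurable]: "lim_or_zero w \<in> borel_measurable M" by (rule borel_measurable_lim_or_zero) (rule w)
  have "(\<integral>\<^sup>+x. ennreal ((cmod (lim_or_zero w x - w j x))\<^sup>2) \<partial>M) = (\<integral>\<^sup>+x. liminf (\<lambda>m. ennreal ((cmod (w m x - w j x))\<^sup>2)) \<partial>M)"
  proof (rule nn_integral_cong_AE)
    show "AE x in M. ennreal ((cmod (lim_or_zero w x - w j x))\<^sup>2) = liminf (\<lambda>m. ennreal ((cmod (w m x - w j x))\<^sup>2))"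
      using ae
    proof eventually_elim
      case (elim x)
      have "(\<lambda>m. ennreal ((cmod (w m x - w j x))\<^sup>2)) \<longlonglongrightarrow> ennreal ((cmod (lim_or_zero w x - w j x))\<^sup>2)"
        by (intro tendsto_ennrealI tendsto_intros elim)
      from lim_imp_Liminf[OF sequentially_bot this] show ?case by simp
    qed
  qed
  also have "\<dots> \<le> liminf (\<lambda>m. \<integral>\<^sup>+x. ennreal ((cmod (w m x - w j x))\<^sup>2) \<partial>M)"
    by (rule nn_integral_liminf) measurable
  also have "\<dots> \<le> limsup (\<lambda>m. \<integral>\<^sup>+x. ennreal ((cmod (w m x - w j x))\<^sup>2) \<partial>M)"
    by (rule Liminf_le_Limsup) simp
  also have "\<dots> \<le> C * ennreal ((1 / 4) ^ j)"
    by (rule Limsup_bounded) (auto intro!: eventually_sequentiallyI[of j] cauchy)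
  finally show ?thesis .
qed

section \<open>Averages over imaginary fibres and energy estimates\<close>

lemma entire_translate:
  assumes "entire F" shows "entire (\<lambda>z. F (w + z))"
proof -
  have "\<exists>H. ((\<lambda>z. F (w + z)) has_derivative H) (at z) \<and> Vector_Spaces.linear (*s) (*) H" for z
  proof -
    obtain F' where F: "(F has_derivative F') (at (w + z))" "Vector_Spaces.linear (*s) (*) F'"
      using assms unfolding entire_def by blast
    have "((\<lambda>z. w + z) has_derivative (\<lambda>h. h)) (at z)" by (auto intro!: derivative_eq_intros)
    from has_derivative_compose[OF this F(1)] F(2) show ?thesis by blast
  qed
  then show ?thesis by (simp add: entire_def)
qed

text \<open>For holomorphic \<open>p\<close> the second derivatives in imaginary directions are the
  negatives of those in real directions, so averaging over \<open>b\<close> with a heat kernel runs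
  the heat flow backwards in \<open>x\<close>.\<close>

definition inverse_heat :: "real \<Rightarrow> (complex^'n \<Rightarrow> complex) \<Rightarrow> real^'n \<Rightarrow> complex" where
  "inverse_heat s p x = (\<integral>b. complex_of_real (gauss_kernel s b) * p (cpx x b) \<partial>lborel)"

text \<open>The exponents add up to \<open>- |b|^2 (1/s - 1/t)\<close>, negative because
  \<open>s < t\<close>; \<open>r\<close> is defined by \<open>1 / (2 r) = 1/s - 1/t\<close>.\<close>

lemma gauss_kernel_weight_finite:
  assumes "0 < s" "s < t"
  shows "(\<integral>\<^sup>+b. ennreal ((gauss_kernel s b)\<^sup>2 * exp ((norm b)\<^sup>2 / t)) \<partial>(lborel::(real^'n) measure)) < \<infinity>"
proof -
  define r where "r = s * t / (2 * (t - s))"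
  have r: "r > 0" using assms by (simp add: r_def)
  define c where "c = 1 / (sqrt (2 * pi * s) ^ CARD('n))\<^sup>2"
  have "(gauss_kernel s b)\<^sup>2 * exp ((norm b)\<^sup>2 / t) = c * exp (- (norm b)\<^sup>2 / (2 * r))" for b :: "real^'n"
  proof -
    have "2 * (- (norm b)\<^sup>2 / (2 * s)) + (norm b)\<^sup>2 / t = - (norm b)\<^sup>2 / (2 * r)"
      using assms by (simp add: r_def field_simps)
    then have "exp (- (norm b)\<^sup>2 / (2 * s))^2 * exp ((norm b)\<^sup>2 / t) = exp (- (norm b)\<^sup>2 / (2 * r))"
      by (simp only: exp_double[symmetric] exp_add[symmetric])
    then show ?thesis by (simp add: gauss_kernel_def c_def power_divide)
  qed
  then have "integrable lborel (\<lambda>b::real^'n. (gauss_kernel s b)\<^sup>2 * exp ((norm b)\<^sup>2 / t))"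
    using integrable_gauss[OF r, where 'a="real^'n"] by simp
  then show ?thesis by (simp add: integrable_iff_bounded)
qed

lemma weighted_Cauchy_Schwarz:
  fixes f g w :: "'a \<Rightarrow> real"
  assumes [measurable]: "f \<in> borel_measurable M" "g \<in> borel_measurable M" "w \<in> borel_measurable M"
    and nn: "\<And>x. 0 \<le> f x" "\<And>x. 0 \<le> g x"
  shows "(\<integral>\<^sup>+x. ennreal (f x * g x) \<partial>M)\<^sup>2
    \<le> (\<integral>\<^sup>+x. ennreal ((f x)\<^sup>2 * exp (w x)) \<partial>M) * (\<integral>\<^sup>+x. ennreal ((g x)\<^sup>2 * exp (- w x)) \<partial>M)"
proof -
  have e: "exp (w x / 2) * exp (- w x / 2) = 1" for x
    by (simp add: exp_add[symmetric])
  have split: "ennreal (f x * g x) = ennreal (f x * exp (w x / 2)) * ennreal (g x * exp (- w x / 2))" for x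
  proof -
    have "f x * g x = (f x * g x) * (exp (w x / 2) * exp (- w x / 2))" unfolding e by simp
    also have "\<dots> = (f x * exp (w x / 2)) * (g x * exp (- w x / 2))" by (simp only: mult_ac)
    finally show ?thesis
      using nn by (simp only: ennreal_mult[symmetric] mult_nonneg_nonneg exp_ge_zero)
  qed
  have sq: "(ennreal (c * exp (v / 2)))\<^sup>2 = ennreal (c\<^sup>2 * exp v)" if "0 \<le> c" for c v :: real
    using that by (subst ennreal_power) (simp_all add: power_mult_distrib exp_double[symmetric])
  have "(\<integral>\<^sup>+x. ennreal (f x * g x) \<partial>M)\<^sup>2
    \<le> (\<integral>\<^sup>+x. (ennreal (f x * exp (w x / 2)))\<^sup>2 \<partial>M) * (\<integral>\<^sup>+x. (ennreal (g x * exp (- w x / 2)))\<^sup>2 \<partial>M)"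
    unfolding split by (rule Cauchy_Schwarz_nn_integral) measurable
  then show ?thesis unfolding sq[OF nn(1)] sq[OF nn(2)] .
qed

lemma inverse_heat_fiber_bound:
  assumes [measurable]: "f \<in> borel_measurable borel" and s: "0 < s"
  shows "(\<integral>\<^sup>+b. ennreal (gauss_kernel s b * cmod (f b)) \<partial>(lborel::(real^'n) measure))\<^sup>2
    \<le> (\<integral>\<^sup>+b. ennreal ((gauss_kernel s b)\<^sup>2 * exp ((norm b)\<^sup>2 / t)) \<partial>(lborel::(real^'n) measure))
      * (\<integral>\<^sup>+b. ennreal ((cmod (f b))\<^sup>2 * exp (- (norm b)\<^sup>2 / t)) \<partial>lborel)"
  using weighted_Cauchy_Schwarz[of "gauss_kernel s" lborel "\<lambda>b. cmod (f b)" "\<lambda>b. (norm b)\<^sup>2 / t"]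
  by (simp add: gauss_kernel_nonneg[OF s])

text \<open>Energies become plain squared norms for a weighted measure, so that the general
  convergence results for L2 apply to them.\<close>

lemma fock_energy_density:
  assumes [measurable]: "p \<in> borel_measurable borel" "D \<in> sets borel"
  shows "fock_energy D t p = (\<integral>\<^sup>+q. ennreal ((cmod (p (cpx (fst q) (snd q))))\<^sup>2)
     \<partial>density (lborel \<Otimes>\<^sub>M lborel) (\<lambda>q. indicator D (fst q) * ennreal (exp (- (norm (snd q))\<^sup>2 / t))))"
proof -
  have "(\<integral>\<^sup>+q. ennreal ((cmod (p (cpx (fst q) (snd q))))\<^sup>2)
     \<partial>density (lborel \<Otimes>\<^sub>M lborel) (\<lambda>q. indicator D (fst q) * ennreal (exp (- (norm (snd q))\<^sup>2 / t))))
    = (\<integral>\<^sup>+q. indicator D (fst q) * ennreal (exp (- (norm (snd q))\<^sup>2 / t)) * ennreal ((cmod (p (cpx (fst q) (snd q))))\<^sup>2) \<partial>(lborel \<Otimes>\<^sub>M lborel))"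
    by (rule nn_integral_density) measurable
  also have "\<dots> = (\<integral>\<^sup>+a. \<integral>\<^sup>+b. indicator D a * ennreal (exp (- (norm b)\<^sup>2 / t)) * ennreal ((cmod (p (cpx a b)))\<^sup>2) \<partial>lborel \<partial>lborel)"
    by (subst lborel.nn_integral_fst[symmetric]) simp_all
  also have "\<dots> = fock_energy D t p"
    unfolding fock_energy_def
  proof (rule nn_integral_cong)
    fix a
    have "(\<integral>\<^sup>+b. indicator D a * ennreal (exp (- (norm b)\<^sup>2 / t)) * ennreal ((cmod (p (cpx a b)))\<^sup>2) \<partial>lborel)
      = (\<integral>\<^sup>+b. indicator D a * ennreal ((cmod (p (cpx a b)))\<^sup>2 * exp (- (norm b)\<^sup>2 / t)) \<partial>lborel)"
      by (intro nn_integral_cong) (simp add: ennreal_mult mult_ac)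
    also have "\<dots> = indicator D a * (\<integral>\<^sup>+b. ennreal ((cmod (p (cpx a b)))\<^sup>2 * exp (- (norm b)\<^sup>2 / t)) \<partial>lborel)"
      by (rule nn_integral_cmult) measurable
    finally show "(\<integral>\<^sup>+b. indicator D a * ennreal (exp (- (norm b)\<^sup>2 / t)) * ennreal ((cmod (p (cpx a b)))\<^sup>2) \<partial>lborel)
      = indicator D a * (\<integral>\<^sup>+b. ennreal ((cmod (p (cpx a b)))\<^sup>2 * exp (- (norm b)\<^sup>2 / t)) \<partial>lborel)" .
  qed
  finally show ?thesis ..
qed

lemma dom_energy_density:
  assumes [measurable]: "u \<in> borel_measurable borel" "D \<in> sets borel"
  shows "dom_energy D u = (\<integral>\<^sup>+x. ennreal ((cmod (u x))\<^sup>2) \<partial>density lborel (indicator D))"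
  unfolding dom_energy_def by (subst nn_integral_density) simp_all

lemma nn_integral_cmod_diff_sq_le:
  assumes [measurable]: "f \<in> borel_measurable M" "g \<in> borel_measurable M"
  shows "(\<integral>\<^sup>+x. ennreal ((cmod (f x - g x))\<^sup>2) \<partial>M) \<le> 2 * (\<integral>\<^sup>+x. ennreal ((cmod (f x))\<^sup>2) \<partial>M) + 2 * (\<integral>\<^sup>+x. ennreal ((cmod (g x))\<^sup>2) \<partial>M)"
proof -
  have "(\<integral>\<^sup>+x. ennreal ((cmod (f x - g x))\<^sup>2) \<partial>M) \<le> (\<integral>\<^sup>+x. 2 * ennreal ((cmod (f x))\<^sup>2) + 2 * ennreal ((cmod (g x))\<^sup>2) \<partial>M)"
  proof (rule nn_integral_mono)
    fix x
    have "ennreal ((cmod (f x - g x))\<^sup>2) \<le> ennreal (2 * (cmod (f x))\<^sup>2 + 2 * (cmod (g x))\<^sup>2)"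
      by (rule ennreal_leI) (rule norm_diff_sq_le)
    then show "ennreal ((cmod (f x - g x))\<^sup>2) \<le> 2 * ennreal ((cmod (f x))\<^sup>2) + 2 * ennreal ((cmod (g x))\<^sup>2)"
      by (simp add: ennreal_mult)
  qed
  also have "\<dots> = 2 * (\<integral>\<^sup>+x. ennreal ((cmod (f x))\<^sup>2) \<partial>M) + 2 * (\<integral>\<^sup>+x. ennreal ((cmod (g x))\<^sup>2) \<partial>M)"
    by (simp add: nn_integral_add nn_integral_cmult)
  finally show ?thesis .
qed

lemma dom_energy_diff_le:
  assumes "u \<in> borel_measurable borel" "v \<in> borel_measurable borel" and [measurable]: "D \<in> sets borel"
  shows "dom_energy D (\<lambda>x. u x - v x) \<le> 2 * dom_energy D u + 2 * dom_energy D v"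
proof -
  note [measurable] = assms(1,2)
  show ?thesis
    using nn_integral_cmod_diff_sq_le[of u "density lborel (indicator D)" v] by (simp add: dom_energy_density)
qed

section \<open>Linearity and continuity of the heat transform\<close>

lemma heat_diff:
  assumes "tame u" "tame v" "t > 0"
  shows "heat t (\<lambda>x. u x - v x) z = heat t u z - heat t v z"
  unfolding heat_def right_diff_distrib
  by (rule Bochner_Integration.integral_diff) (intro integrable_heat assms)+

text \<open>Kernels at times between \<open>s\<close> and \<open>s + T\<close> are dominated by a
  multiple of the kernel at the latest time: the Gaussian is flattest there, whereas the normalising
  factor and the growth in \<open>b\<close> are largest at time \<open>s\<close>. The constant
  \<open>c\<close> accounts for the last two.\<close>

lemma heat_continuous_time:
  assumes u: "tame u" and s: "s > 0" and \<tau>: "\<And>k. 0 \<le> \<tau> k" "\<tau> \<longlonglongrightarrow> 0"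
  shows "(\<lambda>k. heat (s + \<tau> k) u z) \<longlonglongrightarrow> heat s u z"
proof -
  note [measurable] = tame_borel_measurable[OF u]
  obtain a b where z: "z = cpx a b" using cpx_re_im[of z] by metis
  have "Bseq \<tau>" using \<tau>(2) by (rule convergent_imp_Bseq[OF convergentI])
  then obtain T where T: "0 < T" "\<And>k. \<tau> k \<le> T" unfolding Bseq_def by (metis abs_le_D1 real_norm_def)
  define c where "c = sqrt (2 * pi * (s + T)) ^ CARD('a) / sqrt (2 * pi * s) ^ CARD('a) * exp ((norm b)\<^sup>2 / (2 * s))"
  have dom: "cmod (heat_kernel (s + \<tau> k) (z - cvec x)) \<le> c * cmod (heat_kernel (s + T) (cvec a - cvec x))" for k x
  proof -
    let ?r = "s + \<tau> k"
    have r: "s \<le> ?r" "?r \<le> s + T" "0 < ?r" using \<tau>(1)[of k] T s by auto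
    have "cmod (heat_kernel ?r (z - cvec x)) = exp (- (norm (a - x))\<^sup>2 / (2 * ?r)) / sqrt (2 * pi * ?r) ^ CARD('a) * exp ((norm b)\<^sup>2 / (2 * ?r))"
      unfolding z cpx_diff_cvec cmod_heat_kernel_cpx[OF r(3)] gauss_kernel_def ..
    also have "\<dots> \<le> exp (- (norm (a - x))\<^sup>2 / (2 * (s + T))) / sqrt (2 * pi * s) ^ CARD('a) * exp ((norm b)\<^sup>2 / (2 * s))"
    proof (intro mult_mono frac_le)
      have "(norm (a - x))\<^sup>2 / (2 * (s + T)) \<le> (norm (a - x))\<^sup>2 / (2 * ?r)"
        using r s by (intro divide_left_mono) auto
      then show "exp (- (norm (a - x))\<^sup>2 / (2 * ?r)) \<le> exp (- (norm (a - x))\<^sup>2 / (2 * (s + T)))" by simp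
      have "(norm b)\<^sup>2 / (2 * ?r) \<le> (norm b)\<^sup>2 / (2 * s)"
        using r s by (intro divide_left_mono) auto
      then show "exp ((norm b)\<^sup>2 / (2 * ?r)) \<le> exp ((norm b)\<^sup>2 / (2 * s))" by simp
      show "sqrt (2 * pi * s) ^ CARD('a) \<le> sqrt (2 * pi * ?r) ^ CARD('a)"
        using r s by (intro power_mono) auto
    qed (use s in auto)
    also have "\<dots> = c * cmod (heat_kernel (s + T) (cvec a - cvec x))"
    proof -
      have "cmod (heat_kernel (s + T) (cvec a - cvec x)) = gauss_kernel (s + T) (a - x)"
        unfolding cvec_diff[symmetric] heat_kernel_cvec using gauss_kernel_nonneg[of "s + T" "a - x"] s T by simp
      then show ?thesis using s T by (simp add: c_def gauss_kernel_def)
    qed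
    finally show ?thesis .
  qed
  have lim: "(\<lambda>k. heat_kernel (s + \<tau> k) w) \<longlonglongrightarrow> heat_kernel s w" for w :: "complex^'a"
  proof -
    have "(\<lambda>k. s + \<tau> k) \<longlonglongrightarrow> s + 0" by (intro tendsto_intros \<tau>)
    then have L: "(\<lambda>k. s + \<tau> k) \<longlonglongrightarrow> s" by simp
    show ?thesis unfolding heat_kernel_def
      by (intro tendsto_intros L) (use s in auto)
  qed
  show ?thesis
    unfolding heat_def
  proof (rule integral_dominated_convergence[where w="\<lambda>x. c * cmod (heat_kernel (s + T) (cvec a - cvec x) * u x)"])
    show "integrable lborel (\<lambda>x. c * cmod (heat_kernel (s + T) (cvec a - cvec x) * u x))"
      using s T by (intro integrable_mult_right integrable_norm integrable_heat u) simp
    show "AE x in lborel. (\<lambda>k. heat_kernel (s + \<tau> k) (z - cvec x) * u x) \<longlonglongrightarrow> heat_kernel s (z - cvec x) * u x"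
      by (intro AE_I2 tendsto_intros lim)
    show "AE x in lborel. norm (heat_kernel (s + \<tau> k) (z - cvec x) * u x) \<le> c * cmod (heat_kernel (s + T) (cvec a - cvec x) * u x)" for k
      using mult_right_mono[OF dom norm_ge_zero] by (intro AE_I2) (simp add: norm_mult mult.assoc)
  qed measurable
qed

context character_domain begin

text \<open>Point evaluations are bounded by the energy, as in a reproducing kernel space:
  Cauchy-Schwarz against a Gaussian weight, then \<open>weighted_bound\<close>. This turns
  convergence in energy into pointwise convergence of heat transforms.\<close>

lemma heat_point_bound:
  assumes t: "t > 0"
  shows "\<exists>C<\<infinity>. \<forall>u. quasi_periodic u \<longrightarrow> dom_energy D u < \<infinity> \<longrightarrow> ennreal ((cmod (heat t u z))\<^sup>2) \<le> C * dom_energy D u"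
proof -
  obtain a b where z: "z = cpx a b" using cpx_re_im[of z] by metis
  \<comment> \<open>After recentring at 0 the squared kernel decays at rate
    \<open>1 / (2 t)\<close>; half of that goes to the weight, half is kept for
    integrability.\<close>
  define \<mu> where "\<mu> = 1 / (4 * t)"
  have \<mu>: "\<mu> > 0" using t by (simp add: \<mu>_def)
  obtain C where C: "C < \<infinity>" "\<And>u. quasi_periodic u \<Longrightarrow> (\<integral>\<^sup>+x. ennreal (exp (- \<mu> * (norm x)\<^sup>2) * (cmod (u x))\<^sup>2) \<partial>lborel) \<le> C * dom_energy D u"
    using weighted_bound[OF \<mu>] by blast
  define K where "K = (\<integral>\<^sup>+x. ennreal ((cmod (heat_kernel t (z - cvec x)))\<^sup>2 * exp (\<mu> * (norm x)\<^sup>2)) \<partial>lborel)"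
  have "K < \<infinity>"
  proof -
    define c where "c = exp ((norm a)\<^sup>2 / t) * (exp ((norm b)\<^sup>2 / (2 * t)) / sqrt (2 * pi * t) ^ CARD('n))\<^sup>2"
    have "(cmod (heat_kernel t (z - cvec x)))\<^sup>2 * exp (\<mu> * (norm x)\<^sup>2) \<le> c * exp (- (norm x)\<^sup>2 / (2 * (2 * t)))" for x
    proof -
      have "- (norm (a - x))\<^sup>2 \<le> (norm a)\<^sup>2 - (norm x)\<^sup>2 / 2"
        using norm_diff_sq_le[of a "a - x"] by simp
      then have "- (norm (a - x))\<^sup>2 / t + \<mu> * (norm x)\<^sup>2 \<le> ((norm a)\<^sup>2 - (norm x)\<^sup>2 / 2) / t + \<mu> * (norm x)\<^sup>2"
        using t by (intro add_right_mono divide_right_mono) simp_all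
      also have "\<dots> = (norm a)\<^sup>2 / t + - (norm x)\<^sup>2 / (2 * (2 * t))"
        using t by (simp add: \<mu>_def field_simps)
      finally have e: "exp (- (norm (a - x))\<^sup>2 / t) * exp (\<mu> * (norm x)\<^sup>2) \<le> exp ((norm a)\<^sup>2 / t) * exp (- (norm x)\<^sup>2 / (2 * (2 * t)))"
        by (simp only: exp_add[symmetric] exp_le_cancel_iff)
      have "(cmod (heat_kernel t (z - cvec x)))\<^sup>2 = exp (- (norm (a - x))\<^sup>2 / t) * (exp ((norm b)\<^sup>2 / (2 * t)) / sqrt (2 * pi * t) ^ CARD('n))\<^sup>2"
        unfolding z cpx_diff_cvec cmod_heat_kernel_cpx[OF t] gauss_kernel_def
        by (simp add: power_mult_distrib power_divide exp_double[symmetric])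
      then have "(cmod (heat_kernel t (z - cvec x)))\<^sup>2 * exp (\<mu> * (norm x)\<^sup>2) = (exp ((norm b)\<^sup>2 / (2 * t)) / sqrt (2 * pi * t) ^ CARD('n))\<^sup>2 * (exp (- (norm (a - x))\<^sup>2 / t) * exp (\<mu> * (norm x)\<^sup>2))"
        by (simp only: mult_ac)
      also have "\<dots> \<le> (exp ((norm b)\<^sup>2 / (2 * t)) / sqrt (2 * pi * t) ^ CARD('n))\<^sup>2 * (exp ((norm a)\<^sup>2 / t) * exp (- (norm x)\<^sup>2 / (2 * (2 * t))))"
        by (rule mult_left_mono[OF e]) simp
      also have "\<dots> = c * exp (- (norm x)\<^sup>2 / (2 * (2 * t)))" unfolding c_def by (simp only: mult_ac)
      finally show ?thesis .
    qed
    then have "K \<le> (\<integral>\<^sup>+x. ennreal c * ennreal (exp (- (norm x)\<^sup>2 / (2 * (2 * t)))) \<partial>(lborel::(real^'n) measure))"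
      unfolding K_def by (intro nn_integral_mono) (simp add: ennreal_mult[symmetric] c_def)
    also have "\<dots> = ennreal c * ennreal (sqrt (2 * pi * (2 * t)) ^ DIM(real^'n))"
      using t by (subst nn_integral_cmult) (simp_all only: nn_integral_gauss, simp_all)
    also have "\<dots> < \<infinity>" by (simp add: ennreal_mult_less_top)
    finally show ?thesis .
  qed
  have "ennreal ((cmod (heat t u z))\<^sup>2) \<le> (K * C) * dom_energy D u" if u: "quasi_periodic u" "dom_energy D u < \<infinity>" for u
  proof -
    have [measurable]: "u \<in> borel_measurable borel" using u by (simp add: quasi_periodic_def)
    have "ennreal (cmod (heat t u z)) \<le> (\<integral>\<^sup>+x. ennreal (norm (heat_kernel t (z - cvec x) * u x)) \<partial>lborel)"
      unfolding heat_def by (rule integral_norm_bound_ennreal[OF integrable_heat[OF quasi_periodic_tame[OF u] t]])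
    then have "(ennreal (cmod (heat t u z)))\<^sup>2 \<le> (\<integral>\<^sup>+x. ennreal (cmod (heat_kernel t (z - cvec x)) * cmod (u x)) \<partial>lborel)\<^sup>2"
      unfolding norm_mult by (rule power_mono) simp
    also have "\<dots> \<le> (\<integral>\<^sup>+x. ennreal ((cmod (heat_kernel t (z - cvec x)))\<^sup>2 * exp (\<mu> * (norm x)\<^sup>2)) \<partial>lborel) * (\<integral>\<^sup>+x. ennreal (exp (- \<mu> * (norm x)\<^sup>2) * (cmod (u x))\<^sup>2) \<partial>lborel)"
      using weighted_Cauchy_Schwarz[of "\<lambda>x. cmod (heat_kernel t (z - cvec x))" lborel "\<lambda>x. cmod (u x)" "\<lambda>x. \<mu> * (norm x)\<^sup>2"]
      by (simp add: mult.commute)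
    also have "(\<integral>\<^sup>+x. ennreal ((cmod (heat_kernel t (z - cvec x)))\<^sup>2 * exp (\<mu> * (norm x)\<^sup>2)) \<partial>lborel) * (\<integral>\<^sup>+x. ennreal (exp (- \<mu> * (norm x)\<^sup>2) * (cmod (u x))\<^sup>2) \<partial>lborel)
      \<le> K * (C * dom_energy D u)"
      unfolding K_def by (rule mult_left_mono[OF C(2)[OF u(1)]]) simp
    finally show ?thesis by (simp add: ennreal_power mult.assoc)
  qed
  moreover have "K * C < \<infinity>" using \<open>K < \<infinity>\<close> C(1) by (simp add: ennreal_mult_less_top)
  ultimately show ?thesis by blast
qed

end

section \<open>Surjectivity of the heat transform\<close>

context character_domain begin

context
  fixes p :: "complex^'n \<Rightarrow> complex" and t :: real
  assumes p: "entire p" and per: "\<And>z g. g \<in> G \<Longrightarrow> p (z + cvec g) = ch g * p z"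
    and t: "t > 0" and fin: "fock_energy D t p < \<infinity>"
begin

lemma p_borel [measurable]: "p \<in> borel_measurable borel"
  using p by (rule entire_imp_borel_measurable)

definition fiber_energy :: "real^'n \<Rightarrow> ennreal" where
  "fiber_energy a = (\<integral>\<^sup>+b. ennreal ((cmod (p (cpx a b)))\<^sup>2 * exp (- (norm b)\<^sup>2 / t)) \<partial>lborel)"

lemma fiber_energy_borel [measurable]: "fiber_energy \<in> borel_measurable borel"
  unfolding fiber_energy_def by measurable

lemma fiber_energy_periodic: "g \<in> G \<Longrightarrow> fiber_energy (a + g) = fiber_energy a"
  unfolding fiber_energy_def cpx_add_cvec[symmetric] by (simp add: per norm_mult cmod_ch)

lemma fock_energy_fiber: "fock_energy D t p = (\<integral>\<^sup>+a. indicator D a * fiber_energy a \<partial>lborel)"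
  unfolding fock_energy_def fiber_energy_def ..

text \<open>The fibre energy is periodic with finite integral over \<open>D\<close>, so every
  Gaussian controls it; the shift by \<open>x\<close> is harmless because integrals over the domain
  are translation invariant.\<close>

lemma gauss_fiber_energy_finite:
  assumes s: "0 < s"
  shows "(\<integral>\<^sup>+a. ennreal (gauss_kernel s a) * fiber_energy (x + a) \<partial>lborel) < \<infinity>"
proof (rule gauss_weighted_bound[of "1 / (2 * s)"])
  fix C :: ennreal
  assume C: "C < \<infinity>" "\<And>h :: real^'n \<Rightarrow> ennreal. h \<in> borel_measurable borel \<Longrightarrow> (\<And>g. g \<in> G \<Longrightarrow> AE x in lborel. h (x + g) = h x) \<Longrightarrow>
      (\<integral>\<^sup>+x. ennreal (exp (- (1 / (2 * s)) * (norm x)\<^sup>2)) * h x \<partial>lborel) \<le> C * (\<integral>\<^sup>+x. indicator D x * h x \<partial>lborel)"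
  define c where "c = 1 / sqrt (2 * pi * s) ^ CARD('n)"
  have "(\<integral>\<^sup>+a. ennreal (gauss_kernel s a) * fiber_energy (x + a) \<partial>lborel) = (\<integral>\<^sup>+a. ennreal c * (ennreal (exp (- (1 / (2 * s)) * (norm a)\<^sup>2)) * fiber_energy (a + x)) \<partial>lborel)"
    unfolding gauss_kernel_def c_def using s
    by (intro nn_integral_cong) (simp add: ennreal_mult[symmetric] mult.assoc[symmetric] add.commute)
  also have "\<dots> = ennreal c * (\<integral>\<^sup>+a. ennreal (exp (- (1 / (2 * s)) * (norm a)\<^sup>2)) * fiber_energy (a + x) \<partial>lborel)"
    by (rule nn_integral_cmult) measurable
  also have "(\<integral>\<^sup>+a. ennreal (exp (- (1 / (2 * s)) * (norm a)\<^sup>2)) * fiber_energy (a + x) \<partial>lborel) \<le> C * (\<integral>\<^sup>+a. indicator D a * fiber_energy (a + x) \<partial>lborel)"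
  proof (rule C(2))
    show "(\<lambda>a. fiber_energy (a + x)) \<in> borel_measurable borel" by measurable
    show "AE a in lborel. fiber_energy (a + g + x) = fiber_energy (a + x)" if "g \<in> G" for g
      using fiber_energy_periodic[OF that] by (intro AE_I2) (metis add.assoc add.commute)
  qed
  also have "(\<integral>\<^sup>+a. indicator D a * fiber_energy (a + x) \<partial>lborel) = fock_energy D t p"
    unfolding fock_energy_fiber by (rule nn_integral_domain_translate) (simp_all add: fiber_energy_periodic)
  finally have "(\<integral>\<^sup>+a. ennreal (gauss_kernel s a) * fiber_energy (x + a) \<partial>lborel) \<le> ennreal c * (C * fock_energy D t p)"
    by (simp add: mult_left_mono)
  also have "\<dots> < \<infinity>" using C(1) fin by (simp add: ennreal_mult_less_top)
  finally show ?thesis .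
qed (use s in simp)

text \<open>\<open>K\<close> is uniform in \<open>x\<close>: integrating over \<open>D\<close> gives
  finite energy of the inverse, integrating against a Gaussian gives absolute convergence of the
  double integral.\<close>

lemma inverse_heat_sq_le:
  assumes s: "0 < s" "s < t"
  shows "\<exists>K<\<infinity>. \<forall>x. (\<integral>\<^sup>+b. ennreal (gauss_kernel s b * cmod (p (cpx x b))) \<partial>lborel)\<^sup>2 \<le> K * fiber_energy x"
  unfolding fiber_energy_def
  by (intro exI conjI allI, rule gauss_kernel_weight_finite[OF s], rule inverse_heat_fiber_bound) (measurable, rule s)

lemma inverse_heat_translate: "g \<in> G \<Longrightarrow> inverse_heat s p (x + g) = ch g * inverse_heat s p x"
proof -
  assume g: "g \<in> G"
  have "inverse_heat s p (x + g) = (\<integral>b. ch g * (complex_of_real (gauss_kernel s b) * p (cpx x b)) \<partial>lborel)"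
    unfolding inverse_heat_def cpx_add_cvec[symmetric] per[OF g] by (simp only: mult_ac)
  also have "\<dots> = ch g * inverse_heat s p x" unfolding inverse_heat_def by (rule integral_mult_right_zero)
  finally show ?thesis .
qed

lemma quasi_periodic_inverse_heat: "quasi_periodic (inverse_heat s p)"
proof -
  have "inverse_heat s p \<in> borel_measurable borel" unfolding inverse_heat_def[abs_def] by measurable
  then show ?thesis by (simp add: quasi_periodic_def inverse_heat_translate)
qed

lemma dom_energy_inverse_heat:
  assumes s: "0 < s" "s < t"
  shows "dom_energy D (inverse_heat s p) < \<infinity>"
proof -
  obtain K where K: "K < \<infinity>" "\<And>x. (\<integral>\<^sup>+b. ennreal (gauss_kernel s b * cmod (p (cpx x b))) \<partial>lborel)\<^sup>2 \<le> K * fiber_energy x"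
    using inverse_heat_sq_le[OF s] by blast
  have "ennreal ((cmod (inverse_heat s p x))\<^sup>2) \<le> K * fiber_energy x" for x
  proof (cases "integrable lborel (\<lambda>b. complex_of_real (gauss_kernel s b) * p (cpx x b))")
    case True
    have "ennreal (cmod (inverse_heat s p x)) \<le> (\<integral>\<^sup>+b. ennreal (norm (complex_of_real (gauss_kernel s b) * p (cpx x b))) \<partial>lborel)"
      unfolding inverse_heat_def by (rule integral_norm_bound_ennreal[OF True])
    also have "\<dots> = (\<integral>\<^sup>+b. ennreal (gauss_kernel s b * cmod (p (cpx x b))) \<partial>lborel)"
      by (simp add: norm_mult gauss_kernel_nonneg[OF s(1)])
    finally have "(ennreal (cmod (inverse_heat s p x)))\<^sup>2 \<le> (\<integral>\<^sup>+b. ennreal (gauss_kernel s b * cmod (p (cpx x b))) \<partial>lborel)\<^sup>2"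
      by (rule power_mono) simp
    then show ?thesis using K(2)[of x] by (simp add: ennreal_power)
  qed (simp add: inverse_heat_def not_integrable_integral_eq)
  then have "dom_energy D (inverse_heat s p) \<le> (\<integral>\<^sup>+x. indicator D x * (K * fiber_energy x) \<partial>lborel)"
    unfolding dom_energy_def by (intro nn_integral_mono mult_left_mono) simp_all
  also have "\<dots> = K * fock_energy D t p"
    unfolding fock_energy_fiber by (subst nn_integral_cmult[symmetric]) (simp_all add: mult_ac)
  also have "\<dots> < \<infinity>" using K fin by (simp add: ennreal_mult_less_top)
  finally show ?thesis .
qed

text \<open>Composing the two integrals at a real point \<open>x\<close> gives the integral of
  \<open>p (x + a + i b)\<close> against the same Gaussian in \<open>a\<close> and in
  \<open>b\<close>; equal variances make the weight rotation invariant.\<close>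

lemma heat_inverse_heat:
  assumes s: "0 < s" "s < t"
  shows "heat s (inverse_heat s p) = p"
proof (rule entire_eq_on_real)
  let ?u = "inverse_heat s p"
  have u: "tame ?u" by (rule quasi_periodic_tame[OF quasi_periodic_inverse_heat dom_energy_inverse_heat[OF s]])
  note [measurable] = tame_borel_measurable[OF u]
  show "entire (heat s ?u)" by (rule entire_heat[OF u s(1)])
  show "entire p" by (rule p)
  fix x
  obtain K where K: "K < \<infinity>" "\<And>x. (\<integral>\<^sup>+b. ennreal (gauss_kernel s b * cmod (p (cpx x b))) \<partial>lborel)\<^sup>2 \<le> K * fiber_energy x"
    using inverse_heat_sq_le[OF s] by blast
  define F where "F q = complex_of_real (gauss_kernel s (fst q) * gauss_kernel s (snd q)) * p (cvec x + cpx (fst q) (snd q))" for q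
  have [measurable]: "F \<in> borel_measurable (lborel \<Otimes>\<^sub>M lborel)" unfolding F_def[abs_def] by measurable
  have shift: "cvec x + cpx a b = cpx (x + a) b" for a b
    unfolding cpx_zero_right[symmetric] cpx_add by simp
  have "integrable (lborel \<Otimes>\<^sub>M lborel) F"
  proof (rule integrableI_bounded)
    have "(\<integral>\<^sup>+q. ennreal (norm (F q)) \<partial>(lborel \<Otimes>\<^sub>M lborel)) = (\<integral>\<^sup>+a. \<integral>\<^sup>+b. ennreal (norm (F (a, b))) \<partial>lborel \<partial>lborel)"
      by (subst lborel.nn_integral_fst[symmetric]) simp_all
    also have "\<dots> = (\<integral>\<^sup>+a. ennreal (gauss_kernel s a) * (\<integral>\<^sup>+b. ennreal (gauss_kernel s b * cmod (p (cpx (x + a) b))) \<partial>lborel) \<partial>lborel)"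
    proof (rule nn_integral_cong)
      fix a :: "real^'n"
      have "(\<integral>\<^sup>+b. ennreal (norm (F (a, b))) \<partial>lborel) = (\<integral>\<^sup>+b. ennreal (gauss_kernel s a) * ennreal (gauss_kernel s b * cmod (p (cpx (x + a) b))) \<partial>lborel)"
        by (intro nn_integral_cong)
           (simp add: F_def shift norm_mult ennreal_mult[symmetric] mult.assoc gauss_kernel_nonneg[OF s(1)])
      also have "\<dots> = ennreal (gauss_kernel s a) * (\<integral>\<^sup>+b. ennreal (gauss_kernel s b * cmod (p (cpx (x + a) b))) \<partial>lborel)"
        by (rule nn_integral_cmult) measurable
      finally show "(\<integral>\<^sup>+b. ennreal (norm (F (a, b))) \<partial>lborel) = ennreal (gauss_kernel s a) * (\<integral>\<^sup>+b. ennreal (gauss_kernel s b * cmod (p (cpx (x + a) b))) \<partial>lborel)" .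
    qed
    also have "\<dots> \<le> (\<integral>\<^sup>+a. ennreal (gauss_kernel s a) * (1 + K * fiber_energy (x + a)) \<partial>lborel)"
    proof (intro nn_integral_mono mult_left_mono)
      fix a
      let ?m = "\<integral>\<^sup>+b. ennreal (gauss_kernel s b * cmod (p (cpx (x + a) b))) \<partial>lborel"
      \<comment> \<open>The fibre estimate is quadratic; this converts it into the first power
        needed for absolute integrability of \<open>F\<close>.\<close>
      have "?m \<le> 1 + ?m\<^sup>2"
      proof (cases "?m \<le> 1")
        case False
        then have "?m * 1 \<le> ?m * ?m" by (intro mult_left_mono) auto
        then have "?m \<le> ?m\<^sup>2" by (simp add: power2_eq_square)
        then show ?thesis by (rule order_trans) simp
      qed (simp add: add_increasing2)
      also have "\<dots> \<le> 1 + K * fiber_energy (x + a)" by (intro add_left_mono K(2))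
      finally show "?m \<le> 1 + K * fiber_energy (x + a)" .
    qed simp
    also have "\<dots> = (\<integral>\<^sup>+a. ennreal (gauss_kernel s a) + K * (ennreal (gauss_kernel s a) * fiber_energy (x + a)) \<partial>lborel)"
      by (intro nn_integral_cong) (simp add: distrib_left mult_ac)
    also have "\<dots> = (\<integral>\<^sup>+a. ennreal (gauss_kernel s a) \<partial>(lborel::(real^'n) measure)) + K * (\<integral>\<^sup>+a. ennreal (gauss_kernel s a) * fiber_energy (x + a) \<partial>lborel)"
      by (simp add: nn_integral_add nn_integral_cmult)
    also have "\<dots> < \<infinity>"
      using gauss_fiber_energy_finite[OF s(1), of x] K(1) by (simp add: nn_integral_gauss_kernel[OF s(1)] ennreal_mult_less_top)
    finally show "(\<integral>\<^sup>+q. ennreal (norm (F q)) \<partial>(lborel \<Otimes>\<^sub>M lborel)) < \<infinity>" .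
  qed measurable
  note int = this
  have "heat s ?u (cvec x) = (\<integral>a. heat_kernel s (cvec x - cvec (a + x)) * ?u (a + x) \<partial>lborel)"
    unfolding heat_def by (rule integral_translation[symmetric]) measurable
  also have "\<dots> = (\<integral>a. \<integral>b. F (a, b) \<partial>lborel \<partial>lborel)"
  proof (intro Bochner_Integration.integral_cong refl)
    fix a
    have "heat_kernel s (cvec x - cvec (a + x)) = complex_of_real (gauss_kernel s a)"
      unfolding cvec_diff[symmetric] heat_kernel_cvec using gauss_kernel_minus[of s a] by simp
    then have "heat_kernel s (cvec x - cvec (a + x)) * ?u (a + x) = complex_of_real (gauss_kernel s a) * (\<integral>b. complex_of_real (gauss_kernel s b) * p (cpx (x + a) b) \<partial>lborel)"
      by (simp add: inverse_heat_def add.commute)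
    also have "\<dots> = (\<integral>b. complex_of_real (gauss_kernel s a) * (complex_of_real (gauss_kernel s b) * p (cpx (x + a) b)) \<partial>lborel)"
      by (rule integral_mult_right_zero[symmetric])
    also have "\<dots> = (\<integral>b. F (a, b) \<partial>lborel)" by (simp add: F_def shift mult.assoc)
    finally show "heat_kernel s (cvec x - cvec (a + x)) * ?u (a + x) = (\<integral>b. F (a, b) \<partial>lborel)" .
  qed
  also have "\<dots> = (\<integral>q. F q \<partial>(lborel \<Otimes>\<^sub>M lborel))" by (rule lborel_pair.integral_fst'[OF int])
  also have "\<dots> = p (cvec x + 0)"
    using gauss_mean_value[OF entire_translate[OF p] s(1), of "cvec x"] int unfolding F_def by simp
  finally show "heat s ?u (cvec x) = p (cvec x)" by simp
qed

lemma heat_surjective: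
  "\<exists>u. quasi_periodic u \<and> dom_energy D u < \<infinity> \<and> heat t u = p"
proof -
  \<comment> \<open>The shift by 2 gives \<open>\<tau> 0 = t / 2\<close>, so all times
    \<open>t - \<tau> k\<close> lie strictly between 0 and \<open>t\<close>, and \<open>U 0\<close>
    is a fixed function with heat transform \<open>p\<close> at time \<open>t / 2\<close>.\<close>
  define \<tau> where "\<tau> k = t / (2 + real k)" for k :: nat
  have \<tau>: "0 < \<tau> k" "0 < t - \<tau> k" "t - \<tau> k < t" for k
    using t by (auto simp: \<tau>_def divide_less_eq)
  have "(\<lambda>k. t * inverse (real (Suc (Suc k)))) \<longlonglongrightarrow> t * 0"
    by (intro tendsto_intros LIMSEQ_Suc[OF LIMSEQ_inverse_real_of_nat])
  then have \<tau>0: "\<tau> \<longlonglongrightarrow> 0" by (simp add: \<tau>_def[abs_def] divide_inverse add.commute)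
  define U where "U k = inverse_heat (t - \<tau> k) p" for k
  have U: "quasi_periodic (U k)" "dom_energy D (U k) < \<infinity>" "heat (t - \<tau> k) (U k) = p" for k
    unfolding U_def
    by (rule quasi_periodic_inverse_heat, rule dom_energy_inverse_heat[OF \<tau>(2,3)], rule heat_inverse_heat[OF \<tau>(2,3)])
  have tU: "tame (U k)" for k by (rule quasi_periodic_tame[OF U(1,2)])
  have Um [measurable]: "U k \<in> borel_measurable borel" for k by (rule tame_borel_measurable[OF tU])
  define P where "P k = heat t (U k)" for k
  have Pm [measurable]: "P k \<in> borel_measurable borel" for k
    unfolding P_def by (rule entire_imp_borel_measurable[OF entire_heat[OF tU t]])
  have Peq: "P k = (\<lambda>z. \<integral>y. complex_of_real (gauss_kernel (\<tau> k) y) * p (z - cvec y) \<partial>lborel)" for k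
    using heat_semigroup[OF tU[of k] \<tau>(1)[of k] \<tau>(2)[of k]] unfolding U(3) by (simp add: P_def fun_eq_iff)
  have Plim: "(\<lambda>k. P k z) \<longlonglongrightarrow> p z" for z
  proof -
    \<comment> \<open>By the semigroup law \<open>P k\<close>, the average of \<open>p\<close> at
      time \<open>\<tau> k\<close>, is also the heat transform of the fixed \<open>U 0\<close> at a
      varying time; convergence becomes continuity in time.\<close>
    have "P k z = heat (t / 2 + \<tau> k) (U 0) z" for k
      using heat_semigroup[OF tU[of 0] \<tau>(1)[of k] \<tau>(2)[of 0], of z] U(3)[of 0] unfolding Peq by (simp add: \<tau>_def)
    moreover have "(\<lambda>k. heat (t / 2 + \<tau> k) (U 0) z) \<longlonglongrightarrow> heat (t / 2) (U 0) z"
      using \<tau> t by (intro heat_continuous_time[OF tU _ _ \<tau>0]) (auto intro: less_imp_le)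
    moreover have "heat (t / 2) (U 0) = p" using U(3)[of 0] by (simp add: \<tau>_def)
    ultimately show ?thesis by simp
  qed
  let ?M = "density (lborel \<Otimes>\<^sub>M lborel) (\<lambda>q. indicator D (fst q) * ennreal (exp (- (norm (snd q))\<^sup>2 / t))) :: ((real^'n) \<times> (real^'n)) measure"
  have P_p: "(\<lambda>k. fock_energy D t (\<lambda>z. P k z - p z)) \<longlonglongrightarrow> 0"
  proof -
    have "(\<lambda>k. \<integral>\<^sup>+q. ennreal ((cmod (P k (cpx (fst q) (snd q)) - p (cpx (fst q) (snd q))))\<^sup>2) \<partial>?M) \<longlonglongrightarrow> 0"
    proof (rule L2_tendsto_of_norm_le)
      show "(\<integral>\<^sup>+q. ennreal ((cmod (P k (cpx (fst q) (snd q))))\<^sup>2) \<partial>?M) \<le> (\<integral>\<^sup>+q. ennreal ((cmod (p (cpx (fst q) (snd q))))\<^sup>2) \<partial>?M)" for k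
        unfolding fock_energy_density[OF Pm domain_borel, symmetric] fock_energy_density[OF p_borel domain_borel, symmetric]
        unfolding Peq by (rule fock_energy_contraction[OF p_borel per \<tau>(1)])
      show "(\<integral>\<^sup>+q. ennreal ((cmod (p (cpx (fst q) (snd q))))\<^sup>2) \<partial>?M) < \<infinity>"
        unfolding fock_energy_density[OF p_borel domain_borel, symmetric] by (rule fin)
    qed (simp_all add: Plim)
    then show ?thesis by (subst fock_energy_density) simp_all
  qed
  define \<kappa> where "\<kappa> = sqrt (pi * t) ^ CARD('n)"
  have \<kappa>: "\<kappa> > 0" using t by (simp add: \<kappa>_def)
  \<comment> \<open>The isometry at time \<open>t\<close> turns closeness of the \<open>P k\<close>
    to \<open>p\<close> into the Cauchy property of the \<open>U k\<close>.\<close>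
  have energy_diff: "dom_energy D (\<lambda>x. U k x - U l x) \<le> ennreal (1 / \<kappa>) * (2 * fock_energy D t (\<lambda>z. P k z - p z) + 2 * fock_energy D t (\<lambda>z. P l z - p z))" for k l
  proof -
    have q: "quasi_periodic (\<lambda>x. U k x - U l x)" by (rule quasi_periodic_diff[OF U(1) U(1)])
    have "dom_energy D (\<lambda>x. U k x - U l x) \<le> 2 * dom_energy D (U k) + 2 * dom_energy D (U l)"
      by (rule dom_energy_diff_le) measurable
    also have "\<dots> < \<infinity>" using U(2) by (simp add: ennreal_mult_less_top)
    finally have e: "dom_energy D (\<lambda>x. U k x - U l x) < \<infinity>" .
    have h: "heat t (\<lambda>x. U k x - U l x) = (\<lambda>z. (P k z - p z) - (P l z - p z))"
      by (simp add: fun_eq_iff heat_diff[OF tU tU t] P_def)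
    have "ennreal \<kappa> * dom_energy D (\<lambda>x. U k x - U l x) = fock_energy D t (\<lambda>z. (P k z - p z) - (P l z - p z))"
      using heat_isometry[OF q e t] unfolding \<kappa>_def h by simp
    also have "\<dots> \<le> 2 * fock_energy D t (\<lambda>z. P k z - p z) + 2 * fock_energy D t (\<lambda>z. P l z - p z)"
      using nn_integral_cmod_diff_sq_le[of "\<lambda>q. P k (cpx (fst q) (snd q)) - p (cpx (fst q) (snd q))" ?M "\<lambda>q. P l (cpx (fst q) (snd q)) - p (cpx (fst q) (snd q))"]
      by (simp add: fock_energy_density)
    finally have le: "ennreal (1 / \<kappa>) * (ennreal \<kappa> * dom_energy D (\<lambda>x. U k x - U l x)) \<le> ennreal (1 / \<kappa>) * (2 * fock_energy D t (\<lambda>z. P k z - p z) + 2 * fock_energy D t (\<lambda>z. P l z - p z))"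
      by (rule mult_left_mono) simp
    have "ennreal (1 / \<kappa>) * ennreal \<kappa> = 1" using \<kappa> by (simp add: ennreal_mult[symmetric])
    then have "ennreal (1 / \<kappa>) * (ennreal \<kappa> * dom_energy D (\<lambda>x. U k x - U l x)) = dom_energy D (\<lambda>x. U k x - U l x)"
      by (simp add: mult.assoc[symmetric])
    with le show ?thesis by simp
  qed
  have "\<exists>k. \<forall>l\<ge>k. fock_energy D t (\<lambda>z. P l z - p z) < ennreal ((1 / 4) ^ j)" for j
    using order_tendstoD(2)[OF P_p, of "ennreal ((1 / 4) ^ j)"] by (simp add: eventually_sequentially)
  then obtain r where r: "\<And>j l. r j \<le> l \<Longrightarrow> fock_energy D t (\<lambda>z. P l z - p z) < ennreal ((1 / 4) ^ j)" by metis
  \<comment> \<open>\<open>r j\<close> secures the geometric accuracy that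
    \<open>L2_complete_fast\<close> asks for; the maximum with \<open>j\<close> forces
    \<open>m\<close> to infinity, so that \<open>P (m j)\<close> still converges pointwise to
    \<open>p\<close>.\<close>
  define m where "m j = max (r j) j" for j
  have m: "fock_energy D t (\<lambda>z. P (m j) z - p z) \<le> ennreal ((1 / 4) ^ j)" for j
    using r[of j "m j"] by (simp add: m_def)
  have "filterlim m at_top sequentially"
    by (rule filterlim_at_top_mono[OF filterlim_ident]) (simp add: m_def)
  note Plim_m = filterlim_compose[OF Plim this]
  define C where "C = ennreal (1 / \<kappa>) * 4"
  have C: "C < \<infinity>" by (simp add: C_def ennreal_mult_less_top)
  define w where "w j = U (m j)" for j
  have wm [measurable]: "w j \<in> borel_measurable borel" for j unfolding w_def by measurable
  define u where "u = lim_or_zero w"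
  have um [measurable]: "u \<in> borel_measurable borel" unfolding u_def by (rule borel_measurable_lim_or_zero) measurable
  have cauchy: "dom_energy D (\<lambda>x. w n x - w j x) \<le> C * ennreal ((1 / 4) ^ j)" if "j \<le> n" for j n
  proof -
    have "(1 / 4::real) ^ n \<le> (1 / 4) ^ j" using that by (intro power_decreasing) simp_all
    then have "fock_energy D t (\<lambda>z. P (m n) z - p z) \<le> ennreal ((1 / 4) ^ j)"
      using m[of n] by (meson ennreal_leI order_trans)
    then have "2 * fock_energy D t (\<lambda>z. P (m n) z - p z) + 2 * fock_energy D t (\<lambda>z. P (m j) z - p z) \<le> 2 * ennreal ((1 / 4) ^ j) + 2 * ennreal ((1 / 4) ^ j)"
      by (intro add_mono mult_left_mono m) simp_all
    also have "\<dots> = 4 * ennreal ((1 / 4) ^ j)" by (simp add: distrib_right[symmetric])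
    finally show ?thesis
      unfolding w_def C_def mult.assoc by (intro order_trans[OF energy_diff] mult_left_mono) simp_all
  qed
  have lim_energy: "dom_energy D (\<lambda>x. u x - w j x) \<le> C * ennreal ((1 / 4) ^ j)" for j
  proof -
    have "(\<integral>\<^sup>+x. ennreal ((cmod (lim_or_zero w x - w j x))\<^sup>2) \<partial>density lborel (indicator D)) \<le> C * ennreal ((1 / 4) ^ j)"
    proof (rule L2_complete_fast[OF _ C])
      show "(\<integral>\<^sup>+x. ennreal ((cmod (w n x - w j x))\<^sup>2) \<partial>density lborel (indicator D)) \<le> C * ennreal ((1 / 4) ^ j)" if "j \<le> n" for j n
        using cauchy[OF that] by (simp add: dom_energy_density)
    qed measurable
    then show ?thesis by (simp add: dom_energy_density u_def[symmetric])
  qed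
  have uq: "quasi_periodic u"
  proof -
    \<comment> \<open>The approximants satisfy the functional equation at every point, and
      \<open>ch g \<noteq> 0\<close> makes convergence at \<open>x\<close> and at
      \<open>x + g\<close> equivalent, so both branches of \<open>lim_or_zero\<close> respect
      it.\<close>
    have "u (x + g) = ch g * u x" if g: "g \<in> G" for x g
    proof -
      have wx: "w j (x + g) = ch g * w j x" for j unfolding w_def U_def by (rule inverse_heat_translate[OF g])
      have c0: "ch g \<noteq> 0" using cmod_ch[OF g] by auto
      have cv: "convergent (\<lambda>j. ch g * w j x) \<longleftrightarrow> convergent (\<lambda>j. w j x)"
        by (rule convergent_mult_const_iff[OF c0])
      show ?thesis
      proof (cases "convergent (\<lambda>j. w j x)")
        case True
        then have "(\<lambda>j. ch g * w j x) \<longlonglongrightarrow> ch g * lim (\<lambda>j. w j x)"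
          by (intro tendsto_intros) (simp add: convergent_LIMSEQ_iff)
        then show ?thesis using True by (simp add: u_def lim_or_zero_def wx cv limI)
      qed (simp add: u_def lim_or_zero_def wx cv)
    qed
    then show ?thesis by (simp add: quasi_periodic_def)
  qed
  have ed: "dom_energy D (\<lambda>x. u x - w j x) < \<infinity>" for j
    using lim_energy[of j] by (rule order_le_less_trans) (use C in \<open>simp add: ennreal_mult_less_top\<close>)
  have uf: "dom_energy D u < \<infinity>"
  proof -
    have "dom_energy D u \<le> 2 * dom_energy D (\<lambda>x. u x - w 0 x) + 2 * dom_energy D (\<lambda>x. - w 0 x)"
      using dom_energy_diff_le[of "\<lambda>x. u x - w 0 x" "\<lambda>x. - w 0 x" D] by simp
    also have "dom_energy D (\<lambda>x. - w 0 x) = dom_energy D (w 0)" by (simp add: dom_energy_def)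
    finally show ?thesis
      by (rule order_le_less_trans) (use ed[of 0] U(2) in \<open>simp add: ennreal_mult_less_top w_def\<close>)
  qed
  have tu: "tame u" by (rule quasi_periodic_tame[OF uq uf])
  have "heat t u z = p z" for z
  proof -
    \<comment> \<open>Bounded point evaluation shows that \<open>P (m j) z\<close> tends to
      \<open>heat t u z\<close>; it also tends to \<open>p z\<close>.\<close>
    obtain B where B: "B < \<infinity>" "\<And>u. quasi_periodic u \<Longrightarrow> dom_energy D u < \<infinity> \<Longrightarrow> ennreal ((cmod (heat t u z))\<^sup>2) \<le> B * dom_energy D u"
      using heat_point_bound[OF t, of z] by blast
    have "ennreal ((cmod (heat t u z - P (m j) z))\<^sup>2) \<le> B * (C * ennreal ((1 / 4) ^ j))" for j
    proof -
      have "heat t u z - P (m j) z = heat t (\<lambda>x. u x - w j x) z"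
        unfolding w_def P_def by (rule heat_diff[OF tu tU t, symmetric])
      then have "ennreal ((cmod (heat t u z - P (m j) z))\<^sup>2) \<le> B * dom_energy D (\<lambda>x. u x - w j x)"
        using B(2)[OF quasi_periodic_diff[OF uq U(1)], of "m j"] ed[of j] unfolding w_def by simp
      also have "\<dots> \<le> B * (C * ennreal ((1 / 4) ^ j))" by (intro mult_left_mono lim_energy) simp
      finally show ?thesis .
    qed
    moreover obtain c where c: "B * C = ennreal c" "0 \<le> c"
      using B(1) C by (cases "B * C") (auto simp: ennreal_mult_eq_top_iff)
    ultimately have "ennreal ((cmod (heat t u z - P (m j) z))\<^sup>2) \<le> ennreal (c * (1 / 4) ^ j)" for j
      by (simp add: mult.assoc[symmetric] ennreal_mult)
    then have le: "(cmod (heat t u z - P (m j) z))\<^sup>2 \<le> c * (1 / 4) ^ j" for j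
      using c(2) by (simp add: ennreal_le_iff)
    have "(\<lambda>j. c * (1 / 4) ^ j) \<longlonglongrightarrow> c * 0" by (intro tendsto_intros LIMSEQ_realpow_zero) simp_all
    then have c0: "(\<lambda>j. c * (1 / 4) ^ j) \<longlonglongrightarrow> 0" by simp
    have "(\<lambda>j. (cmod (heat t u z - P (m j) z))\<^sup>2) \<longlonglongrightarrow> 0"
      by (rule tendsto_zero_le[OF zero_le_power2 le c0])
    moreover have "(\<lambda>j. (cmod (heat t u z - P (m j) z))\<^sup>2) \<longlonglongrightarrow> (cmod (heat t u z - p z))\<^sup>2"
      by (intro tendsto_intros Plim_m)
    ultimately have "(cmod (heat t u z - p z))\<^sup>2 = 0" by (rule LIMSEQ_unique[symmetric])
    then show ?thesis by simp
  qed
  then show ?thesis using uq uf by (intro exI[of _ u]) (auto simp: fun_eq_iff)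
qed

end

end

section \<open>The Segal-Bargmann transform\<close>

lemma AE_scaleR:
  fixes P :: "'a::euclidean_space \<Rightarrow> bool"
  assumes "AE x in lborel. P x" and c: "c \<noteq> 0"
  shows "AE x in lborel. P (c *\<^sub>R x)"
proof -
  obtain N where N: "{x. \<not> P x} \<subseteq> N" "N \<in> sets lborel" "emeasure lborel N = 0"
    using assms by (auto elim!: AE_E)
  have [measurable]: "N \<in> sets borel" using N by simp
  have "ennreal (\<bar>c\<bar> ^ DIM('a)) * (\<integral>\<^sup>+x. indicator N (0 + c *\<^sub>R x) \<partial>lborel) = 0"
    using N c by (subst nn_integral_lborel_affine[symmetric]) auto
  then have "(\<integral>\<^sup>+x. indicator N (c *\<^sub>R x) \<partial>(lborel :: 'a measure)) = 0"
    using c by (simp add: ennreal_eq_0_iff power_le_zero_eq)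
  then have "AE x in lborel. indicator N (c *\<^sub>R x) = (0::ennreal)"
    by (subst (asm) nn_integral_0_iff_AE) auto
  then show ?thesis
    by eventually_elim (use N in \<open>auto simp: indicator_def split: if_splits\<close>)
qed

text \<open>Translation carries the isolation of 0 to a uniform distance between distinct elements,
  and a set without limit points in a Euclidean space is countable.\<close>

lemma discrete_subgroup_countable:
  fixes \<Gamma> :: "'a::euclidean_space set"
  assumes "discrete_subgroup \<Gamma>"
  shows "countable \<Gamma>"
proof (rule no_limpt_imp_countable)
  fix z
  have "0 isolated_in \<Gamma>" using assms by (simp add: discrete_subgroup_def discrete_def)
  then obtain e where e: "e > 0" "\<And>y. y \<in> \<Gamma> \<Longrightarrow> dist 0 y < e \<Longrightarrow> y = 0"
    unfolding isolated_in_dist_Ex_iff by auto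
  have "y = x" if "x \<in> \<Gamma>" "y \<in> \<Gamma>" "dist y x < e" for x y
  proof -
    have "y + - x \<in> \<Gamma>" using assms that(1,2) unfolding discrete_subgroup_def by blast
    with e(2)[of "y + - x"] that(3) show ?thesis by (simp add: dist_norm norm_minus_commute[of x y])
  qed
  then show "\<not> z islimpt \<Gamma>" using e(1) by (intro discrete_imp_not_islimpt) auto
qed

text \<open>A bridge from the Bochner integrals of the definitions to \<open>ennreal\<close>
  integrals, where energies can be compared before finiteness is known.\<close>

lemma set_integrable_iff_nn_integral:
  fixes h :: "'a::euclidean_space \<Rightarrow> real"
  assumes [measurable]: "h \<in> borel_measurable borel" "S \<in> sets borel" and h: "\<And>x. 0 \<le> h x"
  shows "set_integrable lborel S h \<longleftrightarrow> (\<integral>\<^sup>+x. indicator S x * ennreal (h x) \<partial>lborel) < \<infinity>"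
    and "(LINT x:S|lborel. h x) = enn2real (\<integral>\<^sup>+x. indicator S x * ennreal (h x) \<partial>lborel)"
proof -
  have e: "ennreal (indicator S x *\<^sub>R h x) = indicator S x * ennreal (h x)" for x
    by (simp add: indicator_def)
  show "set_integrable lborel S h \<longleftrightarrow> (\<integral>\<^sup>+x. indicator S x * ennreal (h x) \<partial>lborel) < \<infinity>"
    unfolding set_integrable_def integrable_iff_bounded
    using h by (simp add: e[symmetric] abs_mult)
  show "(LINT x:S|lborel. h x) = enn2real (\<integral>\<^sup>+x. indicator S x * ennreal (h x) \<partial>lborel)"
    unfolding set_lebesgue_integral_def e[symmetric]
    by (rule integral_eq_nn_integral) (use h in auto)
qed

section \<open>Reduction of both theta spaces to quasi-periodic functions\<close>

definition unweight :: "real \<Rightarrow> (real^'n \<Rightarrow> complex) \<Rightarrow> real^'n \<Rightarrow> complex" where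
  "unweight \<nu> f x = complex_of_real (exp (- \<nu> * (norm x)\<^sup>2 / 2)) * f x"

text \<open>The dilation carries \<open>\<Gamma>'\<close> to \<open>\<Gamma>\<close>, and the
  Gaussian factor produces the exponential automorphy factor, so that a plain character is left for
  \<open>p\<close>.\<close>

definition lift :: "real \<Rightarrow> (complex^'n \<Rightarrow> complex) \<Rightarrow> complex^'n \<Rightarrow> complex" where
  "lift \<nu> p z = exp (complex_of_real (\<nu> / 2) * bilin z z) * p (sqrt 2 *\<^sub>R z)"

lemma unweight_borel [measurable]: "f \<in> borel_measurable borel \<Longrightarrow> unweight \<nu> f \<in> borel_measurable borel"
  unfolding unweight_def[abs_def] by measurable

lemma cmod_unweight_sq: "(cmod (unweight \<nu> f x))\<^sup>2 = (cmod (f x))\<^sup>2 * exp (- \<nu> * (norm x)\<^sup>2)"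
  unfolding unweight_def by (simp add: norm_mult power_mult_distrib exp_double[symmetric])

lemma unweight_inverse: "unweight \<nu> (\<lambda>x. complex_of_real (exp (\<nu> * (norm x)\<^sup>2 / 2)) * u x) = u"
  by (simp add: unweight_def fun_eq_iff mult.assoc[symmetric] of_real_mult[symmetric] exp_add[symmetric] del: of_real_mult of_real_exp)

text \<open>The prefactor of the transform times the normalisation by which
  \<open>heat_kernel\<close> divides at time \<open>1 / \<nu>\<close>.\<close>

definition bargmann_const :: "'n::finite itself \<Rightarrow> real \<Rightarrow> real" where
  "bargmann_const _ \<nu> = (\<nu> / pi) powr (3 * real CARD('n) / 4) * sqrt (2 * pi * (1 / \<nu>)) ^ CARD('n)"

lemma bargmann_const_pos: "\<nu> > 0 \<Longrightarrow> bargmann_const TYPE('n::finite) \<nu> > 0"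
  by (simp add: bargmann_const_def)

text \<open>The power of 2 comes from \<open>fock_energy_lift\<close>, the power of
  \<open>sqrt (pi * (1 / \<nu>))\<close> from \<open>heat_isometry\<close>.\<close>

lemma bargmann_const_sq:
  assumes "\<nu> > 0"
  shows "1 / 2 ^ CARD('n) * ((bargmann_const TYPE('n::finite) \<nu>)\<^sup>2 * sqrt (pi * (1 / \<nu>)) ^ CARD('n)) = 1"
proof -
  \<comment> \<open>In terms of \<open>s\<close> all factors are integral powers, and the claim
    reduces to \<open>1/2 * (s^3 * (2 / s^2) * (1 / s)) = 1\<close> in each coordinate.\<close>
  define s where "s = sqrt (\<nu> / pi)"
  have s: "s > 0" "s\<^sup>2 = \<nu> / pi" using assms by (simp_all add: s_def)
  let ?n = "CARD('n)"
  have "((\<nu> / pi) powr (3 * real ?n / 4))\<^sup>2 = (\<nu> / pi) powr (3 * real ?n / 2)"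
    by (simp add: powr_add[symmetric] power2_eq_square)
  also have "\<dots> = s ^ (3 * ?n)"
  proof -
    have "s ^ (3 * ?n) = s powr (real (3 * ?n))" by (rule powr_realpow[OF s(1), symmetric])
    also have "\<dots> = (\<nu> / pi) powr (1 / 2 * real (3 * ?n))"
      unfolding s_def using assms by (simp add: powr_half_sqrt[symmetric] powr_powr)
    finally show ?thesis by simp
  qed
  finally have 1: "((\<nu> / pi) powr (3 * real ?n / 4))\<^sup>2 = s ^ (3 * ?n)" .
  have 2: "(sqrt (2 * pi * (1 / \<nu>)) ^ ?n)\<^sup>2 = (2 * (1 / s\<^sup>2)) ^ ?n"
    using assms by (simp add: power_mult[symmetric] mult.commute[of ?n 2] power_mult s)
  have 3: "sqrt (pi * (1 / \<nu>)) = 1 / s" using assms by (simp add: s_def real_sqrt_divide)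
  have "1 / 2 * (s ^ 3 * (2 * (1 / s\<^sup>2)) * (1 / s)) = 1"
    using s(1) by (simp add: field_simps power2_eq_square power3_eq_cube)
  then have "(1 / 2 * (s ^ 3 * (2 * (1 / s\<^sup>2)) * (1 / s))) ^ ?n = 1" by simp
  then show ?thesis
    unfolding bargmann_const_def power_mult_distrib[of "_ powr _"] 1 2 3
    by (simp only: power_mult power_mult_distrib power_one_over)
qed

text \<open>Completing the square: \<open>\<nu>/2 <z,z> - \<nu>/2 <sqrt 2 z - x, sqrt 2 z - x> -
  \<nu>/2 |x|^2\<close> is the full exponent of the integrand. Half of the weight
  \<open>exp (- \<nu> |x|^2)\<close> goes into \<open>unweight\<close>, the other half into the
  kernel.\<close>

lemma bargmann_integrand_eq:
  fixes z :: "complex^'n"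
  assumes \<nu>: "\<nu> > 0"
  shows "bargmann_integrand \<nu> f z x = (complex_of_real (sqrt (2 * pi * (1 / \<nu>)) ^ CARD('n)) * exp (complex_of_real (\<nu> / 2) * bilin z z))
    * (heat_kernel (1 / \<nu>) (sqrt 2 *\<^sub>R z - cvec x) * unweight \<nu> f x)"
proof -
  have s2: "complex_of_real (sqrt 2) * (complex_of_real (sqrt 2) * c) = 2 * c" for c
    by (simp add: mult.assoc[symmetric] of_real_mult[symmetric] del: of_real_mult)
  have b: "bilin (sqrt 2 *\<^sub>R z - cvec x) (sqrt 2 *\<^sub>R z - cvec x) = 2 * bilin z z - 2 * (complex_of_real (sqrt 2) * bilin z (cvec x)) + complex_of_real ((norm x)\<^sup>2)"
    unfolding bilin_diff_left bilin_diff_right bilin_scaleR_left bilin_scaleR_right bilin_cvec bilin_commute[of "cvec x"]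
    by (simp add: power2_norm_eq_inner algebra_simps s2 s2[of 1, simplified])
  have "complex_of_real (\<nu> / 2) * bilin z z + (- bilin (sqrt 2 *\<^sub>R z - cvec x) (sqrt 2 *\<^sub>R z - cvec x) / complex_of_real (2 * (1 / \<nu>)) + complex_of_real (- \<nu> * (norm x)\<^sup>2 / 2))
    = (complex_of_real (sqrt 2 * \<nu>) * bilin z (cvec x) - complex_of_real (\<nu> / 2) * bilin z z) + complex_of_real (- \<nu> * (norm x)\<^sup>2)"
    unfolding b using \<nu> by (simp add: field_simps)
  then have e: "exp (complex_of_real (\<nu> / 2) * bilin z z) * (exp (- bilin (sqrt 2 *\<^sub>R z - cvec x) (sqrt 2 *\<^sub>R z - cvec x) / complex_of_real (2 * (1 / \<nu>))) * exp (complex_of_real (- \<nu> * (norm x)\<^sup>2 / 2)))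
    = exp (complex_of_real (sqrt 2 * \<nu>) * bilin z (cvec x) - complex_of_real (\<nu> / 2) * bilin z z) * exp (complex_of_real (- \<nu> * (norm x)\<^sup>2))"
    by (simp only: exp_add[symmetric])
  have c0: "complex_of_real (sqrt (2 * pi * (1 / \<nu>)) ^ CARD('n)) \<noteq> 0" using \<nu> by simp
  have "(complex_of_real (sqrt (2 * pi * (1 / \<nu>)) ^ CARD('n)) * exp (complex_of_real (\<nu> / 2) * bilin z z))
      * (heat_kernel (1 / \<nu>) (sqrt 2 *\<^sub>R z - cvec x) * unweight \<nu> f x)
    = (exp (complex_of_real (\<nu> / 2) * bilin z z) * (exp (- bilin (sqrt 2 *\<^sub>R z - cvec x) (sqrt 2 *\<^sub>R z - cvec x) / complex_of_real (2 * (1 / \<nu>))) * exp (complex_of_real (- \<nu> * (norm x)\<^sup>2 / 2)))) * f x"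
    unfolding heat_kernel_def unweight_def exp_of_real[symmetric] using c0 by (simp only: divide_inverse mult_ac) simp
  also have "\<dots> = bargmann_integrand \<nu> f z x"
    unfolding e bargmann_integrand_def exp_of_real[symmetric] by (simp only: mult_ac)
  finally show ?thesis ..
qed

lemma bargmann_eq_lift:
  fixes f :: "real^'n \<Rightarrow> complex"
  assumes \<nu>: "\<nu> > 0"
  shows "bargmann \<nu> f = lift \<nu> (\<lambda>z. complex_of_real (bargmann_const TYPE('n) \<nu>) * heat (1 / \<nu>) (unweight \<nu> f) z)"
  unfolding bargmann_def[abs_def] bargmann_integrand_eq[OF \<nu>] integral_mult_right_zero lift_def[abs_def] heat_def[symmetric] bargmann_const_def of_real_mult
  by (simp only: mult_ac)

text \<open>\<open>D\<close> and \<open>E\<close> are chosen independently of each other; the norms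
  are compared through the product domain in \<open>lattice_domains\<close>.\<close>

locale theta_setting = character_domain \<Gamma> D ch for \<Gamma> D :: "(real^'n) set" and ch +
  fixes \<nu> :: real and \<Gamma>' :: "(real^'n) set" and ch' :: "real^'n \<Rightarrow> complex" and E :: "(complex^'n) set"
  assumes \<nu>: "\<nu> > 0"
    and \<Gamma>': "\<Gamma>' = (\<lambda>g. (1 / sqrt 2) *\<^sub>R g) ` \<Gamma>"
    and ch': "\<And>g. g \<in> \<Gamma> \<Longrightarrow> ch' ((1 / sqrt 2) *\<^sub>R g) = ch g"
    and E: "fundamental_domain (cvec ` \<Gamma>') E"
begin

text \<open>Because \<open>|x + g|^2 = |x|^2 + 2 <x + g/2, g>\<close>, the factor
  \<open>exp (- \<nu> |x|^2 / 2)\<close> absorbs the real automorphy factor.\<close>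

lemma theta_L2_iff:
  "f \<in> theta_L2 D \<Gamma> ch \<nu> \<longleftrightarrow> f \<in> borel_measurable borel \<and> quasi_periodic (unweight \<nu> f) \<and> dom_energy D (unweight \<nu> f) < \<infinity>"
proof (cases "f \<in> borel_measurable borel")
  case True
  note [measurable] = this
  have "(f (x + g) = ch g * complex_of_real (exp (\<nu> * ((x + g /\<^sub>R 2) \<bullet> g))) * f x) \<longleftrightarrow> unweight \<nu> f (x + g) = ch g * unweight \<nu> f x" for x g
  proof -
    have gen: "- \<nu> * A / 2 = - \<nu> * (A + 2 * I) / 2 + \<nu> * I" for A I :: real
      by (simp add: field_simps)
    have n: "(norm (x + g))\<^sup>2 = (norm x)\<^sup>2 + 2 * ((x + g /\<^sub>R 2) \<bullet> g)"
      unfolding power2_norm_eq_inner by (simp add: inner_add_left inner_add_right inner_commute)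
    have "- \<nu> * (norm x)\<^sup>2 / 2 = - \<nu> * (norm (x + g))\<^sup>2 / 2 + \<nu> * ((x + g /\<^sub>R 2) \<bullet> g)"
      unfolding n by (rule gen)
    then have e: "exp (- \<nu> * (norm x)\<^sup>2 / 2) = exp (- \<nu> * (norm (x + g))\<^sup>2 / 2) * exp (\<nu> * ((x + g /\<^sub>R 2) \<bullet> g))"
      by (simp only: exp_add)
    have c2: "ch g * unweight \<nu> f x = complex_of_real (exp (- \<nu> * (norm (x + g))\<^sup>2 / 2)) * (ch g * complex_of_real (exp (\<nu> * ((x + g /\<^sub>R 2) \<bullet> g))) * f x)"
      unfolding unweight_def e of_real_mult by (simp only: mult_ac)
    show ?thesis
      unfolding c2 unweight_def[of \<nu> f "x + g"] mult_cancel_left by simp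
  qed
  moreover have "set_integrable lborel D (\<lambda>x. (cmod (f x))\<^sup>2 * exp (- \<nu> * (norm x)\<^sup>2)) \<longleftrightarrow> dom_energy D (unweight \<nu> f) < \<infinity>"
    unfolding dom_energy_def cmod_unweight_sq by (rule set_integrable_iff_nn_integral) simp_all
  ultimately show ?thesis using True by (simp add: theta_L2_def quasi_periodic_def)
qed (simp add: theta_L2_def)

lemma theta_L2_norm_eq:
  assumes [measurable]: "f \<in> borel_measurable borel"
  shows "theta_L2_norm D \<nu> f = sqrt (enn2real (dom_energy D (unweight \<nu> f)))"
  unfolding theta_L2_norm_def dom_energy_def cmod_unweight_sq
  by (subst set_integrable_iff_nn_integral(2)) simp_all

text \<open>The translations are real, so a domain for the real parts together with all imaginary
  parts is a domain in the complex space. Its product shape is what integration over imaginary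
  fibres requires.\<close>

lemma lattice_domains: "periodic_domain (cvec ` \<Gamma>') E" "periodic_domain (cvec ` \<Gamma>') {z. sqrt 2 *\<^sub>R re_vec z \<in> D}"
proof -
  have c: "countable (cvec ` \<Gamma>')" unfolding \<Gamma>' using countable_G by simp
  have m: "- h \<in> cvec ` \<Gamma>'" if "h \<in> cvec ` \<Gamma>'" for h
  proof -
    from that obtain g where g: "g \<in> \<Gamma>" "h = cvec ((1 / sqrt 2) *\<^sub>R g)" unfolding \<Gamma>' by blast
    have "- h = cvec ((1 / sqrt 2) *\<^sub>R (- g))" by (simp add: g(2) cvec_minus)
    then show ?thesis unfolding \<Gamma>' using uminus_G[OF g(1)] by blast
  qed
  show "periodic_domain (cvec ` \<Gamma>') E" by unfold_locales (use c m E in auto)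
  have ae: "AE z in (lborel :: (complex^'n) measure). \<exists>!g. g \<in> \<Gamma> \<and> sqrt 2 *\<^sub>R re_vec z - g \<in> D"
    by (rule AE_re_vec[where P="\<lambda>x. \<exists>!g. g \<in> \<Gamma> \<and> sqrt 2 *\<^sub>R x - g \<in> D"], rule AE_scaleR[OF domain_unique]) simp
  have "AE z in lborel. \<exists>!h. h \<in> cvec ` \<Gamma>' \<and> z - h \<in> {z. sqrt 2 *\<^sub>R re_vec z \<in> D}"
    using ae
  proof eventually_elim
    case (elim z)
    then obtain g where g: "g \<in> \<Gamma>" "sqrt 2 *\<^sub>R re_vec z - g \<in> D" "\<And>g'. g' \<in> \<Gamma> \<Longrightarrow> sqrt 2 *\<^sub>R re_vec z - g' \<in> D \<Longrightarrow> g' = g"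
      by blast
    have eq: "sqrt 2 *\<^sub>R re_vec (z - cvec ((1 / sqrt 2) *\<^sub>R g')) = sqrt 2 *\<^sub>R re_vec z - g'" for g'
      by (simp add: re_vec_diff scaleR_diff_right)
    show ?case
    proof (rule ex1I[of _ "cvec ((1 / sqrt 2) *\<^sub>R g)"])
      show "cvec ((1 / sqrt 2) *\<^sub>R g) \<in> cvec ` \<Gamma>' \<and> z - cvec ((1 / sqrt 2) *\<^sub>R g) \<in> {z. sqrt 2 *\<^sub>R re_vec z \<in> D}"
        unfolding mem_Collect_eq eq \<Gamma>' using g by blast
      fix h assume h: "h \<in> cvec ` \<Gamma>' \<and> z - h \<in> {z. sqrt 2 *\<^sub>R re_vec z \<in> D}"
      then obtain g' where g': "g' \<in> \<Gamma>" "h = cvec ((1 / sqrt 2) *\<^sub>R g')" unfolding \<Gamma>' by blast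
      with h have "sqrt 2 *\<^sub>R re_vec z - g' \<in> D" by (simp only: mem_Collect_eq eq)
      then show "h = cvec ((1 / sqrt 2) *\<^sub>R g)" using g(3) g' by blast
    qed
  qed
  moreover have "{z. sqrt 2 *\<^sub>R re_vec z \<in> D} \<in> sets (borel :: (complex^'n) measure)" by measurable
  ultimately show "periodic_domain (cvec ` \<Gamma>') {z. sqrt 2 *\<^sub>R re_vec z \<in> D}"
    by unfold_locales (use c m in \<open>auto simp: fundamental_domain_def\<close>)
qed

text \<open>Since \<open>Re <z,z> = |a|^2 - |b|^2\<close> at \<open>z = a + i b\<close>, the squared
  Gaussian factor cancels \<open>|a|^2\<close> in the weight and doubles
  \<open>|b|^2\<close>.\<close>

lemma lift_weight:
  "(cmod (lift \<nu> p (cpx a b)))\<^sup>2 * exp (- \<nu> * Re (herm (cpx a b) (cpx a b)))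
    = (cmod (p (cpx (sqrt 2 *\<^sub>R a) (sqrt 2 *\<^sub>R b))))\<^sup>2 * exp (- (norm (sqrt 2 *\<^sub>R b))\<^sup>2 / (1 / \<nu>))"
proof -
  have "cmod (lift \<nu> p (cpx a b)) = exp (\<nu> / 2 * ((norm a)\<^sup>2 - (norm b)\<^sup>2)) * cmod (p (cpx (sqrt 2 *\<^sub>R a) (sqrt 2 *\<^sub>R b)))"
    unfolding lift_def norm_mult norm_exp_eq_Re bilin_cpx_self cpx_scaleR by simp
  then have "(cmod (lift \<nu> p (cpx a b)))\<^sup>2 = exp (\<nu> * ((norm a)\<^sup>2 - (norm b)\<^sup>2)) * (cmod (p (cpx (sqrt 2 *\<^sub>R a) (sqrt 2 *\<^sub>R b))))\<^sup>2"
    by (simp add: power_mult_distrib exp_double[symmetric])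
  moreover have "exp (\<nu> * ((norm a)\<^sup>2 - (norm b)\<^sup>2)) * exp (- \<nu> * ((norm a)\<^sup>2 + (norm b)\<^sup>2)) = exp (- (norm (sqrt 2 *\<^sub>R b))\<^sup>2 / (1 / \<nu>))"
    unfolding exp_add[symmetric] by (simp add: power_mult_distrib algebra_simps)
  ultimately show ?thesis unfolding herm_cpx_self Re_complex_of_real by (simp add: mult_ac)
qed

text \<open>The automorphy factor comes from \<open><z+g, z+g> = <z,z> + 2 <z + g/2, g>\<close>; for
  real \<open>g\<close> the Hermitian product is the bilinear one.\<close>

lemma lift_translate:
  assumes p: "\<And>z g. g \<in> \<Gamma> \<Longrightarrow> p (z + cvec g) = ch g * p z" and g: "g \<in> \<Gamma>'"
  shows "lift \<nu> p (z + cvec g) = ch' g * exp (complex_of_real \<nu> * herm (z + cvec g /\<^sub>R 2) (cvec g)) * lift \<nu> p z"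
proof -
  obtain h where h: "h \<in> \<Gamma>" "g = (1 / sqrt 2) *\<^sub>R h" using g unfolding \<Gamma>' by blast
  have "sqrt 2 *\<^sub>R (z + cvec g) = sqrt 2 *\<^sub>R z + cvec h"
    by (simp add: h(2) scaleR_add_right cvec_scaleR)
  then have 1: "p (sqrt 2 *\<^sub>R (z + cvec g)) = ch' g * p (sqrt 2 *\<^sub>R z)"
    using p[OF h(1)] ch'[OF h(1)] h(2) by simp
  have e: "complex_of_real (\<nu> / 2) * bilin (z + cvec g) (z + cvec g) = complex_of_real \<nu> * herm (z + cvec g /\<^sub>R 2) (cvec g) + complex_of_real (\<nu> / 2) * bilin z z"
    unfolding herm_cvec bilin_add_left bilin_add_right bilin_scaleR_left bilin_commute[of "cvec g" z] by (simp add: field_simps)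
  show ?thesis unfolding lift_def 1 e exp_add by (simp only: mult_ac)
qed

lemma entire_lift: "entire p \<Longrightarrow> entire (lift \<nu> p)"
  unfolding lift_def[abs_def] by (rule entire_mult[OF entire_exp_bilin entire_scaleR])

text \<open>Periodicity of the weighted modulus is what allows \<open>E\<close> to be exchanged for
  another domain.\<close>

lemma cmod_translate_invariant:
  assumes F: "\<And>z g. g \<in> \<Gamma>' \<Longrightarrow> F (z + cvec g) = ch' g * exp (complex_of_real \<nu> * herm (z + cvec g /\<^sub>R 2) (cvec g)) * F z"
    and g: "g \<in> \<Gamma>'"
  shows "(cmod (F (z + cvec g)))\<^sup>2 * exp (- \<nu> * Re (herm (z + cvec g) (z + cvec g))) = (cmod (F z))\<^sup>2 * exp (- \<nu> * Re (herm z z))"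
proof -
  obtain a b where z: "z = cpx a b" using cpx_re_im[of z] by metis
  obtain h where h: "h \<in> \<Gamma>" "g = (1 / sqrt 2) *\<^sub>R h" using g unfolding \<Gamma>' by blast
  have c: "cmod (ch' g) = 1" using ch'[OF h(1)] h(2) cmod_ch[OF h(1)] by simp
  have "Re (herm (z + cvec g /\<^sub>R 2) (cvec g)) = a \<bullet> g + (norm g)\<^sup>2 / 2"
    unfolding herm_cvec bilin_add_left bilin_scaleR_left z bilin_cpx_cvec bilin_cvec by (simp add: power2_norm_eq_inner)
  then have "cmod (F (z + cvec g)) = exp (\<nu> * (a \<bullet> g + (norm g)\<^sup>2 / 2)) * cmod (F z)"
    unfolding F[OF g] norm_mult c norm_exp_eq_Re by simp
  then have 1: "(cmod (F (z + cvec g)))\<^sup>2 = exp (\<nu> * (2 * (a \<bullet> g) + (norm g)\<^sup>2)) * (cmod (F z))\<^sup>2"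
    by (simp add: power_mult_distrib exp_double[symmetric] algebra_simps)
  have "(norm (a + g))\<^sup>2 = (norm a)\<^sup>2 + (2 * (a \<bullet> g) + (norm g)\<^sup>2)"
    unfolding power2_norm_eq_inner by (simp add: inner_add_left inner_add_right inner_commute)
  then have "\<nu> * (2 * (a \<bullet> g) + (norm g)\<^sup>2) + - \<nu> * Re (herm (z + cvec g) (z + cvec g)) = - \<nu> * Re (herm z z)"
    unfolding z cpx_add_cvec herm_cpx_self Re_complex_of_real by (simp add: algebra_simps)
  then have "exp (\<nu> * (2 * (a \<bullet> g) + (norm g)\<^sup>2)) * exp (- \<nu> * Re (herm (z + cvec g) (z + cvec g))) = exp (- \<nu> * Re (herm z z))"
    by (simp only: exp_add[symmetric])
  then show ?thesis unfolding 1 by (simp add: mult_ac)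
qed

lemma herm_borel [measurable]: "(\<lambda>z. Re (herm z z)) \<in> borel_measurable (borel :: (complex^'n) measure)"
proof -
  have "Re (herm z z) = (norm (re_vec z))\<^sup>2 + (norm (im_vec z))\<^sup>2" for z :: "complex^'n"
    using herm_cpx_self[of "re_vec z" "im_vec z"] by (simp del: of_real_add)
  moreover have [measurable]: "im_vec \<in> borel_measurable (borel :: (complex^'n) measure)"
    unfolding im_vec_def by (intro borel_measurable_continuous_onI continuous_on_vec_lambda continuous_intros)
  ultimately show ?thesis by simp
qed

text \<open>After the exchange of \<open>E\<close> for the product domain, the real and the
  imaginary integral are each rescaled by \<open>sqrt 2\<close>; each contributes
  \<open>1 / k\<close> with \<open>k = sqrt 2 ^ d\<close>.\<close>

lemma fock_energy_lift:
  assumes p: "entire p"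
    and per: "\<And>z g. g \<in> \<Gamma>' \<Longrightarrow> lift \<nu> p (z + cvec g) = ch' g * exp (complex_of_real \<nu> * herm (z + cvec g /\<^sub>R 2) (cvec g)) * lift \<nu> p z"
  shows "(\<integral>\<^sup>+z. indicator E z * ennreal ((cmod (lift \<nu> p z))\<^sup>2 * exp (- \<nu> * Re (herm z z))) \<partial>lborel)
    = ennreal (1 / 2 ^ CARD('n)) * fock_energy D (1 / \<nu>) p"
proof -
  note [measurable] = entire_imp_borel_measurable[OF p] entire_imp_borel_measurable[OF entire_lift[OF p]]
  define S where "S = {z::complex^'n. sqrt 2 *\<^sub>R re_vec z \<in> D}"
  have [measurable]: "S \<in> sets borel" unfolding S_def by measurable
  let ?H = "\<lambda>a b. indicator D a * ennreal ((cmod (p (cpx a b)))\<^sup>2 * exp (- (norm b)\<^sup>2 / (1 / \<nu>)))"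
  define k where "k = sqrt 2 ^ CARD('n)"
  have k: "k > 0" "k * k = 2 ^ CARD('n)" unfolding k_def by (simp, subst power_mult_distrib[symmetric], simp)
  have scale: "(\<integral>\<^sup>+x. h (sqrt 2 *\<^sub>R x) \<partial>lborel) = ennreal (1 / k) * (\<integral>\<^sup>+x. h x \<partial>lborel)"
    if [measurable]: "h \<in> borel_measurable borel" for h :: "real^'n \<Rightarrow> ennreal"
  proof -
    have "(\<integral>\<^sup>+x. h x \<partial>lborel) = ennreal k * (\<integral>\<^sup>+x. h (0 + sqrt 2 *\<^sub>R x) \<partial>lborel)"
      by (subst nn_integral_lborel_affine[of "sqrt 2" h 0]) (simp_all add: k_def that)
    then have "ennreal (1 / k) * (\<integral>\<^sup>+x. h x \<partial>lborel) = (ennreal (1 / k) * ennreal k) * (\<integral>\<^sup>+x. h (sqrt 2 *\<^sub>R x) \<partial>lborel)"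
      by (simp add: mult.assoc)
    also have "ennreal (1 / k) * ennreal k = 1" using k by (simp add: ennreal_mult[symmetric])
    finally show ?thesis by simp
  qed
  have "(\<integral>\<^sup>+z. indicator E z * ennreal ((cmod (lift \<nu> p z))\<^sup>2 * exp (- \<nu> * Re (herm z z))) \<partial>lborel)
    = (\<integral>\<^sup>+z. indicator S z * ennreal ((cmod (lift \<nu> p z))\<^sup>2 * exp (- \<nu> * Re (herm z z))) \<partial>lborel)"
  proof (rule nn_integral_domain_independent[OF lattice_domains[folded S_def]])
    show "AE z in lborel. ennreal ((cmod (lift \<nu> p (z + g)))\<^sup>2 * exp (- \<nu> * Re (herm (z + g) (z + g)))) = ennreal ((cmod (lift \<nu> p z))\<^sup>2 * exp (- \<nu> * Re (herm z z)))"
      if "g \<in> cvec ` \<Gamma>'" for g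
      using that cmod_translate_invariant[of "lift \<nu> p", OF per] by (intro AE_I2) auto
  qed measurable
  also have "\<dots> = (\<integral>\<^sup>+a. \<integral>\<^sup>+b. indicator S (cpx a b) * ennreal ((cmod (lift \<nu> p (cpx a b)))\<^sup>2 * exp (- \<nu> * Re (herm (cpx a b) (cpx a b)))) \<partial>lborel \<partial>lborel)"
    by (rule nn_integral_cpx) measurable
  also have "\<dots> = (\<integral>\<^sup>+a. \<integral>\<^sup>+b. ?H (sqrt 2 *\<^sub>R a) (sqrt 2 *\<^sub>R b) \<partial>lborel \<partial>lborel)"
    unfolding lift_weight by (simp add: S_def indicator_def)
  also have "\<dots> = (\<integral>\<^sup>+a. ennreal (1 / k) * (\<integral>\<^sup>+b. ?H (sqrt 2 *\<^sub>R a) b \<partial>lborel) \<partial>lborel)"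
    by (intro nn_integral_cong scale) measurable
  also have "\<dots> = ennreal (1 / k) * (\<integral>\<^sup>+a. (\<integral>\<^sup>+b. ?H (sqrt 2 *\<^sub>R a) b \<partial>lborel) \<partial>lborel)"
    by (rule nn_integral_cmult) measurable
  also have "(\<integral>\<^sup>+a. (\<integral>\<^sup>+b. ?H (sqrt 2 *\<^sub>R a) b \<partial>lborel) \<partial>lborel) = ennreal (1 / k) * (\<integral>\<^sup>+a. (\<integral>\<^sup>+b. ?H a b \<partial>lborel) \<partial>lborel)"
    by (rule scale) measurable
  also have "(\<integral>\<^sup>+a. (\<integral>\<^sup>+b. ?H a b \<partial>lborel) \<partial>lborel) = fock_energy D (1 / \<nu>) p"
    unfolding fock_energy_def by (intro nn_integral_cong nn_integral_cmult) measurable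
  also have "ennreal (1 / k) * (ennreal (1 / k) * fock_energy D (1 / \<nu>) p) = ennreal (1 / 2 ^ CARD('n)) * fock_energy D (1 / \<nu>) p"
    unfolding k(2)[symmetric] using k(1) by (simp add: mult.assoc[symmetric] ennreal_mult[symmetric])
  finally show ?thesis .
qed

lemma theta_Fock_lift:
  assumes p: "entire p" "\<And>z g. g \<in> \<Gamma> \<Longrightarrow> p (z + cvec g) = ch g * p z" "fock_energy D (1 / \<nu>) p < \<infinity>"
  shows "lift \<nu> p \<in> theta_Fock E \<Gamma>' ch' \<nu>"
    and "theta_Fock_norm E \<nu> (lift \<nu> p) = sqrt (enn2real (ennreal (1 / 2 ^ CARD('n)) * fock_energy D (1 / \<nu>) p))"
proof -
  note [measurable] = entire_imp_borel_measurable[OF entire_lift[OF p(1)]]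
  have [measurable]: "E \<in> sets borel" using E by (simp add: fundamental_domain_def)
  have e: "(\<integral>\<^sup>+z. indicator E z * ennreal ((cmod (lift \<nu> p z))\<^sup>2 * exp (- \<nu> * Re (herm z z))) \<partial>lborel)
    = ennreal (1 / 2 ^ CARD('n)) * fock_energy D (1 / \<nu>) p"
    by (rule fock_energy_lift[OF p(1)]) (rule lift_translate[OF p(2)])
  have "set_integrable lborel E (\<lambda>z. (cmod (lift \<nu> p z))\<^sup>2 * exp (- \<nu> * Re (herm z z)))
    \<longleftrightarrow> (\<integral>\<^sup>+z. indicator E z * ennreal ((cmod (lift \<nu> p z))\<^sup>2 * exp (- \<nu> * Re (herm z z))) \<partial>lborel) < \<infinity>"
    by (rule set_integrable_iff_nn_integral(1)) simp_all
  then have "set_integrable lborel E (\<lambda>z. (cmod (lift \<nu> p z))\<^sup>2 * exp (- \<nu> * Re (herm z z)))"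
    unfolding e using p(3) by (simp add: ennreal_mult_less_top)
  then show "lift \<nu> p \<in> theta_Fock E \<Gamma>' ch' \<nu>"
    unfolding theta_Fock_def using entire_lift[OF p(1)] lift_translate[of p, OF p(2)] by simp
  show "theta_Fock_norm E \<nu> (lift \<nu> p) = sqrt (enn2real (ennreal (1 / 2 ^ CARD('n)) * fock_energy D (1 / \<nu>) p))"
  proof -
    have "(LINT z:E|lborel. (cmod (lift \<nu> p z))\<^sup>2 * exp (- \<nu> * Re (herm z z)))
      = enn2real (\<integral>\<^sup>+z. indicator E z * ennreal ((cmod (lift \<nu> p z))\<^sup>2 * exp (- \<nu> * Re (herm z z))) \<partial>lborel)"
      by (rule set_integrable_iff_nn_integral(2)) simp_all
    then show ?thesis unfolding theta_Fock_norm_def e by (simp only:)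
  qed
qed

lemma theta_Fock_obtain_lift:
  assumes F: "F \<in> theta_Fock E \<Gamma>' ch' \<nu>"
  shows "\<exists>p. F = lift \<nu> p \<and> entire p \<and> (\<forall>z. \<forall>g\<in>\<Gamma>. p (z + cvec g) = ch g * p z) \<and> fock_energy D (1 / \<nu>) p < \<infinity>"
proof -
  have [measurable]: "E \<in> sets borel" using E by (simp add: fundamental_domain_def)
  have F': "entire F" "\<And>z g. g \<in> \<Gamma>' \<Longrightarrow> F (z + cvec g) = ch' g * exp (complex_of_real \<nu> * herm (z + cvec g /\<^sub>R 2) (cvec g)) * F z"
    "set_integrable lborel E (\<lambda>z. (cmod (F z))\<^sup>2 * exp (- \<nu> * Re (herm z z)))"
    using F by (auto simp: theta_Fock_def)
  \<comment> \<open>The inverse of \<open>lift\<close>: \<open><w,w>\<close> doubles under the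
    dilation, so \<open>- \<nu> / 4\<close> at \<open>w = sqrt 2 z\<close> undoes
    \<open>\<nu> / 2\<close> at \<open>z\<close>.\<close>
  define p where "p w = exp (complex_of_real (- \<nu> / 4) * bilin w w) * F ((1 / sqrt 2) *\<^sub>R w)" for w
  have s2: "sqrt 2 *\<^sub>R ((1 / sqrt 2) *\<^sub>R w) = w" "(1 / sqrt 2) *\<^sub>R (sqrt 2 *\<^sub>R w) = w" for w :: "complex^'n"
    by simp_all
  have s2': "complex_of_real (sqrt 2) * (complex_of_real (sqrt 2) * c) = 2 * c" for c
    by (simp add: mult.assoc[symmetric] of_real_mult[symmetric] del: of_real_mult)
  have dbl: "bilin (sqrt 2 *\<^sub>R w) (sqrt 2 *\<^sub>R w) = 2 * bilin w w" for w :: "complex^'n"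
    unfolding bilin_scaleR_left bilin_scaleR_right by (rule s2')
  have pF: "F = lift \<nu> p"
  proof
    fix z :: "complex^'n"
    have sum0: "complex_of_real (\<nu> / 2) * bilin z z + complex_of_real (- \<nu> / 4) * bilin (sqrt 2 *\<^sub>R z) (sqrt 2 *\<^sub>R z) = 0"
      unfolding dbl by simp
    have "exp (complex_of_real (\<nu> / 2) * bilin z z) * exp (complex_of_real (- \<nu> / 4) * bilin (sqrt 2 *\<^sub>R z) (sqrt 2 *\<^sub>R z)) = 1"
      unfolding exp_add[symmetric] sum0 by simp
    then show "F z = lift \<nu> p z" unfolding lift_def p_def s2 mult.assoc[symmetric] by simp
  qed
  have pe: "entire p" unfolding p_def[abs_def] by (rule entire_mult[OF entire_exp_bilin entire_scaleR[OF F'(1)]])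
  have pp: "p (w + cvec g) = ch g * p w" if g: "g \<in> \<Gamma>" for w g
  proof -
    define h where "h = (1 / sqrt 2) *\<^sub>R g"
    have h: "h \<in> \<Gamma>'" "ch' h = ch g" using g ch'[OF g] by (auto simp: h_def \<Gamma>')
    have gh: "cvec g = sqrt 2 *\<^sub>R cvec h" unfolding h_def cvec_scaleR s2 ..
    define z where "z = (1 / sqrt 2) *\<^sub>R w"
    have wz: "w = sqrt 2 *\<^sub>R z" unfolding z_def s2 ..
    have wg: "w + cvec g = sqrt 2 *\<^sub>R (z + cvec h)" unfolding wz gh scaleR_add_right ..
    have ex: "complex_of_real (- \<nu> / 4) * bilin (w + cvec g) (w + cvec g) + complex_of_real \<nu> * herm (z + cvec h /\<^sub>R 2) (cvec h) = complex_of_real (- \<nu> / 4) * bilin w w"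
      unfolding wg unfolding wz dbl unfolding herm_cvec bilin_scaleR_left bilin_add_left bilin_add_right bilin_commute[of "cvec h" z]
      by (simp add: field_simps)
    have "p (w + cvec g) = exp (complex_of_real (- \<nu> / 4) * bilin (w + cvec g) (w + cvec g)) * F (z + cvec h)"
      unfolding p_def wg s2 ..
    also have "\<dots> = ch g * ((exp (complex_of_real (- \<nu> / 4) * bilin (w + cvec g) (w + cvec g)) * exp (complex_of_real \<nu> * herm (z + cvec h /\<^sub>R 2) (cvec h))) * F z)"
      unfolding F'(2)[OF h(1)] h(2) by (simp only: mult_ac)
    also have "\<dots> = ch g * p w"
      unfolding exp_add[symmetric] ex p_def z_def[symmetric] ..
    finally show ?thesis .
  qed
  note [measurable] = entire_imp_borel_measurable[OF F'(1)]
  have "set_integrable lborel E (\<lambda>z. (cmod (F z))\<^sup>2 * exp (- \<nu> * Re (herm z z)))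
    \<longleftrightarrow> (\<integral>\<^sup>+z. indicator E z * ennreal ((cmod (F z))\<^sup>2 * exp (- \<nu> * Re (herm z z))) \<partial>lborel) < \<infinity>"
    by (rule set_integrable_iff_nn_integral(1)) simp_all
  with F'(3) have fin: "(\<integral>\<^sup>+z. indicator E z * ennreal ((cmod (F z))\<^sup>2 * exp (- \<nu> * Re (herm z z))) \<partial>lborel) < \<infinity>"
    by simp
  have "(\<integral>\<^sup>+z. indicator E z * ennreal ((cmod (F z))\<^sup>2 * exp (- \<nu> * Re (herm z z))) \<partial>lborel)
    = ennreal (1 / 2 ^ CARD('n)) * fock_energy D (1 / \<nu>) p"
    unfolding pF by (rule fock_energy_lift[OF pe]) (rule lift_translate[OF pp])
  with fin have "ennreal (1 / 2 ^ CARD('n)) * fock_energy D (1 / \<nu>) p < \<infinity>" by simp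
  then have "fock_energy D (1 / \<nu>) p < \<infinity>" by (auto simp: ennreal_mult_less_top)
  then show ?thesis using pF pe pp by blast
qed

end

section \<open>The transform on functions and on classes\<close>

context theta_setting begin

abbreviation L :: "(real^'n \<Rightarrow> complex) set" where "L \<equiv> theta_L2 D \<Gamma> ch \<nu>"

lemma L_D:
  assumes "f \<in> L"
  shows "f \<in> borel_measurable borel" "quasi_periodic (unweight \<nu> f)" "dom_energy D (unweight \<nu> f) < \<infinity>" "tame (unweight \<nu> f)"
  using assms theta_L2_iff quasi_periodic_tame by blast+

lemma inverse_nu_pos: "1 / \<nu> > 0"
  using \<nu> by simp

lemma integrable_bargmann:
  assumes "f \<in> L" shows "integrable lborel (bargmann_integrand \<nu> f z)"
  unfolding bargmann_integrand_eq[OF \<nu>]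
  by (intro integrable_mult_right integrable_heat L_D(4)[OF assms] inverse_nu_pos)

lemma bargmann_cong_AE:
  assumes "f \<in> L" "g \<in> L" "AE x in lborel. f x = g x"
  shows "bargmann \<nu> f = bargmann \<nu> g"
proof
  fix z
  have "(\<integral>x. bargmann_integrand \<nu> f z x \<partial>lborel) = (\<integral>x. bargmann_integrand \<nu> g z x \<partial>lborel)"
  proof (rule integral_cong_AE)
    show "bargmann_integrand \<nu> f z \<in> borel_measurable lborel" "bargmann_integrand \<nu> g z \<in> borel_measurable lborel"
      using integrable_bargmann[OF assms(1)] integrable_bargmann[OF assms(2)] by (auto simp del: measurable_lborel1)
    show "AE x in lborel. bargmann_integrand \<nu> f z x = bargmann_integrand \<nu> g z x"
      using assms(3) by eventually_elim (simp add: bargmann_integrand_def)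
  qed
  then show "bargmann \<nu> f z = bargmann \<nu> g z" by (simp add: bargmann_def)
qed

lemma bargmann_linear:
  assumes "f \<in> L" "g \<in> L"
  shows "bargmann \<nu> (\<lambda>x. a * f x + b * g x) = (\<lambda>z. a * bargmann \<nu> f z + b * bargmann \<nu> g z)"
proof
  fix z
  have "bargmann_integrand \<nu> (\<lambda>x. a * f x + b * g x) z x = a * bargmann_integrand \<nu> f z x + b * bargmann_integrand \<nu> g z x" for x
    unfolding bargmann_integrand_def by (simp add: distrib_left distrib_right mult_ac)
  then show "bargmann \<nu> (\<lambda>x. a * f x + b * g x) z = a * bargmann \<nu> f z + b * bargmann \<nu> g z"
    using integrable_bargmann[OF assms(1)] integrable_bargmann[OF assms(2)]
    by (simp add: bargmann_def algebra_simps)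
qed

abbreviation bargmann_heat :: "(real^'n \<Rightarrow> complex) \<Rightarrow> complex^'n \<Rightarrow> complex" where
  "bargmann_heat u \<equiv> \<lambda>z. complex_of_real (bargmann_const TYPE('n) \<nu>) * heat (1 / \<nu>) u z"

text \<open>All constants meet here: the scaling of \<open>lift\<close>, the factor
  \<open>A^2\<close> and the mass in \<open>heat_isometry\<close> multiply to exactly 1.\<close>

lemma fock_energy_bargmann_heat:
  assumes "quasi_periodic u" "dom_energy D u < \<infinity>"
  shows "ennreal (1 / 2 ^ CARD('n)) * fock_energy D (1 / \<nu>) (bargmann_heat u) = dom_energy D u"
proof -
  note [measurable] = entire_imp_borel_measurable[OF entire_heat[OF quasi_periodic_tame[OF assms] inverse_nu_pos]]
  define A where "A = bargmann_const TYPE('n) \<nu>"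
  have A: "A > 0" unfolding A_def using \<nu> by (rule bargmann_const_pos)
  have sq: "ennreal ((cmod (complex_of_real A * c))\<^sup>2 * e) = ennreal (A\<^sup>2) * ennreal ((cmod c)\<^sup>2 * e)" if "0 \<le> e" for c e
    using that A by (simp add: norm_mult power_mult_distrib ennreal_mult[symmetric] mult.assoc)
  have "fock_energy D (1 / \<nu>) (bargmann_heat u) = (\<integral>\<^sup>+a. ennreal (A\<^sup>2) * (indicator D a * (\<integral>\<^sup>+b. ennreal ((cmod (heat (1 / \<nu>) u (cpx a b)))\<^sup>2 * exp (- (norm b)\<^sup>2 / (1 / \<nu>))) \<partial>lborel)) \<partial>lborel)"
    unfolding fock_energy_def A_def[symmetric]
    by (simp add: sq nn_integral_cmult mult.left_commute)
  also have "\<dots> = ennreal (A\<^sup>2) * fock_energy D (1 / \<nu>) (heat (1 / \<nu>) u)"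
    unfolding fock_energy_def by (rule nn_integral_cmult) measurable
  also have "\<dots> = ennreal (A\<^sup>2) * (ennreal (sqrt (pi * (1 / \<nu>)) ^ CARD('n)) * dom_energy D u)"
    using heat_isometry[OF assms inverse_nu_pos] by simp
  finally have "ennreal (1 / 2 ^ CARD('n)) * fock_energy D (1 / \<nu>) (bargmann_heat u)
    = (ennreal (1 / 2 ^ CARD('n)) * (ennreal (A\<^sup>2) * ennreal (sqrt (pi * (1 / \<nu>)) ^ CARD('n)))) * dom_energy D u"
    by (simp only: mult.assoc)
  also have "ennreal (1 / 2 ^ CARD('n)) * (ennreal (A\<^sup>2) * ennreal (sqrt (pi * (1 / \<nu>)) ^ CARD('n))) = ennreal (1 / 2 ^ CARD('n) * (A\<^sup>2 * sqrt (pi * (1 / \<nu>)) ^ CARD('n)))"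
    using \<nu> by (subst ennreal_mult, simp, simp, subst ennreal_mult) simp_all
  also have "\<dots> = 1" unfolding A_def bargmann_const_sq[OF \<nu>] by simp
  finally show ?thesis by simp
qed

lemma bargmann_heat_props:
  assumes "quasi_periodic u" "dom_energy D u < \<infinity>"
  shows "entire (bargmann_heat u)" "\<And>z g. g \<in> \<Gamma> \<Longrightarrow> bargmann_heat u (z + cvec g) = ch g * bargmann_heat u z"
    "fock_energy D (1 / \<nu>) (bargmann_heat u) < \<infinity>"
proof -
  show "entire (bargmann_heat u)"
    by (intro entire_cmult entire_heat[OF quasi_periodic_tame[OF assms] inverse_nu_pos])
  show "bargmann_heat u (z + cvec g) = ch g * bargmann_heat u z" if "g \<in> \<Gamma>" for z g
    unfolding heat_translate[OF assms(1) that] by (simp only: mult_ac)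
  have "ennreal (1 / 2 ^ CARD('n)) * fock_energy D (1 / \<nu>) (bargmann_heat u) < \<infinity>"
    unfolding fock_energy_bargmann_heat[OF assms] by (rule assms(2))
  then show "fock_energy D (1 / \<nu>) (bargmann_heat u) < \<infinity>" by (auto simp: ennreal_mult_less_top)
qed

lemma bargmann_in_theta_Fock:
  assumes f: "f \<in> L" shows "bargmann \<nu> f \<in> theta_Fock E \<Gamma>' ch' \<nu>"
proof -
  note h = bargmann_heat_props[OF L_D(2,3)[OF f]]
  show ?thesis
    unfolding bargmann_eq_lift[OF \<nu>] by (rule theta_Fock_lift(1)[OF h(1) _ h(3)]) (rule h(2))
qed

lemma bargmann_isometry:
  assumes f: "f \<in> L" shows "theta_Fock_norm E \<nu> (bargmann \<nu> f) = theta_L2_norm D \<nu> f"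
proof -
  note h = bargmann_heat_props[OF L_D(2,3)[OF f]]
  have "theta_Fock_norm E \<nu> (lift \<nu> (bargmann_heat (unweight \<nu> f)))
    = sqrt (enn2real (ennreal (1 / 2 ^ CARD('n)) * fock_energy D (1 / \<nu>) (bargmann_heat (unweight \<nu> f))))"
    by (rule theta_Fock_lift(2)[OF h(1) _ h(3)]) (rule h(2))
  then show ?thesis
    unfolding bargmann_eq_lift[OF \<nu>] fock_energy_bargmann_heat[OF L_D(2,3)[OF f]] theta_L2_norm_eq[OF L_D(1)[OF f]] .
qed

lemma unweight_eq_iff: "unweight \<nu> f x = unweight \<nu> g x \<longleftrightarrow> f x = g x"
  by (simp add: unweight_def)

text \<open>The isometry yields energy 0, which only sees \<open>D\<close>;
  \<open>weighted_bound\<close> carries this to the whole space, where the weight is strictly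
  positive.\<close>

lemma bargmann_inj:
  assumes f: "f \<in> L" and g: "g \<in> L" and eq: "bargmann \<nu> f = bargmann \<nu> g"
  shows "AE x in lborel. f x = g x"
proof -
  let ?u = "unweight \<nu> f" and ?v = "unweight \<nu> g"
  note F = L_D[OF f] and H = L_D[OF g]
  note [measurable] = F(1) H(1)
  have "heat (1 / \<nu>) ?u z = heat (1 / \<nu>) ?v z" for z
  proof -
    have "lift \<nu> (bargmann_heat ?u) ((1 / sqrt 2) *\<^sub>R z) = lift \<nu> (bargmann_heat ?v) ((1 / sqrt 2) *\<^sub>R z)"
      using fun_cong[OF eq] unfolding bargmann_eq_lift[OF \<nu>] .
    then show ?thesis using bargmann_const_pos[OF \<nu>, where 'n='n] by (simp add: lift_def)
  qed
  then have h0: "heat (1 / \<nu>) (\<lambda>x. ?u x - ?v x) = (\<lambda>z. 0)"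
    by (simp add: fun_eq_iff heat_diff[OF F(4) H(4) inverse_nu_pos])
  have q: "quasi_periodic (\<lambda>x. ?u x - ?v x)" by (rule quasi_periodic_diff[OF F(2) H(2)])
  have "dom_energy D (\<lambda>x. ?u x - ?v x) \<le> 2 * dom_energy D ?u + 2 * dom_energy D ?v"
    by (rule dom_energy_diff_le) measurable
  also have "\<dots> < \<infinity>" using F(3) H(3) by (simp add: ennreal_mult_less_top)
  finally have e: "dom_energy D (\<lambda>x. ?u x - ?v x) < \<infinity>" .
  have "ennreal (sqrt (pi * (1 / \<nu>)) ^ CARD('n)) * dom_energy D (\<lambda>x. ?u x - ?v x) = 0"
    using heat_isometry[OF q e inverse_nu_pos] unfolding h0 by (simp add: fock_energy_def)
  then have z: "dom_energy D (\<lambda>x. ?u x - ?v x) = 0" using divide_pos_pos[OF pi_gt_zero \<nu>] by (auto simp: ennreal_eq_0_iff power_le_zero_eq)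
  obtain C where C: "C < \<infinity>" "\<And>u. quasi_periodic u \<Longrightarrow> (\<integral>\<^sup>+x. ennreal (exp (- 1 * (norm x)\<^sup>2) * (cmod (u x))\<^sup>2) \<partial>lborel) \<le> C * dom_energy D u"
    using weighted_bound[of 1] by auto
  have "(\<integral>\<^sup>+x. ennreal (exp (- 1 * (norm x)\<^sup>2) * (cmod (?u x - ?v x))\<^sup>2) \<partial>lborel) = 0"
    using C(2)[OF q] unfolding z by simp
  then have "AE x in lborel. ennreal (exp (- 1 * (norm x)\<^sup>2) * (cmod (?u x - ?v x))\<^sup>2) = 0"
    by (subst (asm) nn_integral_0_iff_AE) measurable
  then show ?thesis
  proof eventually_elim
    case (elim x)
    then have "exp (- 1 * (norm x)\<^sup>2) * (cmod (?u x - ?v x))\<^sup>2 \<le> 0" by (simp only: ennreal_eq_0_iff)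
    then have "(cmod (?u x - ?v x))\<^sup>2 \<le> 0" by (simp add: mult_le_0_iff)
    then have "?u x = ?v x" by simp
    then show ?case by (simp only: unweight_eq_iff)
  qed
qed

text \<open>A preimage under the heat transform, divided by the constant \<open>A\<close> and
  multiplied back by the Gaussian that \<open>unweight\<close> removes, is the function
  sought.\<close>

lemma bargmann_surj:
  assumes F: "F \<in> theta_Fock E \<Gamma>' ch' \<nu>"
  shows "\<exists>f\<in>L. bargmann \<nu> f = F"
proof -
  obtain p where p: "F = lift \<nu> p" "entire p" "\<And>z g. g \<in> \<Gamma> \<Longrightarrow> p (z + cvec g) = ch g * p z" "fock_energy D (1 / \<nu>) p < \<infinity>"
    using theta_Fock_obtain_lift[OF F] by blast
  obtain u where u: "quasi_periodic u" "dom_energy D u < \<infinity>" "heat (1 / \<nu>) u = p"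
    using heat_surjective[OF p(2) p(3) inverse_nu_pos p(4)] by blast
  define A where "A = bargmann_const TYPE('n) \<nu>"
  have A: "A > 0" unfolding A_def using \<nu> by (rule bargmann_const_pos)
  have [measurable]: "u \<in> borel_measurable borel" using u(1) by (simp add: quasi_periodic_def)
  define v where "v x = complex_of_real (1 / A) * u x" for x
  have [measurable]: "v \<in> borel_measurable borel" unfolding v_def[abs_def] by measurable
  have vq: "quasi_periodic v"
    unfolding quasi_periodic_def
  proof (intro conjI ballI)
    fix g assume "g \<in> \<Gamma>"
    then have "AE x in lborel. u (x + g) = ch g * u x" using u(1) by (simp add: quasi_periodic_def)
    then show "AE x in lborel. v (x + g) = ch g * v x" by eventually_elim (simp add: v_def)
  qed measurable
  have "dom_energy D v = (\<integral>\<^sup>+x. ennreal ((1 / A)\<^sup>2) * (indicator D x * ennreal ((cmod (u x))\<^sup>2)) \<partial>lborel)"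
  proof -
    have "ennreal ((cmod (v x))\<^sup>2) = ennreal ((1 / A)\<^sup>2) * ennreal ((cmod (u x))\<^sup>2)" for x
      unfolding v_def using A by (subst ennreal_mult[symmetric]) (simp_all add: norm_mult norm_divide power_divide)
    then show ?thesis unfolding dom_energy_def by (simp only: mult.left_commute)
  qed
  also have "\<dots> = ennreal ((1 / A)\<^sup>2) * dom_energy D u"
    unfolding dom_energy_def by (rule nn_integral_cmult) measurable
  finally have ve: "dom_energy D v < \<infinity>" using u(2) by (simp add: ennreal_mult_less_top)
  define f where "f x = complex_of_real (exp (\<nu> * (norm x)\<^sup>2 / 2)) * v x" for x
  have uf: "unweight \<nu> f = v" unfolding f_def by (rule unweight_inverse)
  have fm: "f \<in> borel_measurable borel" unfolding f_def[abs_def] by measurable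
  have fL: "f \<in> L" unfolding theta_L2_iff uf using fm vq ve by simp
  have "bargmann_heat v = p"
  proof
    fix z
    have "heat (1 / \<nu>) v z = (\<integral>x. complex_of_real (1 / A) * (heat_kernel (1 / \<nu>) (z - cvec x) * u x) \<partial>lborel)"
      unfolding heat_def v_def by (simp only: mult_ac)
    also have "\<dots> = complex_of_real (1 / A) * p z"
      unfolding u(3)[symmetric] heat_def by (rule integral_mult_right_zero)
    finally show "bargmann_heat v z = p z" using A unfolding A_def[symmetric] by simp
  qed
  then have "bargmann \<nu> f = F" unfolding bargmann_eq_lift[OF \<nu>] uf p(1) by simp
  then show ?thesis using fL by blast
qed

lemma ae_class:
  assumes "f \<in> L"
  shows "ae_eq_on L `` {f} = {g \<in> L. AE x in lborel. f x = g x}"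
  using assms by (auto simp: ae_eq_on_def)

text \<open>The image of a class is a singleton, so \<open>the_elem\<close> reads off the transform
  of a class without choosing a representative.\<close>

lemma bargmann_class:
  assumes "f \<in> L"
  shows "the_elem (bargmann \<nu> ` (ae_eq_on L `` {f})) = bargmann \<nu> f"
proof -
  have "bargmann \<nu> ` (ae_eq_on L `` {f}) = {bargmann \<nu> f}"
  proof (intro equalityI subsetI)
    fix F assume "F \<in> bargmann \<nu> ` (ae_eq_on L `` {f})"
    then obtain g where "g \<in> L" "AE x in lborel. f x = g x" "F = bargmann \<nu> g"
      unfolding ae_class[OF assms] by blast
    then show "F \<in> {bargmann \<nu> f}" using bargmann_cong_AE[OF assms] by simp
  qed (use assms in \<open>auto simp: ae_class[OF assms]\<close>)
  then show ?thesis by simp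
qed

lemma bargmann_bij_betw:
  "bij_betw (\<lambda>C. the_elem (bargmann \<nu> ` C)) (L // ae_eq_on L) (theta_Fock E \<Gamma>' ch' \<nu>)"
proof (rule bij_betw_imageI)
  show "inj_on (\<lambda>C. the_elem (bargmann \<nu> ` C)) (L // ae_eq_on L)"
  proof (rule inj_onI)
    fix C C' assume C: "C \<in> L // ae_eq_on L" "C' \<in> L // ae_eq_on L"
      and eq: "the_elem (bargmann \<nu> ` C) = the_elem (bargmann \<nu> ` C')"
    obtain f g where f: "f \<in> L" "C = ae_eq_on L `` {f}" and g: "g \<in> L" "C' = ae_eq_on L `` {g}"
      using C by (auto elim!: quotientE)
    have fg: "AE x in lborel. f x = g x"
      using eq unfolding f(2) g(2) bargmann_class[OF f(1)] bargmann_class[OF g(1)] by (rule bargmann_inj[OF f(1) g(1)])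
    have "(AE x in lborel. f x = h x) \<longleftrightarrow> (AE x in lborel. g x = h x)" for h
    proof
      assume "AE x in lborel. f x = h x"
      with fg show "AE x in lborel. g x = h x" by eventually_elim simp
    next
      assume "AE x in lborel. g x = h x"
      with fg show "AE x in lborel. f x = h x" by eventually_elim simp
    qed
    then show "C = C'" unfolding f(2) g(2) ae_class[OF f(1)] ae_class[OF g(1)] by simp
  qed
  show "(\<lambda>C. the_elem (bargmann \<nu> ` C)) ` (L // ae_eq_on L) = theta_Fock E \<Gamma>' ch' \<nu>"
  proof (intro equalityI subsetI)
    fix F assume "F \<in> (\<lambda>C. the_elem (bargmann \<nu> ` C)) ` (L // ae_eq_on L)"
    then obtain f where "f \<in> L" "F = the_elem (bargmann \<nu> ` (ae_eq_on L `` {f}))"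
      by (auto elim!: quotientE)
    then show "F \<in> theta_Fock E \<Gamma>' ch' \<nu>" by (simp only: bargmann_class bargmann_in_theta_Fock)
  next
    fix F assume "F \<in> theta_Fock E \<Gamma>' ch' \<nu>"
    then obtain f where f: "f \<in> L" "bargmann \<nu> f = F" using bargmann_surj by blast
    then have "F = the_elem (bargmann \<nu> ` (ae_eq_on L `` {f}))" by (simp only: bargmann_class)
    then show "F \<in> (\<lambda>C. the_elem (bargmann \<nu> ` C)) ` (L // ae_eq_on L)"
      using quotientI[OF f(1)] by blast
  qed
qed

end

text \<open>The isomorphism is split into its constituents. Integrability is listed because a
  divergent Bochner integral would silently be 0; linearity and the norm identity are stated for
  representatives, bijectivity for classes.\<close>

theorem theorem2p2:
  fixes \<Gamma> \<Gamma>' D :: "(real^'n) set" and E :: "(complex^'n) set"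
    and ch ch' :: "real^'n \<Rightarrow> complex" and v :: "real^'n" and \<nu> :: real and r :: nat
  assumes "r \<le> CARD('n)"
    and "discrete_subgroup \<Gamma>" and "has_rank \<Gamma> r"
    and "\<nu> > 0"
    and "unitary_character \<Gamma> ch"
    and "v \<in> span \<Gamma>"
    and "\<And>g. g \<in> \<Gamma> \<Longrightarrow> ch g = exp (2 * \<i> * complex_of_real pi * complex_of_real (g \<bullet> v))"
    and "\<Gamma>' = (\<lambda>g. (1 / sqrt 2) *\<^sub>R g) ` \<Gamma>"
    and "\<And>g. g \<in> \<Gamma>' \<Longrightarrow>
           ch' g = exp (2 * \<i> * complex_of_real pi * complex_of_real (g \<bullet> (sqrt 2 *\<^sub>R v)))"
    and "fundamental_domain \<Gamma> D"
    and "fundamental_domain (cvec ` \<Gamma>') E"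
  defines "L \<equiv> theta_L2 D \<Gamma> ch \<nu>"
    and "F \<equiv> theta_Fock E \<Gamma>' ch' \<nu>"
  shows "(\<forall>\<phi>\<in>L. \<forall>z. integrable lborel (bargmann_integrand \<nu> \<phi> z)) \<and>
    bargmann \<nu> respects (ae_eq_on L) \<and>
    (\<forall>\<phi>\<in>L. \<forall>\<psi>\<in>L. \<forall>a b.
       bargmann \<nu> (\<lambda>x. a * \<phi> x + b * \<psi> x) = (\<lambda>z. a * bargmann \<nu> \<phi> z + b * bargmann \<nu> \<psi> z)) \<and>
    (\<forall>\<phi>\<in>L. theta_Fock_norm E \<nu> (bargmann \<nu> \<phi>) = theta_L2_norm D \<nu> \<phi>) \<and>
    bij_betw (\<lambda>C. the_elem (bargmann \<nu> ` C)) (L // ae_eq_on L) F"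
proof -
  interpret theta_setting \<Gamma> D ch \<nu> \<Gamma>' ch' E
  proof
    show "countable \<Gamma>" using assms(2) by (rule discrete_subgroup_countable)
    show "- g \<in> \<Gamma>" if "g \<in> \<Gamma>" for g using assms(2) that by (simp add: discrete_subgroup_def)
    show "cmod (ch g) = 1" if "g \<in> \<Gamma>" for g using assms(5) that by (simp add: unitary_character_def)
    show "ch' ((1 / sqrt 2) *\<^sub>R g) = ch g" if "g \<in> \<Gamma>" for g
    proof -
      have "(1 / sqrt 2) *\<^sub>R g \<in> \<Gamma>'" using that assms(8) by blast
      from assms(9)[OF this] show ?thesis unfolding assms(7)[OF that] by simp
    qed
  qed (fact assms)+
  show ?thesis
    unfolding L_def F_def
    using integrable_bargmann bargmann_linear bargmann_isometry bargmann_bij_betw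
    by (auto intro!: congruentI bargmann_cong_AE simp: ae_eq_on_def)
qed

end
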